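(* Let $V$ be an $\mathbb{R}$-vector space, let $\tau$ be the locally convex topology on $V$ defined by a directed family $\mathcal{S}$ of seminorms on $V$, and let $\overline{\tau}$ be the associated locally multiplicatively convex topology on $S(V)$ (defined in the context). Let $d\ge1$ be an integer. (a) The relation $L(f)=\int_{V^*}\hat f\,d\mu$ for all $f\in S(V)$ defines a one-to-one correspondence $L\leftrightarrow\mu$ between the $\overline{\tau}$-continuous linear functionals $L:S(V)\to\mathbb{R}$ satisfying $L(\sum S(V)^{2d})\subseteq[0,\infty)$ and the nonnegative Radon measures $\mu$ on $V^*$ that are supported by $\overline{B}_i(\rho')$ for some $\rho\in\mathcal{S}$ and some integer $i\ge1$. (b) Let $L\leftrightarrow\mu$ under this correspondence, let $\rho\in\mathcal{S}$ and let $i\ge1$ be an integer. If $\mu$ is supported by $\overline{B}_i(\rho')$ then $L$ is $\overline{i\rho}$-continuous, and conversely. (c) Let $L\leftrightarrow\mu$ under this correspondence, let $\rho\in\mathcal{S}$ and $i\ge1$ be such that $\mu$ is supported by $\overline{B}_i(\rho')$, and let $M$ be any $2d$-power module of $S(V)$. Then $L(M)\subseteq[0,\infty)$ if and only if $\mu$ is supported by $$X_M\cap\overline{B}_i(\rho'):=\{v^*\in\overline{B}_i(\rho'):\hat g(v^* )\ge0\ \ \forall g\in M\}.$$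
   Context: $S(V)=\bigoplus_{k\ge0}S(V)_k$ is the symmetric algebra of $V$ (a commutative unital graded $\mathbb{R}$-algebra with $S(V)_0=\mathbb{R}$, $S(V)_1=V$). Seminorms take values in $[0,\infty)$. For a seminorm $\rho$ on $V$, set $\overline{\rho}_0:=|\cdot|$ on $\mathbb{R}$, and for $k\ge1$, $f\in S(V)_k$, $$\overline{\rho}_k(f):=\inf\Big\{\sum_{i=1}^n\rho(f_{i1})\cdots\rho(f_{ik}):f=\sum_{i=1}^nf_{i1}\cdots f_{ik},\ f_{ij}\in V,\ n\ge1\Big\}.$$ The projective extension of $\rho$ is the (submultiplicative) seminorm on $S(V)$ given by $\overline{\rho}(f):=\sum_{k}\overline{\rho}_k(f_k)$ for $f=\sum_kf_k$, $f_k\in S(V)_k$; $\overline{i\rho}$ denotes the projective extension of the seminorm $i\rho$. A locally convex topology on $V$ is the one generated by a family $\mathcal{S}$ of seminorms; it is not required to be Hausdorff. $\mathcal{S}$ is directed if it is non-empty and for all $\rho_1,\rho_2\in\mathcal{S}$ there are $\rho\in\mathcal{S}$ and $C>0$ with $C\rho\ge\max\{\rho_1,\rho_2\}$ on $V$. $\overline{\tau}$ is the topology on $S(V)$ generated by the family of submultiplicative seminorms $\overline{i\rho}$, $\rho\in\mathcal{S}$, $i\in\{1,2,3,\dots\}$. $\sum S(V)^{2d}$ is the set of finite sums of $2d$-th powers of elements of $S(V)$. A $2d$-power module of $S(V)$ is a subset $M$ with $1\in M$, $M+M\subseteq M$, $a^{2d}M\subseteq M$ for all $a\in S(V)$. $V^*=\operatorname{Hom}(V,\mathbb{R})$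 is the algebraic dual, with the coarsest topology making $v^*\mapsto v^*(f)$ continuous for every $f\in V$. Each $v^*\in V^*$ extends uniquely to a unital $\mathbb{R}$-algebra homomorphism $\overline{v^*}:S(V)\to\mathbb{R}$; $\hat f(v^* ):=\overline{v^*}(f)$ for $f\in S(V)$. For a seminorm $\rho$ on $V$, $\rho'(v^* ):=\inf\{C\in[0,\infty):|v^*(w)|\le C\rho(w)\ \forall w\in V\}$ (with $\inf\emptyset=\infty$), and $\overline{B}_i(\rho'):=\{v^*\in V^*:\rho'(v^* )\le i\}$. A measure $\mu$ on $V^*$ is supported by a Borel set $Y$ if $\mu(V^*\setminus Y)=0$. *)

theory Defs
  imports "HOL-Analysis.Analysis" "HOL-Library.Poly_Mapping" "HOL-Library.Multiset"
begin

section \<open>The symmetric algebra of a real vector space\<close>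

text \<open>\<open>'v multiset \<Rightarrow>\<^sub>0 real\<close> is the polynomial ring over the reals with one indeterminate
  for each vector (a multiset is a monomial). The symmetric algebra is its quotient by the ideal
  which makes \<open>v \<mapsto> free_var v\<close> linear.\<close>

definition free_var :: "'v \<Rightarrow> ('v multiset \<Rightarrow>\<^sub>0 real)"
  where "free_var v = Poly_Mapping.single {#v#} 1"

inductive_set sym_ideal :: "('v::real_vector multiset \<Rightarrow>\<^sub>0 real) set" where
  zero: "0 \<in> sym_ideal"
| add: "p \<in> sym_ideal \<Longrightarrow> q \<in> sym_ideal \<Longrightarrow> p + q \<in> sym_ideal"
| lin_add: "r * (free_var (u + v) - free_var u - free_var v) \<in> sym_ideal"
| lin_scale: "r * (free_var (c *\<^sub>R v) - Poly_Mapping.single 0 c * free_var v) \<in> sym_ideal"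

lemma sym_ideal_mult: "p \<in> sym_ideal \<Longrightarrow> s * p \<in> sym_ideal"
proof (induction rule: sym_ideal.induct)
  case zero
  then show ?case by (simp add: sym_ideal.zero)
next
  case (add p q)
  then show ?case by (simp add: distrib_left sym_ideal.add)
next
  case (lin_add r u v)
  then show ?case using sym_ideal.lin_add[of "s * r" u v] by (simp add: mult.assoc)
next
  case (lin_scale r c v)
  then show ?case using sym_ideal.lin_scale[of "s * r" c v] by (simp add: mult.assoc)
qed

lemma sym_ideal_uminus: "p \<in> sym_ideal \<Longrightarrow> - p \<in> sym_ideal"
  using sym_ideal_mult[of p "-1"] by simp

lemma sym_ideal_diff: "p \<in> sym_ideal \<Longrightarrow> q \<in> sym_ideal \<Longrightarrow> p - q \<in> sym_ideal"
  using sym_ideal.add[of p "- q"] sym_ideal_uminus[of q] by simp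

lemma free_induct [case_names single add]:
  fixes p :: "'k \<Rightarrow>\<^sub>0 'b::comm_monoid_add"
  assumes s: "\<And>m c. P (Poly_Mapping.single m c)" and a: "\<And>p q. P p \<Longrightarrow> P q \<Longrightarrow> P (p + q)"
  shows "P p"
proof (induction p rule: update_induct)
  case const
  then show ?case using s[of undefined 0] by simp
next
  case (update f m b)
  have "Poly_Mapping.update m b f = f + Poly_Mapping.single m b"
    using update(1)
    by (intro poly_mapping_eqI)
       (auto simp: lookup_update lookup_add lookup_single when_def in_keys_iff)
  then show ?case using a[OF update(3) s[of m b]] by simp
qed

definition free_eval :: "('v \<Rightarrow> 'a::{real_algebra_1,comm_ring_1}) \<Rightarrow> ('v multiset \<Rightarrow>\<^sub>0 real) \<Rightarrow> 'a"
  where "free_eval \<phi> p =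
    (\<Sum>m\<in>Poly_Mapping.keys p. Poly_Mapping.lookup p m *\<^sub>R prod_mset (image_mset \<phi> m))"

lemma free_eval_single:
  "free_eval \<phi> (Poly_Mapping.single m c) = c *\<^sub>R prod_mset (image_mset \<phi> m)"
  by (simp add: free_eval_def)

lemma free_eval_add: "free_eval \<phi> (p + q) = free_eval \<phi> p + free_eval \<phi> q"
  unfolding free_eval_def by (rule setsum_keys_plus_distrib) (auto simp: scaleR_left_distrib)

lemma free_eval_zero [simp]: "free_eval \<phi> 0 = 0"
  by (simp add: free_eval_def)

lemma free_eval_uminus: "free_eval \<phi> (- p) = - free_eval \<phi> p"
  using free_eval_add[of \<phi> p "- p"] by (simp add: eq_neg_iff_add_eq_0 add.commute)

lemma free_eval_diff: "free_eval \<phi> (p - q) = free_eval \<phi> p - free_eval \<phi> q"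
  using free_eval_add[of \<phi> p "- q"] by (simp add: free_eval_uminus)

lemma free_eval_one [simp]: "free_eval \<phi> 1 = 1"
  using free_eval_single[of \<phi> 0 1] by simp

lemma free_eval_mult: "free_eval \<phi> (p * q) = free_eval \<phi> p * free_eval \<phi> q"
proof (induction p rule: free_induct)
  case (single m c)
  show ?case
    by (induction q rule: free_induct)
       (simp_all add: mult_single free_eval_single distrib_left free_eval_add)
qed (simp add: distrib_right free_eval_add)

lemma free_eval_sym_ideal:
  assumes "linear \<phi>" "p \<in> sym_ideal"
  shows "free_eval \<phi> p = 0"
  using assms(2)
proof (induction rule: sym_ideal.induct)
  case (lin_add r u v)
  then show ?case using assms(1)
    by (simp add: free_eval_mult free_eval_diff free_var_def free_eval_single linear_add)
next
  case (lin_scale r c v)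
  then show ?case using assms(1)
    by (simp add: free_eval_mult free_eval_diff free_var_def free_eval_single linear_scale)
qed (simp_all add: free_eval_add)

definition sym_rel :: "('v::real_vector multiset \<Rightarrow>\<^sub>0 real) \<Rightarrow> ('v multiset \<Rightarrow>\<^sub>0 real) \<Rightarrow> bool"
  where "sym_rel p q \<longleftrightarrow> p - q \<in> sym_ideal"

lemma sym_rel_trans: "sym_rel p q \<Longrightarrow> sym_rel q r \<Longrightarrow> sym_rel p r"
  using sym_ideal.add[of "p - q" "q - r"] by (simp add: sym_rel_def)

quotient_type (overloaded) 'v symalg = "'v::real_vector multiset \<Rightarrow>\<^sub>0 real" / sym_rel
proof (rule equivpI)
  show "reflp sym_rel" by (simp add: reflp_def sym_rel_def sym_ideal.zero)
  show "symp sym_rel"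
    unfolding symp_def sym_rel_def by (metis minus_diff_eq sym_ideal_uminus)
  show "transp sym_rel"
    using sym_rel_trans by (rule transpI)
qed

instantiation symalg :: (real_vector) comm_ring_1
begin

lift_definition zero_symalg :: "'a symalg" is 0 .
lift_definition one_symalg :: "'a symalg" is 1 .
lift_definition plus_symalg :: "'a symalg \<Rightarrow> 'a symalg \<Rightarrow> 'a symalg" is "(+)"
  unfolding sym_rel_def by (metis add_diff_add sym_ideal.add)
lift_definition uminus_symalg :: "'a symalg \<Rightarrow> 'a symalg" is uminus
  unfolding sym_rel_def by (metis minus_diff_minus sym_ideal_uminus)
lift_definition minus_symalg :: "'a symalg \<Rightarrow> 'a symalg \<Rightarrow> 'a symalg" is "(-)"
  unfolding sym_rel_def
proof -
  fix a b c d :: "'a multiset \<Rightarrow>\<^sub>0 real"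
  assume "a - b \<in> sym_ideal" "c - d \<in> sym_ideal"
  from sym_ideal_diff[OF this] show "a - c - (b - d) \<in> sym_ideal" by (simp add: algebra_simps)
qed
lift_definition times_symalg :: "'a symalg \<Rightarrow> 'a symalg \<Rightarrow> 'a symalg" is "(*)"
  unfolding sym_rel_def
proof -
  fix a b c d :: "'a multiset \<Rightarrow>\<^sub>0 real"
  assume "a - b \<in> sym_ideal" "c - d \<in> sym_ideal"
  then have "c * (a - b) + b * (c - d) \<in> sym_ideal" by (intro sym_ideal.add sym_ideal_mult)
  then show "a * c - b * d \<in> sym_ideal" by (simp add: algebra_simps)
qed

instance
proof
  fix a b c :: "'a symalg"
  have refl: "sym_rel x x" for x :: "'a multiset \<Rightarrow>\<^sub>0 real"
    by (simp add: sym_rel_def sym_ideal.zero)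
  show "a * b * c = a * (b * c)" by transfer (simp add: refl mult.assoc)
  show "a * b = b * a" by transfer (simp add: refl mult.commute)
  show "1 * a = a" by transfer (simp add: refl)
  show "a + b + c = a + (b + c)" by transfer (simp add: refl add.assoc)
  show "a + b = b + a" by transfer (simp add: refl add.commute)
  show "0 + a = a" by transfer (simp add: refl)
  show "- a + a = 0" by transfer (simp add: refl)
  show "a - b = a + - b" by transfer (simp add: refl)
  show "(a + b) * c = a * c + b * c" by transfer (simp add: refl distrib_right)
  show "(0 :: 'a symalg) \<noteq> 1"
  proof transfer
    have "linear (\<lambda>_ :: 'a. 0 :: real)" by (simp add: linear_iff)
    from free_eval_sym_ideal[OF this, of "0 - 1"]
    show "\<not> sym_rel 0 (1 :: 'a multiset \<Rightarrow>\<^sub>0 real)"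
      by (auto simp: sym_rel_def free_eval_uminus)
  qed
qed

end

instantiation symalg :: (real_vector) real_algebra_1
begin

lift_definition scaleR_symalg :: "real \<Rightarrow> 'a symalg \<Rightarrow> 'a symalg"
  is "\<lambda>c p. Poly_Mapping.single 0 c * p"
  unfolding sym_rel_def by (metis right_diff_distrib sym_ideal_mult)

instance
proof
  fix a b :: real and x y :: "'a symalg"
  have refl: "sym_rel p p" for p :: "'a multiset \<Rightarrow>\<^sub>0 real"
    by (simp add: sym_rel_def sym_ideal.zero)
  show "a *\<^sub>R (x + y) = a *\<^sub>R x + a *\<^sub>R y" by transfer (simp add: refl distrib_left)
  show "(a + b) *\<^sub>R x = a *\<^sub>R x + b *\<^sub>R x" by transfer (simp add: refl single_add distrib_right)
  show "a *\<^sub>R b *\<^sub>R x = (a * b) *\<^sub>R x"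
    by transfer (simp add: refl mult_single flip: mult.assoc)
  show "1 *\<^sub>R x = x" by transfer (simp add: refl)
  show "a *\<^sub>R x * y = a *\<^sub>R (x * y)" by transfer (simp add: refl mult.assoc)
  show "x * a *\<^sub>R y = a *\<^sub>R (x * y)" by transfer (simp add: refl mult.left_commute)
qed

end

lift_definition sym_of :: "'v::real_vector \<Rightarrow> 'v symalg" is free_var .

lemma linear_sym_of: "linear (sym_of :: 'v::real_vector \<Rightarrow> _)"
proof (rule linearI)
  fix u v :: 'v and c :: real
  show "sym_of (u + v) = sym_of u + sym_of v"
    using sym_ideal.lin_add[of 1 u v] by transfer (simp add: sym_rel_def algebra_simps)
  show "sym_of (c *\<^sub>R v) = c *\<^sub>R sym_of v"
    using sym_ideal.lin_scale[of 1 c v] by transfer (simp add: sym_rel_def)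
qed

definition alg_hom :: "('a::real_algebra_1 \<Rightarrow> 'b::real_algebra_1) \<Rightarrow> bool"
  where "alg_hom h \<longleftrightarrow> linear h \<and> h 1 = 1 \<and> (\<forall>x y. h (x * y) = h x * h y)"

lemma abs_symalg_single:
  "abs_symalg (Poly_Mapping.single m c) = c *\<^sub>R prod_mset (image_mset sym_of m)"
proof (induction m)
  case empty
  show ?case
    by (simp add: scaleR_symalg.abs_eq one_symalg_def flip: zero_multiset_def)
next
  case (add x m)
  have "Poly_Mapping.single (add_mset x m) c = free_var x * Poly_Mapping.single m c"
    by (simp add: free_var_def mult_single)
  then show ?case
    using add by (simp add: sym_of.abs_eq flip: times_symalg.abs_eq)
qed

lemma symalg_induct [case_names monom add]:
  fixes f :: "'v::real_vector symalg"
  assumes "\<And>c vs. P (c *\<^sub>R prod_list (map sym_of vs))" and "\<And>f g. P f \<Longrightarrow> P g \<Longrightarrow> P (f + g)"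
  shows "P f"
proof (induction f rule: symalg.abs_induct)
  case (1 p)
  show ?case
  proof (induction p rule: free_induct)
    case (single m c)
    obtain vs where "m = mset vs" by (metis ex_mset)
    then show ?case using assms(1)[of c vs] by (simp add: abs_symalg_single prod_mset_prod_list flip: mset_map)
  next
    case (add p q)
    then show ?case using assms(2) by (simp flip: plus_symalg.abs_eq)
  qed
qed

theorem symalg_universal:
  fixes \<phi> :: "'v::real_vector \<Rightarrow> 'a::{real_algebra_1,comm_ring_1}"
  assumes "linear \<phi>"
  shows "\<exists>!h. alg_hom h \<and> (\<forall>v. h (sym_of v) = \<phi> v)"
proof (rule ex_ex1I)
  define h where "h f = free_eval \<phi> (rep_symalg f)" for f
  have h: "h (abs_symalg p) = free_eval \<phi> p" for p
  proof -
    have "sym_rel (rep_symalg (abs_symalg p)) p"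
      by (rule Quotient_rep_abs[OF Quotient_symalg]) (simp add: sym_rel_def sym_ideal.zero)
    then show ?thesis
      using free_eval_sym_ideal[OF assms, of "rep_symalg (abs_symalg p) - p"]
      by (simp add: h_def sym_rel_def free_eval_diff)
  qed
  have "linear h"
  proof (rule linearI)
    fix f g :: "'v symalg" and c :: real
    show "h (f + g) = h f + h g"
      by (induction f rule: symalg.abs_induct, induction g rule: symalg.abs_induct)
         (simp add: plus_symalg.abs_eq h free_eval_add)
    show "h (c *\<^sub>R f) = c *\<^sub>R h f"
      by (induction f rule: symalg.abs_induct)
         (simp add: scaleR_symalg.abs_eq h free_eval_mult free_eval_single)
  qed
  moreover have "h (f * g) = h f * h g" for f g
    by (induction f rule: symalg.abs_induct, induction g rule: symalg.abs_induct)
       (simp add: times_symalg.abs_eq h free_eval_mult)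
  moreover have "h 1 = 1" by (simp add: one_symalg_def h)
  moreover have "h (sym_of v) = \<phi> v" for v
    by (simp add: sym_of.abs_eq h free_var_def free_eval_single)
  ultimately show "\<exists>h. alg_hom h \<and> (\<forall>v. h (sym_of v) = \<phi> v)"
    unfolding alg_hom_def by blast
next
  fix h k assume hk: "alg_hom h \<and> (\<forall>v. h (sym_of v) = \<phi> v)" "alg_hom k \<and> (\<forall>v. k (sym_of v) = \<phi> v)"
  have "h f = k f" for f
  proof (induction f rule: symalg_induct)
    case (monom c vs)
    have "h (prod_list (map sym_of vs)) = k (prod_list (map sym_of vs))"
      using hk by (induction vs) (auto simp: alg_hom_def)
    then show ?case using hk by (simp add: alg_hom_def linear_scale)
  next
    case (add f g)
    then show ?case using hk by (simp add: alg_hom_def linear_add)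
  qed
  then show "h = k" ..
qed

lemma inj_sym_of: "inj (sym_of :: 'v::real_vector \<Rightarrow> _)"
proof (rule linear_injective_0[OF linear_sym_of, THEN iffD2], intro allI impI)
  fix v :: 'v assume v: "sym_of v = 0"
  show "v = 0"
  proof (rule ccontr)
    assume "v \<noteq> 0"
    then have "independent {v}" by simp
    from linear_independent_extend[OF this, of "\<lambda>_. 1 :: real"]
    obtain \<phi> where \<phi>: "linear \<phi>" "\<phi> v = (1 :: real)" by auto
    obtain h where "alg_hom h" "h (sym_of v) = \<phi> v" using symalg_universal[OF \<phi>(1)] by blast
    then show False using v \<phi>(2) by (simp add: alg_hom_def linear_0)
  qed
qed


subsection \<open>Grading\<close>

definition sym_graded :: "nat \<Rightarrow> 'v::real_vector symalg set"
  where "sym_graded k = span {prod_list (map sym_of vs) | vs. length vs = k}"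

definition is_grading :: "'v::real_vector symalg \<Rightarrow> (nat \<Rightarrow> 'v symalg) \<Rightarrow> bool"
  where "is_grading f g \<longleftrightarrow>
    (\<forall>k. g k \<in> sym_graded k) \<and> finite {k. g k \<noteq> 0} \<and> f = (\<Sum>k | g k \<noteq> 0. g k)"

definition hom_comp :: "nat \<Rightarrow> 'v::real_vector symalg \<Rightarrow> 'v symalg"
  where "hom_comp k f = (THE g. is_grading f g) k"

text \<open>The projections of the polynomial ring onto its homogeneous parts preserve
  \<^const>\<open>sym_ideal\<close>; the maps they induce on the quotient show that the homogeneous components are
  well defined.\<close>

lift_definition free_comp :: "nat \<Rightarrow> ('v multiset \<Rightarrow>\<^sub>0 real) \<Rightarrow> ('v multiset \<Rightarrow>\<^sub>0 real)"
  is "\<lambda>k p m. if size m = k then p m else 0"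
  by (rule finite_subset) auto

lemma free_comp_add: "free_comp k (p + q) = free_comp k p + free_comp k q"
  by transfer auto

lemma free_comp_diff: "free_comp k (p - q) = free_comp k p - free_comp k q"
  by transfer auto

lemma free_comp_zero [simp]: "free_comp k 0 = 0"
  by transfer auto

lemma free_comp_single:
  "free_comp k (Poly_Mapping.single m c) = (if size m = k then Poly_Mapping.single m c else 0)"
  by transfer (auto simp: fun_eq_iff when_def)

lemma free_comp_mult_var:
  "free_comp k (r * free_var v) = (if k = 0 then 0 else free_comp (k - 1) r * free_var v)"
proof (induction r rule: free_induct)
  case (single m c)
  then show ?case by (auto simp: free_var_def mult_single free_comp_single)
next
  case (add p q)
  then show ?case by (simp add: distrib_right free_comp_add)
qed

lemma free_comp_scale:
  "free_comp k (Poly_Mapping.single 0 c * r) = Poly_Mapping.single 0 c * free_comp k r"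
proof (induction r rule: free_induct)
  case (single m c)
  then show ?case by (auto simp: mult_single free_comp_single)
next
  case (add p q)
  then show ?case by (simp add: distrib_left free_comp_add)
qed

lemma free_comp_sym_ideal: "p \<in> sym_ideal \<Longrightarrow> free_comp k p \<in> sym_ideal"
proof (induction rule: sym_ideal.induct)
  case zero
  then show ?case by (simp add: sym_ideal.zero)
next
  case (add p q)
  then show ?case by (simp add: free_comp_add sym_ideal.add)
next
  case (lin_add r u v)
  show ?case using sym_ideal.lin_add[of "free_comp (k - 1) r" u v]
    by (cases "k = 0") (simp_all add: sym_ideal.zero right_diff_distrib free_comp_diff free_comp_mult_var)
next
  case (lin_scale r c v)
  have "free_comp k (r * (Poly_Mapping.single 0 c * free_var v)) =
      Poly_Mapping.single 0 c * free_comp k (r * free_var v)"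
    by (subst mult.left_commute) (rule free_comp_scale)
  then have "free_comp k (r * (free_var (c *\<^sub>R v) - Poly_Mapping.single 0 c * free_var v)) =
      (if k = 0 then 0
       else free_comp (k - 1) r * (free_var (c *\<^sub>R v) - Poly_Mapping.single 0 c * free_var v))"
    by (simp add: right_diff_distrib free_comp_diff free_comp_mult_var
        mult.left_commute[of "free_comp (k - Suc 0) r"])
  then show ?case
    using sym_ideal.lin_scale[of "free_comp (k - 1) r" c v] sym_ideal.zero by metis
qed

lift_definition sym_comp :: "nat \<Rightarrow> 'v::real_vector symalg \<Rightarrow> 'v symalg" is free_comp
  unfolding sym_rel_def by (metis free_comp_diff free_comp_sym_ideal)

lemma linear_sym_comp: "linear (sym_comp k :: 'v::real_vector symalg \<Rightarrow> _)"
proof (rule linearI)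
  fix f g :: "'v symalg" and c :: real
  show "sym_comp k (f + g) = sym_comp k f + sym_comp k g"
    by transfer (simp add: free_comp_add sym_rel_def sym_ideal.zero)
  show "sym_comp k (c *\<^sub>R f) = c *\<^sub>R sym_comp k f"
    by transfer (simp add: free_comp_scale sym_rel_def sym_ideal.zero)
qed

lemma sym_comp_monom:
  "sym_comp k (prod_list (map sym_of vs)) = (if length vs = k then prod_list (map sym_of vs) else 0)"
proof -
  have *: "prod_list (map sym_of vs) = abs_symalg (Poly_Mapping.single (mset vs) 1)"
    by (simp add: abs_symalg_single prod_mset_prod_list flip: mset_map)
  show ?thesis unfolding * by (simp add: sym_comp.abs_eq free_comp_single zero_symalg_def)
qed

lemma sym_comp_graded:
  assumes "f \<in> sym_graded j"
  shows "sym_comp k f = (if j = k then f else 0)"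
  using assms unfolding sym_graded_def
proof (induction rule: span_induct_alt)
  case base
  then show ?case by (simp add: linear_0[OF linear_sym_comp])
next
  case (step c x y)
  then show ?case
    by (auto simp: linear_add[OF linear_sym_comp] linear_scale[OF linear_sym_comp] sym_comp_monom)
qed

lemma sum_support:
  fixes g :: "nat \<Rightarrow> 'a::comm_monoid_add"
  assumes "finite A" "{k. g k \<noteq> 0} \<subseteq> A"
  shows "(\<Sum>k | g k \<noteq> 0. g k) = sum g A"
  using assms by (intro sum.mono_neutral_left) auto

lemma is_grading_sym_comp: "is_grading f (\<lambda>k. sym_comp k f)"
proof (induction f rule: symalg_induct)
  case (monom c vs)
  let ?f = "c *\<^sub>R prod_list (map sym_of vs)"
  have f: "?f \<in> sym_graded (length vs)"
    unfolding sym_graded_def by (rule span_scale, rule span_base) auto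
  have fin: "{k. sym_comp k ?f \<noteq> 0} \<subseteq> {length vs}"
    using sym_comp_graded[OF f] by auto
  show ?case unfolding is_grading_def
  proof (intro conjI allI)
    show "sym_comp k ?f \<in> sym_graded k" for k
      unfolding sym_comp_graded[OF f] using f by (auto simp: sym_graded_def span_zero)
    show "finite {k. sym_comp k ?f \<noteq> 0}" using fin by (rule finite_subset) simp
    show "?f = (\<Sum>k | sym_comp k ?f \<noteq> 0. sym_comp k ?f)"
      using sum_support[OF _ fin] sym_comp_graded[OF f] by simp
  qed
next
  case (add f g)
  let ?A = "{k. sym_comp k f \<noteq> 0} \<union> {k. sym_comp k g \<noteq> 0}"
  have A: "finite ?A" using add by (auto simp: is_grading_def)
  have sub: "{k. sym_comp k (f + g) \<noteq> 0} \<subseteq> ?A" by (auto simp: linear_add[OF linear_sym_comp])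
  have "f = (\<Sum>k\<in>?A. sym_comp k f)" "g = (\<Sum>k\<in>?A. sym_comp k g)"
    using sum_support[OF A, of "\<lambda>k. sym_comp k f"] sum_support[OF A, of "\<lambda>k. sym_comp k g"] add
    by (auto simp: is_grading_def)
  then have "f + g = (\<Sum>k\<in>?A. sym_comp k f) + (\<Sum>k\<in>?A. sym_comp k g)"
    by (rule arg_cong2)
  also have "\<dots> = (\<Sum>k\<in>?A. sym_comp k (f + g))"
    by (simp add: linear_add[OF linear_sym_comp] sum.distrib)
  also have "\<dots> = (\<Sum>k | sym_comp k (f + g) \<noteq> 0. sym_comp k (f + g))"
    by (rule sum_support[OF A sub, symmetric])
  finally have eq: "f + g = \<dots>" .
  have "sym_comp k (f + g) \<in> sym_graded k" for k
    using add by (simp add: is_grading_def linear_add[OF linear_sym_comp] sym_graded_def span_add)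
  then show ?case
    unfolding is_grading_def using eq finite_subset[OF sub A] by blast
qed

theorem ex1_grading: "\<exists>!g. is_grading f g"
proof (rule ex1I[of _ "\<lambda>k. sym_comp k f"], rule is_grading_sym_comp)
  fix g assume g: "is_grading f g"
  show "g = (\<lambda>k. sym_comp k f)"
  proof
    fix j
    have "sym_comp j f = (\<Sum>k | g k \<noteq> 0. sym_comp j (g k))"
      using g by (simp add: is_grading_def flip: linear_sum[OF linear_sym_comp])
    also have "\<dots> = (\<Sum>k | g k \<noteq> 0. if k = j then g j else 0)"
    proof (rule sum.cong)
      show "sym_comp j (g k) = (if k = j then g j else 0)" for k
        using g sym_comp_graded[of "g k" k j] by (auto simp: is_grading_def)
    qed simp
    also have "\<dots> = g j" using g by (auto simp: is_grading_def)
    finally show "g j = sym_comp j f" ..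
  qed
qed

lemma hom_comp_eq: "hom_comp k f = sym_comp k f"
  unfolding hom_comp_def
  by (rule fun_cong[of _ "\<lambda>k. sym_comp k f"], rule the1_equality, rule ex1_grading, rule is_grading_sym_comp)


section \<open>Seminorms and their projective extensions\<close>

definition seminorm :: "('a::real_vector \<Rightarrow> real) \<Rightarrow> bool"
  where "seminorm p \<longleftrightarrow> (\<forall>x. 0 \<le> p x) \<and> (\<forall>x y. p (x + y) \<le> p x + p y) \<and>
    (\<forall>c x. p (c *\<^sub>R x) = \<bar>c\<bar> * p x)"

definition directed_family :: "('a \<Rightarrow> real) set \<Rightarrow> bool"
  where "directed_family S \<longleftrightarrow> S \<noteq> {} \<and>
    (\<forall>\<rho>1\<in>S. \<forall>\<rho>2\<in>S. \<exists>\<rho>\<in>S. \<exists>C>0. \<forall>v. max (\<rho>1 v) (\<rho>2 v) \<le> C * \<rho> v)"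

text \<open>The whole space is added to the subbase only so that the topology lives on the whole type
  also for the empty family.\<close>

definition seminorm_topology :: "('a::real_vector \<Rightarrow> real) set \<Rightarrow> 'a topology"
  where "seminorm_topology P =
    topology_generated_by (insert UNIV {{y. p (y - x) < e} | p x e. p \<in> P \<and> e > 0})"

text \<open>In degree \<open>k\<close>, on elements of \<^term>\<open>sym_graded k\<close>; degree \<open>0\<close> consists of the scalars.\<close>

definition proj_seminorm :: "('v::real_vector \<Rightarrow> real) \<Rightarrow> nat \<Rightarrow> 'v symalg \<Rightarrow> real"
  where "proj_seminorm \<rho> k f =
    (if k = 0 then \<bar>THE c. f = of_real c\<bar>
     else Inf {(\<Sum>i=1..n. \<Prod>j=1..k. \<rho> (F i j)) | (n::nat) (F :: nat \<Rightarrow> nat \<Rightarrow> 'v).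
       n \<ge> 1 \<and> f = (\<Sum>i=1..n. \<Prod>j=1..k. sym_of (F i j))})"

definition proj_ext :: "('v::real_vector \<Rightarrow> real) \<Rightarrow> 'v symalg \<Rightarrow> real"
  where "proj_ext \<rho> f = (\<Sum>k | hom_comp k f \<noteq> 0. proj_seminorm \<rho> k (hom_comp k f))"

definition sym_topology :: "('v::real_vector \<Rightarrow> real) set \<Rightarrow> 'v symalg topology"
  where "sym_topology S =
    seminorm_topology {proj_ext (\<lambda>v. real i * \<rho> v) | \<rho> (i::nat). \<rho> \<in> S \<and> i \<ge> 1}"


section \<open>Sums of powers and power modules\<close>

definition sums_of_powers :: "nat \<Rightarrow> 'a::comm_semiring_1 set"
  where "sums_of_powers m = {\<Sum>i<n. a i ^ m | (n::nat) a. True}"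

definition power_module :: "nat \<Rightarrow> 'a::comm_semiring_1 set \<Rightarrow> bool"
  where "power_module m M \<longleftrightarrow>
    1 \<in> M \<and> (\<forall>f\<in>M. \<forall>g\<in>M. f + g \<in> M) \<and> (\<forall>a. \<forall>g\<in>M. a ^ m * g \<in> M)"


section \<open>The algebraic dual\<close>

typedef (overloaded) 'v algdual = "{\<phi> :: 'v::real_vector \<Rightarrow> real. linear \<phi>}"
  morphisms dual_app Abs_algdual
  using linear_zero by blast

instantiation algdual :: (real_vector) t2_space
begin

definition open_algdual :: "'a algdual set \<Rightarrow> bool"
  where "open_algdual =
    generate_topology {{\<phi>. dual_app \<phi> f \<in> U} | f (U :: real set). open U}"

instance
proof
  show "open (UNIV :: 'a algdual set)"
    unfolding open_algdual_def by (rule generate_topology.UNIV)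
  show "open (S \<inter> T)" if "open S" "open T" for S T :: "'a algdual set"
    using that unfolding open_algdual_def by (rule generate_topology.Int)
  show "open (\<Union>K)" if "\<forall>S\<in>K. open S" for K :: "'a algdual set set"
    using that unfolding open_algdual_def by (intro generate_topology.UN) auto
  fix \<phi> \<psi> :: "'a algdual"
  assume "\<phi> \<noteq> \<psi>"
  then obtain f where f: "dual_app \<phi> f \<noteq> dual_app \<psi> f"
    by (auto simp flip: dual_app_inject simp: fun_eq_iff)
  obtain U V where UV: "open U" "open V" "dual_app \<phi> f \<in> U" "dual_app \<psi> f \<in> V" "U \<inter> V = {}"
    using hausdorff[OF f] by blast
  have o: "open {\<eta>. dual_app (\<eta> :: 'a algdual) f \<in> W}" if "open W" for W
  proof -
    have "{\<eta>. dual_app \<eta> f \<in> W} \<in> {{\<phi>. dual_app \<phi> f \<in> U} | f (U :: real set). open U}"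
      using that by blast
    then show ?thesis unfolding open_algdual_def by (rule generate_topology.Basis)
  qed
  have "{\<eta>. dual_app \<eta> f \<in> U} \<inter> {\<eta>. dual_app \<eta> f \<in> V} = {}" using UV(5) by blast
  then show "\<exists>U V. open U \<and> open V \<and> \<phi> \<in> U \<and> \<psi> \<in> V \<and> U \<inter> V = {}"
    using o[OF UV(1)] o[OF UV(2)] UV(3,4) by blast
qed

end

definition sym_eval :: "'v::real_vector algdual \<Rightarrow> 'v symalg \<Rightarrow> real"
  where "sym_eval \<phi> = (THE h. alg_hom h \<and> (\<forall>v. h (sym_of v) = dual_app \<phi> v))"

definition dual_norm :: "('v::real_vector \<Rightarrow> real) \<Rightarrow> 'v algdual \<Rightarrow> ereal"
  where "dual_norm \<rho> \<phi> = Inf {ereal C | C. 0 \<le> C \<and> (\<forall>w. \<bar>dual_app \<phi> w\<bar> \<le> C * \<rho> w)}"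

definition dual_ball :: "('v::real_vector \<Rightarrow> real) \<Rightarrow> nat \<Rightarrow> 'v algdual set"
  where "dual_ball \<rho> i = {\<phi>. dual_norm \<rho> \<phi> \<le> ereal (real i)}"

definition nonneg_set :: "'v::real_vector symalg set \<Rightarrow> 'v algdual set"
  where "nonneg_set M = {\<phi>. \<forall>g\<in>M. 0 \<le> sym_eval \<phi> g}"


section \<open>Radon measures and moment functionals\<close>

definition radon_measure :: "'a::t2_space measure \<Rightarrow> bool"
  where "radon_measure \<mu> \<longleftrightarrow> sets \<mu> = sets borel \<and>
    (\<forall>x. \<exists>U. open U \<and> x \<in> U \<and> emeasure \<mu> U < \<infinity>) \<and>
    (\<forall>B\<in>sets borel. emeasure \<mu> B = (SUP K\<in>{K. compact K \<and> K \<subseteq> B}. emeasure \<mu> K))"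

text \<open>Borel measurability of \<open>Y\<close> has to be demanded, since \<^const>\<open>emeasure\<close> is \<open>0\<close> on
  non-measurable sets.\<close>

definition supported_by :: "'a::topological_space measure \<Rightarrow> 'a set \<Rightarrow> bool"
  where "supported_by \<mu> Y \<longleftrightarrow> Y \<in> sets borel \<and> emeasure \<mu> (- Y) = 0"

definition pos_functionals :: "('v::real_vector \<Rightarrow> real) set \<Rightarrow> nat \<Rightarrow> ('v symalg \<Rightarrow> real) set"
  where "pos_functionals S d = {L. linear L \<and> continuous_map (sym_topology S) euclideanreal L \<and>
    L ` sums_of_powers (2 * d) \<subseteq> {0..}}"

definition ball_measures :: "('v::real_vector \<Rightarrow> real) set \<Rightarrow> 'v algdual measure set"
  where "ball_measures S = {\<mu>. radon_measure \<mu> \<and>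
    (\<exists>\<rho>\<in>S. \<exists>i\<ge>1. supported_by \<mu> (dual_ball \<rho> i))}"

text \<open>Integrability is part of the relation, since the Bochner integral of a non-integrable
  function is \<open>0\<close>.\<close>

definition represents :: "'v::real_vector algdual measure \<Rightarrow> ('v symalg \<Rightarrow> real) \<Rightarrow> bool"
  where "represents \<mu> L \<longleftrightarrow> (\<forall>f. integrable \<mu> (\<lambda>\<phi>. sym_eval \<phi> f) \<and> L f = (\<integral>\<phi>. sym_eval \<phi> f \<partial>\<mu>))"

end

theory Submission
  imports Defs
begin

text \<open>
  Let \<open>L\<close> be continuous and nonnegative on \<open>2d\<close>-th powers. By directedness it is bounded on monomials by a
  multiple of \<open>\<rho> v\<^sub>1 \<cdots> \<rho> v\<^sub>k\<close>, after replacing \<open>\<rho>\<close> by some \<open>i\<rho>\<close>. The elements on which all such functionals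
  are nonnegative form a cone closed under multiplication; by the binomial series of \<open>(1 + x)\<close> to the power
  \<open>1/2d\<close> it contains \<open>r + v\<close> whenever \<open>\<rho> v < r\<close>, so it is an archimedean preprime, and its characters are the
  evaluations at points of the dual ball. The Positivstellensatz for archimedean preprimes then shows \<open>L f \<ge> 0\<close>
  as soon as \<open>f\<close> is nonnegative on the dual ball, which is compact, so that the Riesz representation
  theorem yields the measure. Supports are controlled by the growth of the even moments, and by
  localising the integrals with Stone-Weierstrass approximations of indicator functions.
\<close>

section \<open>Archimedean preprimes\<close>

text \<open>In general \<open>r + v\<close> is not itself a sum of \<open>2d\<close>-th powers: its
  root is an infinite series, which converges only when tested by bounded functionals. This is why
  the powers are replaced by their bipolar: membership is defined by testing, so limits cost
  nothing, and closure under multiplication holds because \<open>y \<mapsto> L (a * y)\<close> is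
  again a functional of the same kind. For \<open>d > 1\<close> the cone is not known in advance to
  contain squares, so characters are obtained from maximal modules over a preprime and not from
  orderings.

  On the measure side, \<open>V*\<close> need not be locally compact, and closed sets such as the
  ball are intersections over possibly uncountably many vectors. The measure is therefore built by
  inner regularity from closed subsets of the ball, with algebra elements in place of continuous
  functions. The Radon property then comes with the construction, and it is what makes uncountable
  intersections of closed sets of full measure manageable.\<close>

lemma alg_homI:
  assumes "linear h" "h 1 = 1" "\<And>x y. h (x * y) = h x * h y"
  shows "alg_hom h"
  using assms by (simp add: alg_hom_def)

text \<open>Squares need not lie in \<open>T\<close>, so this is a preprime and not a preordering.
  The archimedean axiom bounds from above; applied to \<open>- a\<close> it also bounds from
  below.\<close>

locale archimedean_preprime =
  fixes T :: "'a::{real_algebra_1,comm_ring_1} set"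
  assumes add_closed: "a \<in> T \<Longrightarrow> b \<in> T \<Longrightarrow> a + b \<in> T"
    and mult_closed: "a \<in> T \<Longrightarrow> b \<in> T \<Longrightarrow> a * b \<in> T"
    and scalar_mem: "0 \<le> c \<Longrightarrow> of_real c \<in> T"
    and archimedean: "\<exists>r. of_real r - a \<in> T"
begin

lemma zero_mem: "0 \<in> T" and one_mem: "1 \<in> T"
  using scalar_mem[of 0] scalar_mem[of 1] by auto

lemma archimedean_pos: "\<exists>r>0. of_real r - a \<in> T"
proof -
  obtain r where r: "of_real r - a \<in> T" using archimedean by blast
  have "of_real (\<bar>r\<bar> + 1 - r) + (of_real r - a) \<in> T"
    by (intro add_closed scalar_mem r) simp
  moreover have "of_real (\<bar>r\<bar> + 1 - r) + (of_real r - a) = of_real (\<bar>r\<bar> + 1) - a" by simp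
  ultimately show ?thesis by (metis abs_ge_zero add_nonneg_pos zero_less_one)
qed

section \<open>Modules over a preprime and their characters\<close>

definition preprime_module :: "'a set \<Rightarrow> bool"
  where "preprime_module M \<longleftrightarrow> T \<subseteq> M \<and> (\<forall>a\<in>M. \<forall>b\<in>M. a + b \<in> M) \<and> (\<forall>t\<in>T. \<forall>a\<in>M. t * a \<in> M)"

lemma preprime_moduleD:
  assumes "preprime_module M"
  shows "t \<in> T \<Longrightarrow> t \<in> M" "a \<in> M \<Longrightarrow> b \<in> M \<Longrightarrow> a + b \<in> M" "t \<in> T \<Longrightarrow> a \<in> M \<Longrightarrow> t * a \<in> M"
  using assms by (auto simp: preprime_module_def)

text \<open>Modules rather than preprimes are enlarged, because adjoining an element then needs only
  terms linear in \<open>a\<close>: a certificate for \<open>- 1\<close> keeps the form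
  \<open>m + t * a\<close>.\<close>

lemma preprime_module_adjoin:
  assumes M: "preprime_module M"
  shows "preprime_module {m + t * a | m t. m \<in> M \<and> t \<in> T}"
    and "M \<subseteq> {m + t * a | m t. m \<in> M \<and> t \<in> T}"
    and "a \<in> {m + t * a | m t. m \<in> M \<and> t \<in> T}"
proof -
  let ?N = "{m + t * a | m t. m \<in> M \<and> t \<in> T}"
  show sub: "M \<subseteq> ?N" using zero_mem by force
  show "a \<in> ?N" using preprime_moduleD(1)[OF M zero_mem] one_mem by force
  have 1: "x + y \<in> ?N" if xy: "x \<in> ?N" "y \<in> ?N" for x y
  proof -
    obtain m t m' t' where "x = m + t * a" "y = m' + t' * a" "m \<in> M" "m' \<in> M" "t \<in> T" "t' \<in> T"
      using xy by blast
    then show ?thesis using preprime_moduleD(2)[OF M] add_closed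
      by (intro CollectI exI[of _ "m + m'"] exI[of _ "t + t'"]) (auto simp: algebra_simps)
  qed
  have 2: "s * x \<in> ?N" if x: "s \<in> T" "x \<in> ?N" for s x
  proof -
    obtain m t where m: "x = m + t * a" "m \<in> M" "t \<in> T" using x by blast
    have "s * x = s * m + (s * t) * a" unfolding m(1) by (simp add: algebra_simps)
    then show ?thesis using preprime_moduleD(3)[OF M x(1) m(2)] mult_closed[OF x(1) m(3)] by blast
  qed
  show "preprime_module ?N" unfolding preprime_module_def
    using sub preprime_moduleD(1)[OF M] 1 2 by auto
qed

lemma ex_maximal_module:
  assumes M: "preprime_module M" "- 1 \<notin> M"
  shows "\<exists>N. preprime_module N \<and> - 1 \<notin> N \<and> M \<subseteq> N \<and>
    (\<forall>X. preprime_module X \<longrightarrow> - 1 \<notin> X \<longrightarrow> N \<subseteq> X \<longrightarrow> X = N)"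
proof -
  let ?A = "{N. preprime_module N \<and> - 1 \<notin> N \<and> M \<subseteq> N}"
  have "\<exists>N\<in>?A. \<forall>X\<in>?A. N \<subseteq> X \<longrightarrow> X = N"
  proof (rule subset_Zorn_nonempty)
    show "?A \<noteq> {}" using M by blast
    fix C assume C: "C \<noteq> {}" "subset.chain ?A C"
    then have CA: "C \<subseteq> ?A" and lin: "\<And>X Y. X \<in> C \<Longrightarrow> Y \<in> C \<Longrightarrow> X \<subseteq> Y \<or> Y \<subseteq> X"
      by (auto simp: subset_chain_def)
    have "preprime_module (\<Union>C)"
      unfolding preprime_module_def
    proof (intro conjI ballI)
      obtain X where "X \<in> C" using C(1) by blast
      then show "T \<subseteq> \<Union>C" using CA unfolding preprime_module_def by blast
      show "t * a \<in> \<Union>C" if "t \<in> T" "a \<in> \<Union>C" for t a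
        using that CA unfolding preprime_module_def by blast
      fix a b assume "a \<in> \<Union>C" "b \<in> \<Union>C"
      then obtain X where "X \<in> C" "a \<in> X" "b \<in> X" using lin by blast
      then show "a + b \<in> \<Union>C" using CA unfolding preprime_module_def by blast
    qed
    then show "\<Union>C \<in> ?A" using C(1) CA by auto
  qed
  then obtain N where "N \<in> ?A" and max: "\<forall>X\<in>?A. N \<subseteq> X \<longrightarrow> X = N" by blast
  then have N: "preprime_module N" "- 1 \<notin> N" "M \<subseteq> N" by auto
  have "X = N" if "preprime_module X" "- 1 \<notin> X" "N \<subseteq> X" for X
    using max that N(3) by simp
  then show ?thesis using N by (intro exI[of _ N]) simp
qed

text \<open>Otherwise adjoining \<open>a\<close> and adjoining \<open>- a\<close> both produce
  \<open>- 1\<close>. Eliminating \<open>a\<close> between the two certificates puts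
  \<open>- t\<close> into \<open>M\<close>, and an archimedean bound for \<open>- a\<close> turns
  this into \<open>- 1 \<in> M\<close>.\<close>

lemma maximal_module_total:
  assumes M: "preprime_module M" "- 1 \<notin> M"
    and max: "\<And>X. preprime_module X \<Longrightarrow> - 1 \<notin> X \<Longrightarrow> M \<subseteq> X \<Longrightarrow> X = M"
  shows "a \<in> M \<or> - a \<in> M"
proof (rule ccontr)
  assume *: "\<not> ?thesis"
  note D = preprime_moduleD[OF M(1)]
  have "\<exists>m t. - 1 = m + t * b \<and> m \<in> M \<and> t \<in> T" if "b \<notin> M" for b
    using preprime_module_adjoin[OF M(1), of b] max that by blast
  then obtain s t s' t' where st: "- 1 = s + t * a" "s \<in> M" "t \<in> T"
      "- 1 = s' + t' * (- a)" "s' \<in> M" "t' \<in> T"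
    using * by metis
  \<comment> \<open>Cross-multiplying by \<open>t'\<close> and \<open>t\<close> cancels the terms in
    \<open>a\<close> and leaves \<open>- t' - t\<close>.\<close>
  have "t' * s + t * s' = t' * (s + t * a) + t * (s' + t' * (- a))" by (simp add: algebra_simps)
  then have "t' * s + t * s' + t' = - t" unfolding st(1,4)[symmetric] by simp
  then have nt: "- t \<in> M" using st D by metis
  obtain n where n: "n > 0" "of_real n - (- a) \<in> T" using archimedean_pos by blast
  have "- 1 = s + (of_real n - (- a)) * t + of_real n * (- t)"
    by (subst st(1)) (simp add: algebra_simps)
  moreover have "\<dots> \<in> M"
    by (intro D(2) D(3) D(1)[OF st(3)] st n nt scalar_mem less_imp_le)
  ultimately show False using M(2) by metis
qed

text \<open>\<open>h a\<close> is the Dedekind cut of the reals that lie below \<open>a\<close> with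
  respect to \<open>M\<close>; totality closes the gap, so \<open>h a\<close> is pinned down from
  both sides up to every \<open>e > 0\<close>, and linearity can be read off. Multiplicativity is
  less direct, since \<open>M\<close> is stable under multiplication by \<open>T\<close> only: the
  kernel of \<open>h\<close> is first shown to be an ideal.\<close>

lemma total_module_character:
  assumes M: "preprime_module M" "- 1 \<notin> M" and total: "\<And>a. a \<in> M \<or> - a \<in> M"
  shows "\<exists>h::'a \<Rightarrow> real. alg_hom h \<and> (\<forall>a\<in>M. 0 \<le> h a)"
proof -
  note D = preprime_moduleD[OF M(1)]
  have scal: "0 \<le> r" if "of_real r \<in> M" for r :: real
  proof (rule ccontr)
    assume "\<not> 0 \<le> r"
    then have "of_real (1 / - r) * of_real r \<in> M"
      using that by (intro D(3) scalar_mem) auto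
    moreover have "of_real (1 / - r) * (of_real r :: 'a) = - 1"
      using \<open>\<not> 0 \<le> r\<close> unfolding of_real_mult[symmetric] by simp
    ultimately show False using M(2) by metis
  qed
  define h where "h a = Sup {r. a - of_real r \<in> M}" for a
  have lower_le: "r \<le> s" if "a - of_real r \<in> M" "of_real s - a \<in> M" for a and r s :: real
    using scal[of "s - r"] D(2)[OF that] by simp
  have upper: "\<exists>s. of_real s - a \<in> M" for a using archimedean D(1) by blast
  have lower: "\<exists>r. a - of_real r \<in> M" for a
  proof -
    obtain s where "of_real s - (- a) \<in> M" using upper by blast
    then have "a - of_real (- s) \<in> M" by (simp add: add.commute)
    then show ?thesis by blast
  qed
  have bdd: "bdd_above {r. a - of_real r \<in> M}" for a
    using upper lower_le by (metis (mono_tags, lifting) bdd_aboveI mem_Collect_eq)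
  have le_chi: "r \<le> h a" if "a - of_real r \<in> M" for a r
    unfolding h_def using bdd that by (intro cSup_upper) auto
  have chi_le: "h a \<le> r" if "of_real r - a \<in> M" for a r
    unfolding h_def using lower lower_le that by (intro cSup_least) auto
  have below: "a - of_real (h a - e) \<in> M" if "e > 0" for a e
    using chi_le[of "h a - e" a] total[of "a - of_real (h a - e)"] that by force
  have above: "of_real (h a + e) - a \<in> M" if "e > 0" for a e
    using le_chi[of a "h a + e"] total[of "of_real (h a + e) - a"] that by force
  have eqI: "h a = c" if "\<And>e. e > 0 \<Longrightarrow> a - of_real (c - e) \<in> M" "\<And>e. e > 0 \<Longrightarrow> of_real (c + e) - a \<in> M" for a c
  proof (rule antisym)
    show "h a \<le> c" by (rule field_le_epsilon) (use chi_le that in blast)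
    show "c \<le> h a" 
      by (rule field_le_epsilon) (metis le_chi that(1) diff_le_eq)
  qed
  have add: "h (a + b) = h a + h b" for a b
  proof (rule eqI)
    fix e :: real assume "e > 0"
    then show "a + b - of_real (h a + h b - e) \<in> M" "of_real (h a + h b + e) - (a + b) \<in> M"
      using D(2)[OF below[of "e/2" a] below[of "e/2" b]] D(2)[OF above[of "e/2" a] above[of "e/2" b]]
      by (simp_all add: algebra_simps flip: of_real_add)
  qed
  have minus: "h (- a) = - h a" for a
  proof (rule eqI)
    fix e :: real assume "e > 0"
    then show "- a - of_real (- h a - e) \<in> M" "of_real (- h a + e) - (- a) \<in> M"
      using below[of e a] above[of e a] by (simp_all add: algebra_simps)
  qed
  have scale_pos: "h (c *\<^sub>R a) = c * h a" if c: "c > 0" for c a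
  proof (rule eqI)
    fix e :: real assume "e > 0"
    then have e: "e / c > 0" using c by simp
    have "of_real c * (a - of_real (h a - e / c)) \<in> M"
         "of_real c * (of_real (h a + e / c) - a) \<in> M"
      using c by (auto intro!: D(3) scalar_mem below[OF e] above[OF e] simp del: of_real_add of_real_diff)
    moreover have "of_real c * (a - of_real (h a - e / c)) = c *\<^sub>R a - of_real (c * h a - e)"
      "of_real c * (of_real (h a + e / c) - a) = of_real (c * h a + e) - c *\<^sub>R a"
      using c by (simp_all add: scaleR_conv_of_real right_diff_distrib distrib_left flip: of_real_mult)
    ultimately show "c *\<^sub>R a - of_real (c * h a - e) \<in> M" "of_real (c * h a + e) - c *\<^sub>R a \<in> M"
      by simp_all
  qed
  have zero: "h 0 = 0" using add[of 0 0] by simp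
  have scale: "h (c *\<^sub>R a) = c * h a" for c a
    using scale_pos[of c a] scale_pos[of "- c" a] minus[of "c *\<^sub>R a"] zero
    by (cases c "0::real" rule: linorder_cases) simp_all
  have lin: "linear h" by (rule linearI) (simp_all add: add scale)
  have nonneg: "0 \<le> h a" if "a \<in> M" for a using le_chi[of a 0] that by simp
  have one: "h 1 = 1"
  proof (rule eqI)
    fix e :: real assume "e > 0"
    then have "of_real e \<in> M" by (intro D(1) scalar_mem) simp
    then show "1 - of_real (1 - e) \<in> M" "of_real (1 + e) - 1 \<in> M" by simp_all
  qed
  \<comment> \<open>For \<open>h b = 0\<close> the sum \<open>e * (n - t) + t * (b + e)\<close>
    collapses to \<open>n * e + t * b\<close>; taking \<open>a\<close> and \<open>- a\<close> for
    \<open>b\<close> squeezes \<open>h (t * a)\<close> to \<open>0\<close>.\<close>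
  have null_T: "h (t * a) = 0" if a: "h a = 0" and t: "t \<in> T" for a t
  proof -
    obtain n where n: "n > 0" "of_real n - t \<in> T" using archimedean_pos by blast
    have "of_real (n * e) + t * b \<in> M" if b: "h b = 0" and "e > 0" for b e
    proof -
      have "of_real e * (of_real n - t) + t * (b - of_real (h b - e)) \<in> M"
        using that by (intro D t n below mult_closed scalar_mem) auto
      then show ?thesis by (simp add: b algebra_simps)
    qed
    from this[of a "_ / n"] this[of "- a" "_ / n"] minus[of a] a n(1) show ?thesis
      by (intro eqI) (simp_all add: add.commute)
  qed
  \<comment> \<open>Every \<open>b\<close> is \<open>n - (n - b)\<close> with
    \<open>n - b \<in> T\<close>, so multipliers from \<open>T\<close> suffice.\<close>
  have null: "h (b * a) = 0" if a: "h a = 0" for a b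
  proof -
    obtain n where n: "n > 0" "of_real n - b \<in> T" using archimedean_pos by blast
    have "b * a = n *\<^sub>R a + - ((of_real n - b) * a)"
      by (simp add: scaleR_conv_of_real algebra_simps)
    then show ?thesis using null_T[OF a n(2)] by (simp only: add scale minus a)
  qed
  have "h (a * b) = h a * h b" for a b
  proof -
    have "h (b - h b *\<^sub>R 1) = 0" using linear_diff[OF lin] scale one by simp
    from null[OF this, of a] have "h (a * b - h b *\<^sub>R a) = 0"
      by (simp add: right_diff_distrib)
    then show ?thesis using linear_diff[OF lin] scale by simp
  qed
  then show ?thesis using lin one nonneg by (auto intro!: alg_homI)
qed

text \<open>If \<open>- 1\<close> were missing from the module \<open>T - f * T\<close>, a maximal
  module above it would give a character with \<open>h f \<le> 0\<close>. Hence
  \<open>t * f = 1 + s\<close> with \<open>s, t \<in> T\<close>. As one cannot divide by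
  \<open>t\<close>, membership of \<open>f\<close> is reached from some \<open>r + f \<in> T\<close>
  by lowering \<open>r\<close> in steps of a fixed size.\<close>

theorem positivstellensatz:
  assumes pos: "\<And>h::'a \<Rightarrow> real. alg_hom h \<Longrightarrow> (\<And>t. t \<in> T \<Longrightarrow> 0 \<le> h t) \<Longrightarrow> 0 < h f"
  shows "f \<in> T"
proof -
  have T: "preprime_module T" by (simp add: preprime_module_def add_closed mult_closed)
  let ?M = "{m + t * (- f) | m t. m \<in> T \<and> t \<in> T}"
  note M = preprime_module_adjoin[OF T, of "- f"]
  have "- 1 \<in> ?M"
  proof (rule ccontr)
    assume "- 1 \<notin> ?M"
    from ex_maximal_module[OF M(1) this] obtain N where N: "preprime_module N" "- 1 \<notin> N" "?M \<subseteq> N"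
        "\<And>X. preprime_module X \<Longrightarrow> - 1 \<notin> X \<Longrightarrow> N \<subseteq> X \<Longrightarrow> X = N" by blast
    obtain h :: "'a \<Rightarrow> real" where h: "alg_hom h" "\<And>a. a \<in> N \<Longrightarrow> 0 \<le> h a"
      using total_module_character[OF N(1,2) maximal_module_total[OF N(1,2,4)]] by blast
    have "0 < h f" using pos h preprime_moduleD(1)[OF N(1)] by blast
    moreover have "0 \<le> h (- f)" using h(2) M(3) N(3) by blast
    ultimately show False using h(1) by (simp add: alg_hom_def linear_neg)
  qed
  then obtain s t where st: "- 1 = s + t * (- f)" "s \<in> T" "t \<in> T" by blast
  then have s: "t * f - 1 = s" by (simp add: algebra_simps)
  obtain n where n: "n > 0" "of_real n - t \<in> T" using archimedean_pos by blast
  \<comment> \<open>From \<open>t * f - 1 = s\<close> one gets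
    \<open>(n - t) * (r + f) + s + r * t = n * (r + f) - 1\<close>, where every summand on the left
    lies in \<open>T\<close>.\<close>
  have step: "of_real (r - 1 / n) + f \<in> T" if r: "of_real r + f \<in> T" "r \<ge> 0" for r
  proof -
    have "of_real (1 / n) * ((of_real n - t) * (of_real r + f) + s + of_real r * t) \<in> T"
      using n by (intro mult_closed[OF scalar_mem] add_closed[OF add_closed]
          mult_closed[OF n(2) r(1)] st(2) mult_closed[OF scalar_mem st(3)] r(2)) auto
    moreover have "(of_real n - t) * (of_real r + f) + s + of_real r * t =
        of_real n * (of_real (r - 1 / n) + f)"
      using n(1) unfolding s[symmetric] by (simp add: algebra_simps flip: of_real_mult)
    ultimately have "of_real (1 / n) * (of_real n * (of_real (r - 1 / n) + f)) \<in> T" by metis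
    moreover have "of_real (1 / n) * (of_real n * (of_real (r - 1 / n) + f)) = of_real (r - 1 / n) + f"
      using n(1) unfolding mult.assoc[symmetric] of_real_mult[symmetric] by simp
    ultimately show ?thesis by metis
  qed
  obtain r0 where r0: "r0 > 0" "of_real r0 - (- f) \<in> T" using archimedean_pos by blast
  \<comment> \<open>The second alternative catches the overshoot: once the constant is negative,
    adding its absolute value as a scalar gives \<open>f\<close> itself.\<close>
  have "of_real (r0 - real k / n) + f \<in> T \<or> f \<in> T" for k
  proof (induction k)
    case 0
    then show ?case using r0 by simp
  next
    case (Suc k)
    show ?case
    proof (cases "r0 - real k / n \<ge> 0")
      case True
      then show ?thesis using Suc step[of "r0 - real k / n"] by (auto simp: add_divide_distrib algebra_simps)
    next
      case False
      then show ?thesis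
        using Suc add_closed[OF scalar_mem, of "real k / n - r0" "of_real (r0 - real k / n) + f"]
        by auto
    qed
  qed
  moreover obtain k where k: "r0 * n < real k" using reals_Archimedean2 by blast
  ultimately have "of_real (r0 - real k / n) + f \<in> T \<or> f \<in> T" by blast
  moreover have "real k / n - r0 \<ge> 0" using k n(1) by (simp add: field_simps)
  ultimately show ?thesis
    using add_closed[OF scalar_mem, of "real k / n - r0" "of_real (r0 - real k / n) + f"]
    by auto
qed

end

section \<open>Roots by the binomial series\<close>

abbreviation real_poly :: "'a::{real_algebra_1,comm_ring_1} \<Rightarrow> real poly \<Rightarrow> 'a"
  where "real_poly x p \<equiv> poly (map_poly of_real p) x"

lemma real_poly_pCons: "real_poly x (pCons a p) = of_real a + x * real_poly x p"
  by (simp add: map_poly_pCons)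

lemma real_poly_add: "real_poly x (p + q) = real_poly x p + real_poly x q"
  by (induction p q rule: poly_induct2) (simp_all add: real_poly_pCons algebra_simps)

lemma real_poly_smult: "real_poly x (smult c p) = of_real c * real_poly x p"
  by (induction p) (simp_all add: real_poly_pCons algebra_simps)

lemma real_poly_mult: "real_poly x (p * q) = real_poly x p * real_poly x q"
  by (induction p) (simp_all add: real_poly_pCons real_poly_add real_poly_smult algebra_simps)

lemma real_poly_power: "real_poly x (p ^ n) = real_poly x p ^ n"
  by (induction n) (simp_all add: real_poly_mult)

lemma real_poly_altdef: "real_poly x p = (\<Sum>i\<le>degree p. coeff p i *\<^sub>R x ^ i)"
proof -
  have "degree (map_poly of_real p :: 'a poly) = degree p"
    by (rule degree_map_poly) simp
  then show ?thesis by (simp add: poly_altdef coeff_map_poly scaleR_conv_of_real)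
qed

text \<open>Coefficient \<open>n\<close> of a power depends only on the coefficients up to
  \<open>n\<close>, so a long enough truncation has the same one as the full series.\<close>

lemma fps_power_nth_cong:
  fixes f g :: "'a::comm_ring_1 fps"
  assumes "\<And>i. i \<le> n \<Longrightarrow> fps_nth f i = fps_nth g i"
  shows "fps_nth (f ^ m) n = fps_nth (g ^ m) n"
  using assms
proof (induction m arbitrary: n)
  case (Suc m)
  then show ?case by (simp add: fps_mult_nth)
qed simp

text \<open>Supplies one bound for the coefficients of powers that is valid for all truncations of a
  series at the same time.\<close>

lemma fps_power_nth_abs_le:
  fixes f g :: "real fps"
  assumes "\<And>i. \<bar>fps_nth f i\<bar> \<le> fps_nth g i"
  shows "\<bar>fps_nth (f ^ m) n\<bar> \<le> fps_nth (g ^ m) n"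
proof (induction m arbitrary: n)
  case (Suc m)
  have "\<bar>fps_nth (f ^ Suc m) n\<bar> \<le> (\<Sum>i=0..n. \<bar>fps_nth f i\<bar> * \<bar>fps_nth (f ^ m) (n - i)\<bar>)"
    unfolding power_Suc fps_mult_nth by (rule order.trans[OF sum_abs]) (simp add: abs_mult)
  also have "\<dots> \<le> (\<Sum>i=0..n. fps_nth g i * fps_nth (g ^ m) (n - i))"
    using Suc assms abs_ge_zero order.trans by (intro sum_mono mult_mono) (blast | simp)+
  finally show ?case by (simp add: fps_mult_nth)
qed simp

text \<open>The truncations \<open>q\<close> of the binomial series of \<open>(1 + x)\<^sup>1\<^sup>/\<^sup>m\<close> satisfy \<open>L (q\<^sup>m) \<longrightarrow> L (1 + x)\<close>.\<close>

lemma power_positive_one_plus: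
  fixes L :: "'a::{real_algebra_1,comm_ring_1} \<Rightarrow> real"
  assumes L: "linear L" and m: "m \<ge> 1" and pos: "\<And>a. 0 \<le> L (a ^ m)"
    and bound: "\<And>j. \<bar>L (x ^ j)\<bar> \<le> C * t ^ j" and t: "0 \<le> t" "t < 1"
  shows "0 \<le> L (1 + x)"
proof -
  define c where "c = fps_binomial (1 / real m)"
  \<comment> \<open>Coefficientwise absolute values dominate every truncation and keep the radius of
    convergence, which is at least \<open>1\<close>; with \<open>t < 1\<close> the bound below
    becomes summable.\<close>
  define c' where "c' = Abs_fps (\<lambda>n. norm (fps_nth c n))"
  define q where "q N = (\<Sum>k<N. monom (fps_nth c k) k)" for N
  have coeff_q: "coeff (q N) k = (if k < N then fps_nth c k else 0)" for N k
    by (simp add: q_def coeff_sum)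
  have cm: "c ^ m = 1 + fps_X"
    using m by (simp add: c_def fps_binomial_power fps_binomial_1)
  define a where "a k N = coeff (q N ^ m) k * L (x ^ k)" for k N
  define b where "b k = fps_nth (1 + fps_X) k * L (x ^ k)" for k
  have C: "C \<ge> 0" using bound[of 0] by simp
  have lim: "(\<lambda>N. a k N) \<longlonglongrightarrow> b k" for k
  proof (rule tendsto_eventually, rule eventually_sequentiallyI)
    fix N assume "Suc k \<le> N"
    then have "fps_nth (fps_of_poly (q N) ^ m) k = fps_nth (c ^ m) k"
      by (intro fps_power_nth_cong) (simp add: coeff_q)
    then show "a k N = b k" by (simp add: a_def b_def cm flip: fps_of_poly_power)
  qed
  have le: "norm (a k N) \<le> C * (fps_nth (c' ^ m) k * t ^ k)" for k N
  proof -
    have "\<bar>coeff (q N ^ m) k\<bar> \<le> fps_nth (c' ^ m) k"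
      using fps_power_nth_abs_le[of "fps_of_poly (q N)" c' m k]
      by (simp add: coeff_q c'_def flip: fps_of_poly_power)
    then have "\<bar>coeff (q N ^ m) k\<bar> * \<bar>L (x ^ k)\<bar> \<le> fps_nth (c' ^ m) k * (C * t ^ k)"
      using bound by (intro mult_mono) (auto intro: order.trans[OF abs_ge_zero])
    then show ?thesis by (simp add: a_def abs_mult mult_ac)
  qed
  have "1 \<le> fps_conv_radius c" by (simp add: c_def fps_conv_radius_binomial)
  also have "\<dots> = fps_conv_radius c'" by (simp only: c'_def fps_conv_radius_norm)
  also have "\<dots> \<le> fps_conv_radius (c' ^ m)" by (rule fps_conv_radius_power)
  finally have "ereal (norm t) < fps_conv_radius (c' ^ m)"
    using t by (metis abs_of_nonneg ereal_less(3) less_le_trans real_norm_def)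
  then have "summable (\<lambda>k. C * (fps_nth (c' ^ m) k * t ^ k))"
    by (intro summable_mult summable_fps)
  \<comment> \<open>Tannery's theorem is dominated convergence for series; each \<open>a k N\<close>
    is eventually constant in \<open>N\<close>.\<close>
  from tannerys_theorem[where F = sequentially and a = a and b = b, OF lim always_eventually this] le
  have "(\<lambda>N. suminf (\<lambda>k. a k N)) \<longlonglongrightarrow> suminf b" by (simp add: split_beta)
  moreover have "0 \<le> suminf (\<lambda>k. a k N)" for N
  proof -
    have "suminf (\<lambda>k. a k N) = (\<Sum>k\<le>degree (q N ^ m). a k N)"
      by (rule suminf_finite) (auto simp: a_def coeff_eq_0)
    also have "\<dots> = L (real_poly x (q N ^ m))"
      unfolding real_poly_altdef by (simp add: a_def linear_sum[OF L] linear_scale[OF L])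
    finally show ?thesis using pos by (simp add: real_poly_power)
  qed
  ultimately have "0 \<le> suminf b" by (meson LIMSEQ_le_const)
  also have "\<dots> = (\<Sum>k\<in>{0, 1}. b k)"
    by (rule suminf_finite) (auto simp: b_def)
  also have "\<dots> = L (1 + x)" by (simp add: b_def linear_add[OF L])
  finally show ?thesis .
qed

section \<open>The projective extension of a seminorm\<close>

abbreviation sym_monom :: "'v::real_vector list \<Rightarrow> 'v symalg"
  where "sym_monom vs \<equiv> prod_list (map sym_of vs)"

lemma seminormD:
  assumes "seminorm p"
  shows "0 \<le> p x" "p (x + y) \<le> p x + p y" "p (c *\<^sub>R x) = \<bar>c\<bar> * p x"
  using assms by (auto simp: seminorm_def)

lemma seminorm_zero: "seminorm p \<Longrightarrow> p 0 = 0"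
  using seminormD(3)[of p 0 0] by simp

lemma seminorm_minus: "seminorm p \<Longrightarrow> p (- x) = p x"
  using seminormD(3)[of p "- 1" x] by simp

lemma seminorm_scale_nat: "seminorm \<rho> \<Longrightarrow> seminorm (\<lambda>v. real i * \<rho> v)"
  unfolding seminorm_def by (simp add: mult.left_commute mult_left_mono flip: distrib_left)

lemma prod_list_map_nonneg:
  fixes f :: "'v \<Rightarrow> real"
  shows "(\<And>v. 0 \<le> f v) \<Longrightarrow> 0 \<le> prod_list (map f vs)"
  by (induction vs) auto

lemma prod_list_map_mono:
  fixes f g :: "'v \<Rightarrow> real"
  shows "(\<And>v. 0 \<le> f v) \<Longrightarrow> (\<And>v. f v \<le> g v) \<Longrightarrow> prod_list (map f vs) \<le> prod_list (map g vs)"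
proof (induction vs)
  case (Cons v vs)
  then have "f v * prod_list (map f vs) \<le> g v * prod_list (map g vs)"
    using order.trans[of 0 "f v" "g v"] by (intro mult_mono prod_list_map_nonneg) auto
  then show ?case by simp
qed simp

text \<open>Lists make it easy to concatenate the representations of two elements.\<close>

definition proj_values :: "('v::real_vector \<Rightarrow> real) \<Rightarrow> nat \<Rightarrow> 'v symalg \<Rightarrow> real set"
  where "proj_values \<rho> k f = {\<Sum>vs\<leftarrow>xs. prod_list (map \<rho> vs) | xs.
    xs \<noteq> [] \<and> (\<forall>vs\<in>set xs. length vs = k) \<and> f = (\<Sum>vs\<leftarrow>xs. sym_monom vs)}"

lemma prod_nth_eq_prod_list:
  fixes f :: "'v \<Rightarrow> 'b::comm_monoid_mult"
  assumes "length vs = k"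
  shows "(\<Prod>j=1..k. f (vs ! (j - 1))) = prod_list (map f vs)"
  using assms by (simp add: prod.atLeast1_atMost_eq prod.list_conv_set_nth atLeast0LessThan)

lemma sum_nth_eq_sum_list:
  fixes f :: "'v \<Rightarrow> 'b::comm_monoid_add"
  assumes "length xs = n"
  shows "(\<Sum>i=1..n. f (xs ! (i - 1))) = sum_list (map f xs)"
  using assms by (simp add: sum.atLeast1_atMost_eq sum.list_conv_set_nth atLeast0LessThan)

lemma proj_seminorm_eq_Inf:
  assumes "k \<ge> 1"
  shows "proj_seminorm \<rho> k f = Inf (proj_values \<rho> k f)"
proof -
  have "{(\<Sum>i=1..n. \<Prod>j=1..k. \<rho> (F i j)) | (n::nat) (F :: nat \<Rightarrow> nat \<Rightarrow> 'a).
       n \<ge> 1 \<and> f = (\<Sum>i=1..n. \<Prod>j=1..k. sym_of (F i j))} = proj_values \<rho> k f" (is "?A = _")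
  proof (intro equalityI subsetI)
    fix s assume "s \<in> ?A"
    then obtain n and F :: "nat \<Rightarrow> nat \<Rightarrow> 'a" where nF: "n \<ge> 1" "s = (\<Sum>i=1..n. \<Prod>j=1..k. \<rho> (F i j))"
      "f = (\<Sum>i=1..n. \<Prod>j=1..k. sym_of (F i j))" by blast
    \<comment> \<open>The table \<open>F\<close> read row by row. Its indices start at
      \<open>1\<close>, those of lists at \<open>0\<close>; hence the ranges here and the shift by
      one in the other inclusion.\<close>
    let ?xs = "map (\<lambda>i. map (F i) [1..<Suc k]) [1..<Suc n]"
    have *: "(\<Prod>j=1..k. h (F i j)) = prod_list (map h (map (F i) [1..<Suc k]))"
      for h :: "'a \<Rightarrow> 'c::comm_monoid_mult" and i
      using prod.distinct_set_conv_list[of "[1..<Suc k]" "\<lambda>j. h (F i j)"]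
      by (simp add: atLeastLessThanSuc_atLeastAtMost comp_def del: upt_Suc)
    have **: "(\<Sum>i=1..n. h (map (F i) [1..<Suc k])) = sum_list (map h ?xs)"
      for h :: "'a list \<Rightarrow> 'c::comm_monoid_add"
      using sum.distinct_set_conv_list[of "[1..<Suc n]" "\<lambda>i. h (map (F i) [1..<Suc k])"]
      by (simp add: atLeastLessThanSuc_atLeastAtMost comp_def del: upt_Suc)
    have "s = (\<Sum>vs\<leftarrow>?xs. prod_list (map \<rho> vs))"
      using **[of "\<lambda>vs. prod_list (map \<rho> vs)"] unfolding nF(2) * .
    moreover have "f = (\<Sum>vs\<leftarrow>?xs. sym_monom vs)"
      using **[of sym_monom] unfolding nF(3) * .
    moreover have "?xs \<noteq> []" "\<forall>vs\<in>set ?xs. length vs = k" using nF(1) by auto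
    ultimately show "s \<in> proj_values \<rho> k f" unfolding proj_values_def by blast
  next
    fix s assume "s \<in> proj_values \<rho> k f"
    then obtain xs where xs: "xs \<noteq> []" "\<forall>vs\<in>set xs. length vs = k"
      "s = (\<Sum>vs\<leftarrow>xs. prod_list (map \<rho> vs))" "f = (\<Sum>vs\<leftarrow>xs. sym_monom vs)"
      unfolding proj_values_def by blast
    define n where "n = length xs"
    have len: "length (xs ! (i - 1)) = k" if "i \<in> {1..n}" for i
    proof -
      have "i - 1 < length xs" using that by (simp add: n_def) linarith
      then show ?thesis using xs(2) nth_mem by blast
    qed
    have eq: "(\<Sum>i=1..n. \<Prod>j=1..k. h (xs ! (i - 1) ! (j - 1))) = (\<Sum>vs\<leftarrow>xs. prod_list (map h vs))"
      for h :: "'a \<Rightarrow> 'c::comm_semiring_1"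
    proof -
      have "(\<Sum>i=1..n. \<Prod>j=1..k. h (xs ! (i - 1) ! (j - 1))) = (\<Sum>i=1..n. prod_list (map h (xs ! (i - 1))))"
        using len by (intro sum.cong refl prod_nth_eq_prod_list)
      also have "\<dots> = (\<Sum>vs\<leftarrow>xs. prod_list (map h vs))"
        by (rule sum_nth_eq_sum_list) (simp add: n_def)
      finally show ?thesis .
    qed
    have "n \<ge> 1" using xs(1) by (cases xs) (auto simp: n_def)
    then show "s \<in> ?A"
      unfolding xs(3,4) eq[symmetric]
      by (intro CollectI exI[of _ n] exI[of _ "\<lambda>i j. xs ! (i - 1) ! (j - 1)"] conjI refl)
  qed
  then show ?thesis using assms by (simp add: proj_seminorm_def)
qed

lemma proj_values_nonneg: "seminorm \<rho> \<Longrightarrow> s \<in> proj_values \<rho> k f \<Longrightarrow> 0 \<le> s"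
  by (auto simp: proj_values_def seminormD intro!: sum_list_nonneg prod_list_map_nonneg)

lemma proj_values_add:
  assumes "s \<in> proj_values \<rho> k f" "t \<in> proj_values \<rho> k g"
  shows "s + t \<in> proj_values \<rho> k (f + g)"
proof -
  obtain xs ys where "xs \<noteq> []" "\<forall>vs\<in>set xs. length vs = k"
      "s = (\<Sum>vs\<leftarrow>xs. prod_list (map \<rho> vs))" "f = (\<Sum>vs\<leftarrow>xs. sym_monom vs)"
      "\<forall>vs\<in>set ys. length vs = k"
      "t = (\<Sum>vs\<leftarrow>ys. prod_list (map \<rho> vs))" "g = (\<Sum>vs\<leftarrow>ys. sym_monom vs)"
    using assms unfolding proj_values_def by blast
  then show ?thesis unfolding proj_values_def
    by (intro CollectI exI[of _ "xs @ ys"]) auto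
qed

lemma proj_values_monom: "length vs = k \<Longrightarrow> prod_list (map \<rho> vs) \<in> proj_values \<rho> k (sym_monom vs)"
  unfolding proj_values_def by (intro CollectI exI[of _ "[vs]"]) auto

lemma proj_values_scale:
  assumes \<rho>: "seminorm \<rho>" and k: "k \<ge> 1" and s: "s \<in> proj_values \<rho> k f"
  shows "\<bar>c\<bar> * s \<in> proj_values \<rho> k (c *\<^sub>R f)"
proof -
  \<comment> \<open>The scalar goes into the first factor of each monomial, which exists since
    \<open>k \<ge> 1\<close>.\<close>
  let ?g = "\<lambda>vs. (c *\<^sub>R hd vs) # tl vs"
  obtain xs where xs: "xs \<noteq> []" "\<forall>vs\<in>set xs. length vs = k"
      "s = (\<Sum>vs\<leftarrow>xs. prod_list (map \<rho> vs))" "f = (\<Sum>vs\<leftarrow>xs. sym_monom vs)"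
    using s unfolding proj_values_def by blast
  have 1: "prod_list (map \<rho> (?g vs)) = \<bar>c\<bar> * prod_list (map \<rho> vs)"
      "sym_monom (?g vs) = c *\<^sub>R sym_monom vs" "length (?g vs) = k" if "vs \<in> set xs" for vs
    using xs(2) that k seminormD(3)[OF \<rho>] by (cases vs; force simp: linear_scale[OF linear_sym_of])+
  have eqs: "map (\<lambda>vs. prod_list (map \<rho> (?g vs))) xs = map (\<lambda>vs. \<bar>c\<bar> * prod_list (map \<rho> vs)) xs"
       "map (\<lambda>vs. sym_monom (?g vs)) xs = map (\<lambda>vs. c *\<^sub>R sym_monom vs) xs"
    using 1(1,2) by (auto simp del: prod_list.Cons list.map)
  have scale: "sum_list (map (\<lambda>vs. c *\<^sub>R sym_monom vs) ys) = c *\<^sub>R sum_list (map sym_monom ys)" for ys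
    by (induction ys) (simp_all add: scaleR_right_distrib)
  have "\<bar>c\<bar> * s = (\<Sum>vs\<leftarrow>map ?g xs. prod_list (map \<rho> vs))"
    unfolding map_map comp_def eqs(1) xs(3) by (simp add: sum_list_const_mult)
  moreover have "c *\<^sub>R f = (\<Sum>vs\<leftarrow>map ?g xs. sym_monom vs)"
    unfolding map_map comp_def eqs(2) xs(4) scale ..
  moreover have "\<forall>vs\<in>set (map ?g xs). length vs = k" using 1(3) by auto
  moreover have "map ?g xs \<noteq> []" using xs(1) by simp
  ultimately show ?thesis unfolding proj_values_def by blast
qed

text \<open>Together with the lower bound \<open>0\<close> this makes the real \<open>Inf\<close>
  over representations a genuine infimum.\<close>

lemma proj_values_nonempty:
  assumes \<rho>: "seminorm \<rho>" and k: "k \<ge> 1" and f: "f \<in> sym_graded k"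
  shows "proj_values \<rho> k f \<noteq> {}"
  using f unfolding sym_graded_def
proof (induction rule: span_induct_alt)
  case base
  obtain l where "k = Suc l" using k by (cases k) auto
  then show ?case
    using proj_values_monom[of "replicate k 0" k \<rho>] by (auto simp: linear_0[OF linear_sym_of])
next
  case (step c x y)
  then show ?case using proj_values_scale[OF \<rho> k proj_values_monom] proj_values_add by blast
qed

lemma sym_graded_0E:
  assumes "f \<in> sym_graded 0"
  obtains c where "f = of_real c"
proof -
  have "f \<in> span {1}" using assms by (simp add: sym_graded_def)
  then show ?thesis using that by (auto simp: span_singleton of_real_def)
qed

lemma proj_seminorm_of_real: "proj_seminorm \<rho> 0 (of_real c) = \<bar>c\<bar>"
  by (simp add: proj_seminorm_def)

lemma bdd_below_proj_values: "seminorm \<rho> \<Longrightarrow> bdd_below (proj_values \<rho> k f)"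
  using proj_values_nonneg by (intro bdd_belowI) 

lemma proj_seminorm_nonneg:
  assumes "seminorm \<rho>" "f \<in> sym_graded k"
  shows "0 \<le> proj_seminorm \<rho> k f"
proof (cases "k = 0")
  case True
  then show ?thesis by (simp add: proj_seminorm_def)
next
  case False
  then show ?thesis
    using assms proj_values_nonempty[of \<rho> k f] proj_values_nonneg
    by (subst proj_seminorm_eq_Inf) (auto intro!: cInf_greatest)
qed

lemma proj_seminorm_add:
  assumes \<rho>: "seminorm \<rho>" and fg: "f \<in> sym_graded k" "g \<in> sym_graded k"
  shows "proj_seminorm \<rho> k (f + g) \<le> proj_seminorm \<rho> k f + proj_seminorm \<rho> k g"
proof (cases "k = 0")
  case True
  obtain a b where "f = of_real a" "g = of_real b" using fg True by (metis sym_graded_0E)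
  then show ?thesis using proj_seminorm_of_real[of \<rho> "a + b"] True by (simp add: proj_seminorm_of_real)
next
  case False
  then have k: "k \<ge> 1" by simp
  note ne = proj_values_nonempty[OF \<rho> k]
  have "Inf (proj_values \<rho> k (f + g)) - t \<le> s"
    if "s \<in> proj_values \<rho> k f" "t \<in> proj_values \<rho> k g" for s t
    using cInf_lower[OF proj_values_add[OF that] bdd_below_proj_values[OF \<rho>]] by simp
  then have "Inf (proj_values \<rho> k (f + g)) - Inf (proj_values \<rho> k f) \<le> t" if "t \<in> proj_values \<rho> k g" for t
    using cInf_greatest[OF ne[OF fg(1)], of "Inf (proj_values \<rho> k (f + g)) - t"] that by (force simp: algebra_simps)
  then have "Inf (proj_values \<rho> k (f + g)) - Inf (proj_values \<rho> k f) \<le> Inf (proj_values \<rho> k g)"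
    by (intro cInf_greatest ne fg)
  then show ?thesis using k by (simp add: proj_seminorm_eq_Inf)
qed

lemma proj_seminorm_scale_le:
  assumes \<rho>: "seminorm \<rho>" and f: "f \<in> sym_graded k"
  shows "proj_seminorm \<rho> k (c *\<^sub>R f) \<le> \<bar>c\<bar> * proj_seminorm \<rho> k f"
proof (cases "k = 0")
  case True
  obtain a where "f = of_real a" using f True by (metis sym_graded_0E)
  then have "c *\<^sub>R f = of_real (c * a)" by (simp add: scaleR_conv_of_real)
  then show ?thesis using \<open>f = _\<close> True by (simp only: proj_seminorm_of_real abs_mult)
next
  case False
  then have k: "k \<ge> 1" by simp
  have "Inf (proj_values \<rho> k (c *\<^sub>R f)) \<le> \<bar>c\<bar> * s" if "s \<in> proj_values \<rho> k f" for s
    using cInf_lower[OF proj_values_scale[OF \<rho> k that] bdd_below_proj_values[OF \<rho>]] .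
  note * = this
  show ?thesis
  proof (cases "c = 0")
    case True
    obtain s where "s \<in> proj_values \<rho> k f" using proj_values_nonempty[OF \<rho> k f] by blast
    from *[OF this] show ?thesis using k True by (simp add: proj_seminorm_eq_Inf)
  next
    case False
    have "Inf (proj_values \<rho> k (c *\<^sub>R f)) / \<bar>c\<bar> \<le> Inf (proj_values \<rho> k f)"
      using * False by (intro cInf_greatest proj_values_nonempty[OF \<rho> k f]) (simp add: field_simps)
    then show ?thesis using k False by (simp add: proj_seminorm_eq_Inf field_simps)
  qed
qed

lemma proj_seminorm_monom_le:
  assumes \<rho>: "seminorm \<rho>"
  shows "proj_seminorm \<rho> (length vs) (sym_monom vs) \<le> prod_list (map \<rho> vs)"
proof (cases "vs = []")
  case True
  then show ?thesis using proj_seminorm_of_real[of \<rho> 1] by simp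
next
  case False
  then have "length vs \<ge> 1" by (cases vs) auto
  then show ?thesis
    using cInf_lower[OF proj_values_monom[OF refl] bdd_below_proj_values[OF \<rho>]]
    by (simp add: proj_seminorm_eq_Inf)
qed

section \<open>The projective extension on the whole symmetric algebra\<close>

lemma zero_mem_sym_graded: "0 \<in> sym_graded k"
  by (simp add: sym_graded_def span_zero)

lemma proj_seminorm_zero: "seminorm \<rho> \<Longrightarrow> proj_seminorm \<rho> k 0 = 0"
  using proj_seminorm_scale_le[OF _ zero_mem_sym_graded, of \<rho> k 0]
    proj_seminorm_nonneg[OF _ zero_mem_sym_graded, of \<rho> k] by simp

lemma sym_comp_mem: "sym_comp k f \<in> sym_graded k"
  using is_grading_sym_comp[of f] by (simp add: is_grading_def)

lemma finite_sym_comp: "finite {k. sym_comp k f \<noteq> 0}"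
  using is_grading_sym_comp[of f] by (simp add: is_grading_def)

lemma sum_sym_comp: "(\<Sum>k | sym_comp k f \<noteq> 0. sym_comp k f) = f"
  using is_grading_sym_comp[of f] by (simp add: is_grading_def)

lemma proj_ext_eq_sum:
  assumes "seminorm \<rho>" "finite A" "{k. sym_comp k f \<noteq> 0} \<subseteq> A"
  shows "proj_ext \<rho> f = (\<Sum>k\<in>A. proj_seminorm \<rho> k (sym_comp k f))"
  unfolding proj_ext_def hom_comp_eq
  using assms by (intro sum.mono_neutral_left) (auto simp: proj_seminorm_zero)

lemma proj_ext_nonneg: "seminorm \<rho> \<Longrightarrow> 0 \<le> proj_ext \<rho> f"
  by (simp add: proj_ext_def hom_comp_eq sum_nonneg proj_seminorm_nonneg sym_comp_mem)

lemma proj_ext_scale_le: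
  assumes \<rho>: "seminorm \<rho>"
  shows "proj_ext \<rho> (c *\<^sub>R f) \<le> \<bar>c\<bar> * proj_ext \<rho> f"
proof -
  have "proj_ext \<rho> (c *\<^sub>R f) = (\<Sum>k | sym_comp k f \<noteq> 0. proj_seminorm \<rho> k (c *\<^sub>R sym_comp k f))"
    by (subst proj_ext_eq_sum[OF \<rho> finite_sym_comp[of f]]) (auto simp: linear_scale[OF linear_sym_comp])
  also have "\<dots> \<le> (\<Sum>k | sym_comp k f \<noteq> 0. \<bar>c\<bar> * proj_seminorm \<rho> k (sym_comp k f))"
    by (intro sum_mono proj_seminorm_scale_le \<rho> sym_comp_mem)
  finally show ?thesis by (simp add: proj_ext_def hom_comp_eq sum_distrib_left)
qed

lemma seminorm_proj_ext:
  assumes \<rho>: "seminorm \<rho>"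
  shows "seminorm (proj_ext \<rho>)"
  unfolding seminorm_def
proof (intro conjI allI)
  show "0 \<le> proj_ext \<rho> f" for f by (rule proj_ext_nonneg[OF \<rho>])
next
  fix f g :: "'a symalg"
  let ?A = "{k. sym_comp k f \<noteq> 0} \<union> {k. sym_comp k g \<noteq> 0}"
  have A: "finite ?A" by (simp add: finite_sym_comp)
  have "proj_ext \<rho> (f + g) = (\<Sum>k\<in>?A. proj_seminorm \<rho> k (sym_comp k f + sym_comp k g))"
    by (subst proj_ext_eq_sum[OF \<rho> A]) (auto simp: linear_add[OF linear_sym_comp])
  also have "\<dots> \<le> (\<Sum>k\<in>?A. proj_seminorm \<rho> k (sym_comp k f) + proj_seminorm \<rho> k (sym_comp k g))"
    by (intro sum_mono proj_seminorm_add \<rho> sym_comp_mem)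
  also have "\<dots> = proj_ext \<rho> f + proj_ext \<rho> g"
    by (subst (1 2) proj_ext_eq_sum[OF \<rho> A]) (auto simp: sum.distrib)
  finally show "proj_ext \<rho> (f + g) \<le> proj_ext \<rho> f + proj_ext \<rho> g" .
next
  fix c and f :: "'a symalg"
  show "proj_ext \<rho> (c *\<^sub>R f) = \<bar>c\<bar> * proj_ext \<rho> f"
  proof (cases "c = 0")
    case True
    then show ?thesis by (simp add: proj_ext_def hom_comp_eq linear_0[OF linear_sym_comp])
  next
    case False
    have "\<bar>c\<bar> * proj_ext \<rho> f \<le> proj_ext \<rho> (c *\<^sub>R f)"
      using proj_ext_scale_le[OF \<rho>, of "1 / c" "c *\<^sub>R f"] False by (simp add: field_simps)
    then show ?thesis using proj_ext_scale_le[OF \<rho>, of c f] by simp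
  qed
qed

lemma proj_ext_monom_le:
  assumes \<rho>: "seminorm \<rho>"
  shows "proj_ext \<rho> (sym_monom vs) \<le> prod_list (map \<rho> vs)"
proof -
  have "proj_ext \<rho> (sym_monom vs) =
      (\<Sum>k\<in>{length vs}. proj_seminorm \<rho> k (sym_comp k (sym_monom vs)))"
    by (rule proj_ext_eq_sum[OF \<rho>]) (auto simp: sym_comp_monom)
  then show ?thesis using proj_seminorm_monom_le[OF \<rho>, of vs] by (simp add: sym_comp_monom)
qed

section \<open>Functionals bounded on monomials\<close>

definition monomial_bounded :: "('v::real_vector \<Rightarrow> real) \<Rightarrow> ('v symalg \<Rightarrow> real) \<Rightarrow> real \<Rightarrow> bool"
  where "monomial_bounded \<rho> L C \<longleftrightarrow> (\<forall>vs. \<bar>L (sym_monom vs)\<bar> \<le> C * prod_list (map \<rho> vs))"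

lemma monomial_bounded_nonneg: "monomial_bounded \<rho> L C \<Longrightarrow> 0 \<le> C"
  using abs_ge_zero order.trans unfolding monomial_bounded_def by (metis list.simps(8) mult.right_neutral prod_list.Nil)

text \<open>The estimate on monomials adds up along any representation of \<open>f\<close>, so it
  survives the infimum. The constant is the same in all degrees, which allows summing over the
  degrees afterwards.\<close>

lemma proj_seminorm_bound:
  assumes L: "linear L" and b: "monomial_bounded \<rho> L C" and \<rho>: "seminorm \<rho>" and f: "f \<in> sym_graded k"
  shows "\<bar>L f\<bar> \<le> C * proj_seminorm \<rho> k f"
proof (cases "k = 0")
  case True
  obtain c where c: "f = of_real c" using f True by (metis sym_graded_0E)
  \<comment> \<open>The monomial of the empty list is \<open>1\<close>, so the bound on monomials
    covers the scalars as well.\<close>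
  have "\<bar>L (c *\<^sub>R sym_monom [])\<bar> \<le> \<bar>c\<bar> * C"
    using b[unfolded monomial_bounded_def, rule_format, of "[]"]
    by (simp only: linear_scale[OF L]) (simp add: abs_mult mult_left_mono)
  then show ?thesis using c True by (simp add: of_real_def[symmetric] proj_seminorm_of_real mult.commute)
next
  case False
  then have k: "k \<ge> 1" by simp
  have C: "0 \<le> C" using b by (rule monomial_bounded_nonneg)
  have *: "\<bar>L f\<bar> \<le> C * s" if "s \<in> proj_values \<rho> k f" for s
  proof -
    obtain xs where xs: "s = (\<Sum>vs\<leftarrow>xs. prod_list (map \<rho> vs))" "f = (\<Sum>vs\<leftarrow>xs. sym_monom vs)"
      using \<open>s \<in> _\<close> unfolding proj_values_def by blast
    have "\<bar>L (\<Sum>vs\<leftarrow>ys. sym_monom vs)\<bar> \<le> C * (\<Sum>vs\<leftarrow>ys. prod_list (map \<rho> vs))" for ys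
    proof (induction ys)
      case (Cons vs ys)
      have "\<bar>L (sym_monom vs)\<bar> \<le> C * prod_list (map \<rho> vs)" using b by (simp add: monomial_bounded_def)
      then show ?case using Cons by (simp add: linear_add[OF L] distrib_left)
    qed (simp add: linear_0[OF L])
    then show ?thesis using xs by blast
  qed
  show ?thesis
  proof (cases "C = 0")
    case True
    then show ?thesis using * proj_values_nonempty[OF \<rho> k f] by force
  next
    case False
    then have "\<bar>L f\<bar> / C \<le> Inf (proj_values \<rho> k f)"
      using * C by (intro cInf_greatest proj_values_nonempty[OF \<rho> k f]) (simp add: field_simps)
    then show ?thesis using k False C by (simp add: proj_seminorm_eq_Inf field_simps)
  qed
qed

lemma proj_ext_bound:
  assumes L: "linear L" and b: "monomial_bounded \<rho> L C" and \<rho>: "seminorm \<rho>"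
  shows "\<bar>L f\<bar> \<le> C * proj_ext \<rho> f"
proof -
  have "\<bar>L f\<bar> = \<bar>\<Sum>k | sym_comp k f \<noteq> 0. L (sym_comp k f)\<bar>"
    by (simp add: sum_sym_comp flip: linear_sum[OF L])
  also have "\<dots> \<le> (\<Sum>k | sym_comp k f \<noteq> 0. C * proj_seminorm \<rho> k (sym_comp k f))"
    by (intro order.trans[OF sum_abs] sum_mono proj_seminorm_bound assms sym_comp_mem)
  finally show ?thesis by (simp add: proj_ext_def hom_comp_eq sum_distrib_left)
qed

section \<open>Continuity for a topology generated by seminorms\<close>

lemma topspace_seminorm_topology [simp]: "topspace (seminorm_topology P) = UNIV"
  by (auto simp: seminorm_topology_def)

lemma continuous_map_seminorm_topologyI:
  assumes p: "p \<in> P" "seminorm p" and L: "linear L" and b: "\<And>x. \<bar>L x\<bar> \<le> C * p x"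
  shows "continuous_map (seminorm_topology P) euclideanreal L"
  unfolding continuous_map
proof (intro conjI allI impI)
  fix U :: "real set" assume "openin euclideanreal U"
  then have U: "open U" by simp
  show "openin (seminorm_topology P) {x \<in> topspace (seminorm_topology P). L x \<in> U}"
  proof (subst openin_subopen, intro ballI)
    fix x assume "x \<in> {x \<in> topspace (seminorm_topology P). L x \<in> U}"
    then obtain e where e: "e > 0" "\<And>y. \<bar>y - L x\<bar> < e \<Longrightarrow> y \<in> U"
      using U by (auto simp: open_dist dist_real_def)
    let ?W = "{y. p (y - x) < e / (\<bar>C\<bar> + 1)}"
    have "openin (seminorm_topology P) ?W"
      unfolding seminorm_topology_def
      using p(1) e(1) by (intro topology_generated_by_Basis insertI2 CollectI exI[of _ p] exI[of _ x] exI[of _ "e / (\<bar>C\<bar> + 1)"]) auto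
    moreover have "x \<in> ?W" using e(1) by (simp add: seminorm_zero[OF p(2)])
    moreover have "?W \<subseteq> {x \<in> topspace (seminorm_topology P). L x \<in> U}"
    proof safe
      fix y assume y: "p (y - x) < e / (\<bar>C\<bar> + 1)"
      have "\<bar>L y - L x\<bar> \<le> C * p (y - x)" using b[of "y - x"] by (simp add: linear_diff[OF L])
      also have "\<dots> \<le> (\<bar>C\<bar> + 1) * p (y - x)"
        by (intro mult_right_mono seminormD(1)[OF p(2)]) simp
      also have "\<dots> < e" using y by (simp add: field_simps)
      finally show "L y \<in> U" by (rule e(2))
    qed simp
    ultimately show "\<exists>T. openin (seminorm_topology P) T \<and> x \<in> T \<and>
        T \<subseteq> {x \<in> topspace (seminorm_topology P). L x \<in> U}" by blast
  qed
qed simp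

text \<open>Subbasic balls have arbitrary centres. A point \<open>x\<close> in the ball of radius
  \<open>e\<close> around \<open>z\<close> is the centre of a smaller one of radius
  \<open>e - p (x - z)\<close>; finite intersections then take the union of the sets of seminorms
  and the smaller radius.\<close>

lemma openin_seminorm_topologyD:
  assumes P: "\<forall>p\<in>P. seminorm p"
    and U: "openin (seminorm_topology P) U" and x: "x \<in> U"
  shows "\<exists>Q e. finite Q \<and> Q \<subseteq> P \<and> e > 0 \<and> (\<forall>y. (\<forall>p\<in>Q. p (y - x) < e) \<longrightarrow> y \<in> U)"
  using U[unfolded seminorm_topology_def openin_topology_generated_by_iff] x
proof (induction rule: generate_topology_on.induct)
  case Empty
  then show ?case by simp
next
  case (Int a b)
  then have x: "x \<in> a" "x \<in> b" by auto
  obtain Q e where Q: "finite Q" "Q \<subseteq> P" "e > 0" "\<forall>y. (\<forall>p\<in>Q. p (y - x) < e) \<longrightarrow> y \<in> a"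
    using Int.IH(1)[OF x(1)] by (elim exE conjE)
  obtain Q' e' where Q': "finite Q'" "Q' \<subseteq> P" "e' > 0" "\<forall>y. (\<forall>p\<in>Q'. p (y - x) < e') \<longrightarrow> y \<in> b"
    using Int.IH(2)[OF x(2)] by (elim exE conjE)
  show ?case
    using Q(1-3) Q'(1-3) by (intro exI[of _ "Q \<union> Q'"] exI[of _ "min e e'"]) (simp add: Q(4) Q'(4))
next
  case (UN K)
  then obtain k where "k \<in> K" "x \<in> k" by blast
  from UN.IH[OF this] obtain Q e where Q: "finite Q" "Q \<subseteq> P" "e > 0" "\<forall>y. (\<forall>p\<in>Q. p (y - x) < e) \<longrightarrow> y \<in> k"
    by (elim exE conjE)
  then show ?case using \<open>k \<in> K\<close> by (intro exI[of _ Q] exI[of _ e]) (simp, blast)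
next
  case (Basis s)
  from Basis(1) show ?case
    unfolding insert_iff mem_Collect_eq
  proof (elim disjE exE conjE)
    assume "s = UNIV"
    then show ?thesis by (intro exI[of _ "{}"] exI[of _ 1]) auto
  next
    fix p z e assume 2: "s = {y. p (y - z) < e}" "p \<in> P" "e > 0"
    have "p (y - z) < e" if "p (y - x) < e - p (x - z)" for y
      using seminormD(2)[OF P[rule_format, OF 2(2)], of "y - x" "x - z"] that by simp
    moreover have "p (x - z) < e" using Basis(2) 2(1) by simp
    ultimately show ?thesis using 2(2) by (intro exI[of _ "{p}"] exI[of _ "e - p (x - z)"]) (simp add: 2(1))
  qed
qed

text \<open>Near \<open>0\<close> the functional stays below \<open>1\<close> on a finite
  intersection of balls of radius \<open>e\<close>; homogeneity turns this into a bound by the sum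
  of the seminorms involved.\<close>

lemma continuous_map_seminorm_topologyD:
  assumes P: "\<forall>p\<in>P. seminorm p" and L: "linear L"
    and cont: "continuous_map (seminorm_topology P) euclideanreal L"
  shows "\<exists>Q C. finite Q \<and> Q \<subseteq> P \<and> 0 \<le> C \<and> (\<forall>x. \<bar>L x\<bar> \<le> C * (\<Sum>p\<in>Q. p x))"
proof -
  have "{x. \<bar>L x\<bar> < 1} = {x \<in> topspace (seminorm_topology P). L x \<in> {-1<..<1}}" by auto
  then have "openin (seminorm_topology P) {x. \<bar>L x\<bar> < 1}"
    using openin_continuous_map_preimage[OF cont, of "{-1<..<1}"] by simp
  from openin_seminorm_topologyD[OF P this, of 0] obtain Q e where
    Q: "finite Q" "Q \<subseteq> P" and e: "e > 0" "\<And>x. (\<forall>p\<in>Q. p x < e) \<Longrightarrow> \<bar>L x\<bar> < 1"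
    by (auto simp: linear_0[OF L])
  have "\<bar>L x\<bar> \<le> 1 / e * (\<Sum>p\<in>Q. p x)" for x
  proof (rule field_le_epsilon)
    fix d :: real assume d: "d > 0"
    \<comment> \<open>The extra \<open>e * d\<close> keeps \<open>s\<close> positive even where all
      seminorms in \<open>Q\<close> vanish; it contributes only \<open>d\<close> to the final
      bound.\<close>
    define s where "s = (\<Sum>p\<in>Q. p x) + e * d"
    have s0: "0 \<le> (\<Sum>p\<in>Q. p x)" using P Q by (intro sum_nonneg) (auto simp: seminormD)
    then have s: "s > 0" using d e(1) by (simp add: s_def add_nonneg_pos)
    have "p ((e / s) *\<^sub>R x) < e" if "p \<in> Q" for p
    proof -
      have "p x \<le> (\<Sum>p\<in>Q. p x)" using P Q that by (intro member_le_sum) (auto simp: seminormD)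
      also have "\<dots> < s" using d e(1) by (simp add: s_def)
      finally have "p x < s" .
      moreover have "p ((e / s) *\<^sub>R x) = e / s * p x" using seminormD(3) P Q that s e(1) by fastforce
      ultimately have "s * p ((e / s) *\<^sub>R x) < s * e" using s e(1) by (simp add: field_simps)
      then show ?thesis using s by simp
    qed
    then have "\<bar>L ((e / s) *\<^sub>R x)\<bar> < 1" using e(2) by blast
    then have "e / s * \<bar>L x\<bar> < 1" using s e(1) by (simp add: linear_scale[OF L] abs_mult)
    then have "\<bar>L x\<bar> < s / e" using s e(1) by (simp add: field_simps)
    then show "\<bar>L x\<bar> \<le> 1 / e * (\<Sum>p\<in>Q. p x) + d" using e(1) by (simp add: s_def field_simps)
  qed
  then show ?thesis using Q e(1) by (intro exI[of _ Q] exI[of _ "1 / e"]) auto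
qed

lemma continuous_map_proj_ext_iff:
  assumes \<rho>: "seminorm \<rho>" and L: "linear L"
  shows "continuous_map (seminorm_topology {proj_ext \<rho>}) euclideanreal L \<longleftrightarrow> (\<exists>C. monomial_bounded \<rho> L C)"
proof
  assume "\<exists>C. monomial_bounded \<rho> L C"
  then obtain C where "monomial_bounded \<rho> L C" ..
  then show "continuous_map (seminorm_topology {proj_ext \<rho>}) euclideanreal L"
    by (intro continuous_map_seminorm_topologyI[where p = "proj_ext \<rho>"] proj_ext_bound L seminorm_proj_ext \<rho>) auto
next
  assume "continuous_map (seminorm_topology {proj_ext \<rho>}) euclideanreal L"
  from continuous_map_seminorm_topologyD[OF _ L this] seminorm_proj_ext[OF \<rho>]
  obtain Q C where Q: "Q \<subseteq> {proj_ext \<rho>}" "0 \<le> C" "\<forall>x. \<bar>L x\<bar> \<le> C * (\<Sum>p\<in>Q. p x)" by auto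
  have "\<bar>L x\<bar> \<le> C * proj_ext \<rho> x" for x
  proof -
    \<comment> \<open>\<open>Q\<close> may be empty; then the inequality is the nonnegativity of the
      extension.\<close>
    have "(\<Sum>p\<in>Q. p x) \<le> (\<Sum>p\<in>{proj_ext \<rho>}. p x)" using Q(1) proj_ext_nonneg[OF \<rho>] by (intro sum_mono2) auto
    then have "C * (\<Sum>p\<in>Q. p x) \<le> C * proj_ext \<rho> x" by (intro mult_left_mono Q(2)) simp
    then show ?thesis using Q(3) order.trans by blast
  qed
  then have "\<bar>L (sym_monom vs)\<bar> \<le> C * prod_list (map \<rho> vs)" for vs
    using mult_left_mono[OF proj_ext_monom_le[OF \<rho>] Q(2)] order.trans by blast
  then show "\<exists>C. monomial_bounded \<rho> L C" unfolding monomial_bounded_def by blast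
qed

lemma directed_family_finite_bound:
  assumes S: "\<forall>\<rho>\<in>S. seminorm \<rho>" "directed_family S"
    and Q: "finite Q" "Q \<subseteq> {\<lambda>v. real i * \<rho> v | \<rho> (i::nat). \<rho> \<in> S \<and> i \<ge> 1}"
  shows "\<exists>\<rho>\<in>S. \<exists>i::nat\<ge>1. \<forall>q\<in>Q. \<forall>v. q v \<le> real i * \<rho> v"
  using Q
proof (induction Q rule: finite_induct)
  case empty
  then show ?case using S(2) by (auto simp: directed_family_def)
next
  case (insert q Q)
  then obtain \<rho>1 i1 \<rho>2 i2 where 1: "\<rho>1 \<in> S" "i1 \<ge> (1::nat)" "\<And>p v. p \<in> Q \<Longrightarrow> p v \<le> real i1 * \<rho>1 v"
    and 2: "\<rho>2 \<in> S" "i2 \<ge> (1::nat)" "q = (\<lambda>v. real i2 * \<rho>2 v)" by auto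
  obtain \<rho> C where \<rho>: "\<rho> \<in> S" "C > 0" "\<And>v. max (\<rho>1 v) (\<rho>2 v) \<le> C * \<rho> v"
    using S(2) 1(1) 2(1) unfolding directed_family_def by meson
  \<comment> \<open>Directedness supplies a real constant, the topology only integer multiples of
    seminorms: the product is rounded up, and \<open>Suc\<close> makes
    \<open>i \<ge> 1\<close>.\<close>
  define i where "i = Suc (nat \<lceil>real (max i1 i2) * C\<rceil>)"
  have *: "real j * \<rho>' v \<le> real i * \<rho> v" if "\<rho>' v \<le> C * \<rho> v" "j \<le> max i1 i2" for j v and \<rho>' :: "'a \<Rightarrow> real"
  proof -
    have 0: "0 \<le> \<rho> v" using S(1) \<rho>(1) by (simp add: seminormD)
    have "real j * \<rho>' v \<le> real j * (C * \<rho> v)" using that by (intro mult_left_mono) auto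
    also have "\<dots> \<le> real (max i1 i2) * (C * \<rho> v)" using that 0 \<rho>(2) by (intro mult_right_mono) auto
    also have "\<dots> = (real (max i1 i2) * C) * \<rho> v" by simp
    also have "\<dots> \<le> real i * \<rho> v" using 0 unfolding i_def by (intro mult_right_mono) linarith+
    finally show ?thesis .
  qed
  have "i \<ge> 1" by (simp add: i_def)
  moreover have "p v \<le> real i * \<rho> v" if "p \<in> insert q Q" for p v
    using that 1(3)[of p v] *[of \<rho>1 v i1] *[of \<rho>2 v i2] \<rho>(3)[of v] 2(3) by auto
  ultimately show ?case using \<rho>(1) by blast
qed

text \<open>Continuity involves finitely many projective extensions. On a monomial each is at most
  the product of the values of its seminorm, hence at most the product for one common
  \<open>i * \<rho>\<close> given by directedness. The number of extensions goes into the
  constant.\<close>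

lemma continuous_map_sym_topologyD:
  assumes S: "\<forall>\<rho>\<in>S. seminorm \<rho>" "directed_family S" and L: "linear L"
    and cont: "continuous_map (sym_topology S) euclideanreal L"
  shows "\<exists>\<rho>\<in>S. \<exists>i::nat\<ge>1. \<exists>C. monomial_bounded (\<lambda>v. real i * \<rho> v) L C"
proof -
  let ?N = "{\<lambda>v. real i * \<rho> v | \<rho> (i::nat). \<rho> \<in> S \<and> i \<ge> 1}"
  have eq: "{proj_ext (\<lambda>v. real i * \<rho> v) | \<rho> (i::nat). \<rho> \<in> S \<and> i \<ge> 1} = proj_ext ` ?N" by blast
  have N: "seminorm q" if "q \<in> ?N" for q using S(1) that by (auto intro: seminorm_scale_nat)
  then have "\<forall>p\<in>proj_ext ` ?N. seminorm p" using seminorm_proj_ext by blast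
  from continuous_map_seminorm_topologyD[OF this L cont[unfolded sym_topology_def eq]]
  obtain Q' C where Q': "finite Q'" "Q' \<subseteq> proj_ext ` ?N" and C: "0 \<le> C" "\<And>x. \<bar>L x\<bar> \<le> C * (\<Sum>p\<in>Q'. p x)"
    by (elim exE conjE) (rule that, assumption+, erule spec)
  obtain Q where Q: "finite Q" "Q \<subseteq> ?N" "Q' = proj_ext ` Q"
    using finite_subset_image[OF Q'] by blast
  obtain \<rho> i where \<rho>: "\<rho> \<in> S" "i \<ge> (1::nat)" "\<And>q v. q \<in> Q \<Longrightarrow> q v \<le> real i * \<rho> v"
    using directed_family_finite_bound[OF S Q(1,2)] by metis
  have "\<bar>L (sym_monom vs)\<bar> \<le> (C * card Q') * prod_list (map (\<lambda>v. real i * \<rho> v) vs)" for vs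
  proof -
    have "p (sym_monom vs) \<le> prod_list (map (\<lambda>v. real i * \<rho> v) vs)" if "p \<in> Q'" for p
    proof -
      obtain q where q: "q \<in> Q" "p = proj_ext q" using \<open>p \<in> Q'\<close> Q(3) by blast
      then have sq: "seminorm q" using N Q(2) by blast
      show ?thesis unfolding q(2)
        by (rule order.trans[OF proj_ext_monom_le[OF sq] prod_list_map_mono])
          (use sq \<rho>(3) q(1) in \<open>auto simp: seminormD\<close>)
    qed
    then have "(\<Sum>p\<in>Q'. p (sym_monom vs)) \<le> card Q' * prod_list (map (\<lambda>v. real i * \<rho> v) vs)"
      using sum_bounded_above[of Q' "\<lambda>p. p (sym_monom vs)"] by simp
    then have "C * (\<Sum>p\<in>Q'. p (sym_monom vs)) \<le> C * (card Q' * prod_list (map (\<lambda>v. real i * \<rho> v) vs))"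
      by (rule mult_left_mono[OF _ C(1)])
    then show ?thesis using C(2)[of "sym_monom vs"] by (simp add: mult.assoc)
  qed
  then have "monomial_bounded (\<lambda>v. real i * \<rho> v) L (C * card Q')" unfolding monomial_bounded_def by blast
  then show ?thesis using \<rho>(1,2) by blast
qed

section \<open>The Riesz representation theorem on a compact set\<close>

text \<open>The intended case is a ball of the dual with the evaluations of elements of the
  symmetric algebra. The ambient space is only Hausdorff, so compactness is asked of
  \<open>X\<close>, while the measure will live on all Borel sets of the space.\<close>

locale compact_function_algebra =
  fixes ev :: "'a::t2_space \<Rightarrow> 'b::{real_algebra_1,comm_ring_1} \<Rightarrow> real" and X :: "'a set"
  assumes compact_X: "compact X"
    and ev_hom: "alg_hom (ev x)"
    and ev_continuous: "continuous_on UNIV (\<lambda>x. ev x f)"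
    and ev_separates: "x \<in> X \<Longrightarrow> y \<in> X \<Longrightarrow> x \<noteq> y \<Longrightarrow> \<exists>f. ev x f \<noteq> ev y f"
begin

lemma closed_X: "closed X"
  by (rule compact_imp_closed[OF compact_X])

lemma linear_ev: "linear (ev x)"
  using ev_hom by (simp add: alg_hom_def)

lemmas ev_add = linear_add[OF linear_ev] and ev_diff = linear_diff[OF linear_ev]
  and ev_minus = linear_neg[OF linear_ev] and ev_scale = linear_scale[OF linear_ev]
  and ev_zero = linear_0[OF linear_ev] and ev_sum = linear_sum[OF linear_ev]

lemma ev_one [simp]: "ev x 1 = 1" and ev_mult: "ev x (f * g) = ev x f * ev x g"
  using ev_hom by (auto simp: alg_hom_def)

lemma ev_of_real [simp]: "ev x (of_real c) = c"
  by (simp add: of_real_def ev_scale)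

lemma ev_power: "ev x (f ^ n) = ev x f ^ n"
  by (induction n) (simp_all add: ev_mult)

lemma ev_borel: "(\<lambda>x. ev x f) \<in> borel_measurable borel"
  by (rule borel_measurable_continuous_onI[OF ev_continuous])

lemma closed_ev_le: "closed {x. ev x f \<le> c}" and closed_ev_ge: "closed {x. c \<le> ev x f}"
  by (intro closed_Collect_le ev_continuous continuous_on_const)+

sublocale function_ring_on "range (\<lambda>f x. ev x f)" X
proof
  show "compact X" by (rule compact_X)
  fix f assume "f \<in> range (\<lambda>f x. ev x f)"
  then show "continuous_on X f" using continuous_on_subset[OF ev_continuous] by auto
next
  fix f g assume "f \<in> range (\<lambda>f x. ev x f)" "g \<in> range (\<lambda>f x. ev x f)"
  then obtain a b where "f = (\<lambda>x. ev x a)" "g = (\<lambda>x. ev x b)" by blast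
  then show "(\<lambda>x. f x + g x) \<in> range (\<lambda>f x. ev x f)" "(\<lambda>x. f x * g x) \<in> range (\<lambda>f x. ev x f)"
    by (auto simp flip: ev_add ev_mult)
next
  show "(\<lambda>_. c) \<in> range (\<lambda>f x. ev x f)" for c
    by (rule range_eqI[of _ _ "of_real c"]) simp
  show "\<exists>f\<in>range (\<lambda>f x. ev x f). f x \<noteq> f y" if xy: "x \<in> X" "y \<in> X" "x \<noteq> y" for x y
  proof -
    obtain f where "ev x f \<noteq> ev y f" using ev_separates[OF xy] by blast
    then show ?thesis by (intro bexI[of _ "\<lambda>x. ev x f"]) auto
  qed
qed

text \<open>Takes the place of Urysohn functions. The separating function lies in the algebra, so a
  functional given only there applies to it without being extended to continuous functions.\<close>

lemma ex_separating:
  assumes "closed A" "A \<subseteq> X" "closed B" "B \<subseteq> X" "A \<inter> B = {}" "0 < e" "e < 1"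
  shows "\<exists>f. (\<forall>x\<in>X. 0 \<le> ev x f \<and> ev x f \<le> 1) \<and> (\<forall>x\<in>A. ev x f < e) \<and> (\<forall>x\<in>B. 1 - e < ev x f)"
  using two[OF assms] by (force simp: image_subset_iff)

lemma ex_approximation:
  assumes "continuous_on X g" "e > 0"
  shows "\<exists>f. \<forall>x\<in>X. \<bar>g x - ev x f\<bar> < e"
  using Stone_Weierstrass_basic[OF assms] by blast

lemma ev_bounded: "\<exists>B>0. \<forall>x\<in>X. \<bar>ev x f\<bar> \<le> B"
proof -
  have "bounded ((\<lambda>x. ev x f) ` X)"
    by (intro compact_imp_bounded compact_continuous_image compact_X continuous_on_subset[OF ev_continuous]) simp
  then show ?thesis by (auto simp: bounded_pos)
qed

lemma AE_mem_X: "sets \<mu> = sets borel \<Longrightarrow> emeasure \<mu> (- X) = 0 \<Longrightarrow> AE x in \<mu>. x \<in> X"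
  using closed_X by (intro AE_I[of _ _ "- X"]) auto

lemma integrable_ev:
  assumes "sets \<mu> = sets borel" "emeasure \<mu> (- X) = 0" "finite_measure \<mu>"
  shows "integrable \<mu> (\<lambda>x. ev x f)"
proof -
  obtain B where "\<forall>x\<in>X. \<bar>ev x f\<bar> \<le> B" using ev_bounded by blast
  then have "AE x in \<mu>. norm (ev x f) \<le> B"
    by (intro eventually_mono[OF AE_mem_X[OF assms(1,2)]]) simp
  then show ?thesis
    using ev_borel assms(1) by (intro finite_measure.integrable_const_bound[OF assms(3)]) (auto cong: measurable_cong_sets)
qed

end

lemma sum_geometric_le: "e > 0 \<Longrightarrow> (\<Sum>i<N. e / 2 ^ Suc i) \<le> (e::real)"
proof -
  assume "e > 0"
  have eq: "(\<Sum>i<N. e / 2 ^ Suc i) = e * (1 - 1 / 2 ^ N)" by (induction N) (simp_all add: field_simps)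
  show ?thesis unfolding eq using \<open>e > 0\<close> by (simp add: mult_left_le)
qed

text \<open>Cuts the height \<open>s\<close> into unit layers; applied to a multiple of a function,
  it compares the function with the indicators of its superlevel sets.\<close>

lemma sum_clamp: "(\<Sum>k<n. min 1 (max 0 (s - real k))) = min (max s 0) (real n)"
  by (induction n) (auto simp: min_def max_def)

locale positive_functional = compact_function_algebra +
  fixes L :: "'b::{real_algebra_1,comm_ring_1} \<Rightarrow> real"
  assumes linear_L: "linear L"
    and L_nonneg: "(\<And>x. x \<in> X \<Longrightarrow> 0 \<le> ev x f) \<Longrightarrow> 0 \<le> L f"
begin

lemma L_mono:
  assumes "\<And>x. x \<in> X \<Longrightarrow> ev x f \<le> ev x g"
  shows "L f \<le> L g"
  using L_nonneg[of "g - f"] assms by (simp add: ev_diff linear_diff[OF linear_L])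

lemma L_of_real: "L (of_real c) = c * L 1"
  by (simp add: of_real_def linear_scale[OF linear_L])

lemma L_one_nonneg: "0 \<le> L 1"
  by (rule L_nonneg) simp

section \<open>The set function induced by a positive functional\<close>

definition majorants :: "'a set \<Rightarrow> 'b set"
  where "majorants C = {f. (\<forall>x\<in>X. 0 \<le> ev x f) \<and> (\<forall>x\<in>C \<inter> X. 1 \<le> ev x f)}"

text \<open>An outer estimate of the indicator function through algebra elements; for closed
  \<open>C\<close> it becomes the measure of \<open>C \<inter> X\<close>.\<close>

definition charge :: "'a set \<Rightarrow> real"
  where "charge C = Inf (L ` majorants C)"

lemma one_majorant: "1 \<in> majorants C"
  by (simp add: majorants_def)

lemma majorant_nonneg: "f \<in> majorants C \<Longrightarrow> 0 \<le> L f"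
  by (rule L_nonneg) (simp add: majorants_def)

lemma charge_le: "f \<in> majorants C \<Longrightarrow> charge C \<le> L f"
  unfolding charge_def using majorant_nonneg by (intro cInf_lower bdd_belowI) auto

lemma le_charge: "(\<And>f. f \<in> majorants C \<Longrightarrow> c \<le> L f) \<Longrightarrow> c \<le> charge C"
  unfolding charge_def using one_majorant by (intro cInf_greatest) auto

lemma charge_nonneg: "0 \<le> charge C"
  by (rule le_charge) (rule majorant_nonneg)

lemma ex_majorant:
  assumes "e > 0"
  shows "\<exists>f\<in>majorants C. L f < charge C + e"
  using le_charge[of C "charge C + e"] assms by force

lemma majorants_anti_mono: "C \<subseteq> D \<Longrightarrow> majorants D \<subseteq> majorants C"
  unfolding majorants_def by blast

lemma charge_mono: "C \<subseteq> D \<Longrightarrow> charge C \<le> charge D"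
  using majorants_anti_mono[of C D] by (intro le_charge charge_le) blast

lemma charge_empty: "charge {} = 0"
  using charge_le[of 0 "{}"] charge_nonneg[of "{}"]
  by (simp add: majorants_def ev_zero linear_0[OF linear_L])

lemma charge_X: "charge X = L 1"
proof (rule antisym)
  show "charge X \<le> L 1" by (rule charge_le[OF one_majorant])
  show "L 1 \<le> charge X" by (rule le_charge, rule L_mono) (simp add: majorants_def)
qed

lemma charge_subadd: "charge (C \<union> D) \<le> charge C + charge D"
proof (rule field_le_epsilon)
  fix e :: real assume "e > 0"
  then have "e / 2 > 0" by simp
  then obtain f g where fg: "f \<in> majorants C" "L f < charge C + e / 2"
      "g \<in> majorants D" "L g < charge D + e / 2"
    using ex_majorant by meson
  then have "f + g \<in> majorants (C \<union> D)"
    by (auto simp: majorants_def ev_add intro: add_increasing add_increasing2)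
  from charge_le[OF this] show "charge (C \<union> D) \<le> charge C + charge D + e"
    using fg(2,4) by (simp add: linear_add[OF linear_L])
qed

text \<open>The strict margin makes \<open>C \<inter> X\<close> disjoint from the closed set where
  \<open>f\<close> is at most \<open>1\<close>; this is how complements get approximated from
  inside.\<close>

lemma ex_majorant_gt_1:
  assumes "e > 0"
  shows "\<exists>f. L f < charge C + e \<and> (\<forall>x\<in>X. 0 \<le> ev x f) \<and> (\<forall>x\<in>C \<inter> X. 1 < ev x f)"
proof -
  obtain f where f: "f \<in> majorants C" "L f < charge C + e / 2"
    using ex_majorant[of "e / 2"] assms by auto
  \<comment> \<open>Chosen so that \<open>t * L f \<le> e / 2\<close>; the \<open>+ 1\<close> avoids
    division by \<open>0\<close>.\<close>
  define t where "t = e / (2 * (L f + 1))"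
  have Lf: "0 \<le> L f" using f(1) by (rule majorant_nonneg)
  then have t: "t > 0" using assms by (simp add: t_def)
  have "t * L f \<le> t * (L f + 1)" using t by simp
  also have "\<dots> = e / 2" using Lf by (simp add: t_def field_simps)
  moreover have "L ((1 + t) *\<^sub>R f) = L f + t * L f"
    by (simp add: linear_scale[OF linear_L] distrib_right)
  ultimately have "L ((1 + t) *\<^sub>R f) < charge C + e" using f(2) by simp
  moreover have "1 < ev x ((1 + t) *\<^sub>R f)" if "x \<in> C \<inter> X" for x
  proof -
    have "1 \<le> ev x f" using f(1) that by (simp add: majorants_def)
    have "1 < (1 + t) * 1" using t by simp
    also have "\<dots> \<le> (1 + t) * ev x f" using t \<open>1 \<le> ev x f\<close> by (intro mult_left_mono) auto
    finally show ?thesis by (simp add: ev_scale)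
  qed
  moreover have "0 \<le> ev x ((1 + t) *\<^sub>R f)" if "x \<in> X" for x
    using f(1) that t by (simp add: majorants_def ev_scale)
  ultimately show ?thesis by blast
qed

text \<open>A majorant \<open>f\<close> of the union is split as \<open>f * (1 - h) + f * h\<close>
  with \<open>h\<close> near \<open>0\<close> on \<open>C\<close> and near \<open>1\<close> on
  \<open>D\<close>. Each summand misses being a majorant of its set by a factor \<open>1 - e\<close>
  only, and \<open>e\<close> tends to \<open>0\<close>.\<close>

lemma charge_superadd:
  assumes C: "closed C" "closed D" "C \<inter> D \<inter> X = {}"
  shows "charge C + charge D \<le> charge (C \<union> D)"
proof -
  have "(1 - e) * (charge C + charge D) \<le> charge (C \<union> D)" if e: "0 < e" "e < 1" for e
  proof (rule le_charge)
    fix f assume f: "f \<in> majorants (C \<union> D)"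
    obtain h where h: "\<forall>x\<in>X. 0 \<le> ev x h \<and> ev x h \<le> 1" "\<forall>x\<in>C \<inter> X. ev x h < e" "\<forall>x\<in>D \<inter> X. 1 - e < ev x h"
      using ex_separating[of "C \<inter> X" "D \<inter> X" e] C e closed_X by auto
    have scale: "1 \<le> 1 / (1 - e) * (u * v)" if "1 \<le> u" "1 - e \<le> v" for u v :: real
      using mult_mono[of 1 u "1 - e" v] that e by (simp add: field_simps)
    have f1: "0 \<le> ev x f" if "x \<in> X" for x using f that by (simp add: majorants_def)
    have f2: "1 \<le> ev x f" if "x \<in> (C \<union> D) \<inter> X" for x using f that by (simp add: majorants_def)
    have "(1 / (1 - e)) *\<^sub>R (f * (1 - h)) \<in> majorants C"
      unfolding majorants_def mem_Collect_eq ev_scale ev_mult ev_diff ev_one real_scaleR_def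
    proof (intro conjI ballI)
      show "0 \<le> 1 / (1 - e) * (ev x f * (1 - ev x h))" if "x \<in> X" for x
        using f1[OF that] h(1) e that by simp
      show "1 \<le> 1 / (1 - e) * (ev x f * (1 - ev x h))" if "x \<in> C \<inter> X" for x
        using bspec[OF h(2) that] that by (intro scale f2) auto
    qed
    moreover have "(1 / (1 - e)) *\<^sub>R (f * h) \<in> majorants D"
      unfolding majorants_def mem_Collect_eq ev_scale ev_mult real_scaleR_def
    proof (intro conjI ballI)
      show "0 \<le> 1 / (1 - e) * (ev x f * ev x h)" if "x \<in> X" for x
        using f1[OF that] h(1) e that by simp
      show "1 \<le> 1 / (1 - e) * (ev x f * ev x h)" if "x \<in> D \<inter> X" for x
        using bspec[OF h(3) that] that by (intro scale f2) auto
    qed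
    ultimately have "charge C + charge D \<le> L ((1 / (1 - e)) *\<^sub>R (f * (1 - h))) + L ((1 / (1 - e)) *\<^sub>R (f * h))"
      by (intro add_mono charge_le)
    also have "\<dots> = L f / (1 - e)"
      by (simp add: linear_scale[OF linear_L] linear_diff[OF linear_L] right_diff_distrib diff_divide_distrib)
    finally show "(1 - e) * (charge C + charge D) \<le> L f"
      using e by (simp add: field_simps)
  qed
  then have "\<forall>\<^sub>F e in at_right 0. (1 - e) * (charge C + charge D) \<le> charge (C \<union> D)"
    using eventually_at_right_real[of 0 "1::real"] by (auto elim!: eventually_mono)
  then show ?thesis
    by (intro tendsto_upperbound[of "\<lambda>e. (1 - e) * (charge C + charge D)" _ "at_right 0"])
       (auto intro!: tendsto_eq_intros)
qed

text \<open>\<open>D\<close> is the part of \<open>E\<close> where a strict majorant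
  \<open>f\<close> of \<open>C\<close> is at most \<open>1\<close>. The rest of \<open>E\<close>
  lies in \<open>{x. 1 \<le> ev x f}\<close>, which \<open>f\<close> also majorises, so its charge
  is at most \<open>L f\<close>.\<close>

lemma charge_tight:
  assumes E: "closed E" "E \<subseteq> X" and "e > 0"
  shows "\<exists>D. closed D \<and> D \<subseteq> E \<and> D \<inter> C = {} \<and> charge E \<le> charge C + charge D + e"
proof -
  obtain f where f: "L f < charge C + e" "\<forall>x\<in>X. 0 \<le> ev x f" "\<forall>x\<in>C \<inter> X. 1 < ev x f"
    using ex_majorant_gt_1[OF \<open>e > 0\<close>, of C] by blast
  let ?D = "E \<inter> {x. ev x f \<le> 1}"
  have "charge E \<le> charge ({x. 1 \<le> ev x f} \<union> ?D)" by (intro charge_mono) auto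
  also have "\<dots> \<le> charge {x. 1 \<le> ev x f} + charge ?D" by (rule charge_subadd)
  also have "charge {x. 1 \<le> ev x f} \<le> L f" using f(2) by (intro charge_le) (auto simp: majorants_def)
  finally have "charge E \<le> charge C + charge ?D + e" using f(1) by simp
  moreover have "?D \<inter> C = {}"
  proof (rule equals0I)
    fix x assume x: "x \<in> ?D \<inter> C"
    then have "x \<in> C \<inter> X" using E(2) by blast
    from bspec[OF f(3) this] x show False by simp
  qed
  ultimately show ?thesis using E(1) closed_ev_le by (intro exI[of _ ?D]) auto
qed

text \<open>Tightness splits off from \<open>E\<close> a closed part \<open>D\<close> that misses
  \<open>F\<close> and carries at least \<open>charge E - charge (E \<inter> F)\<close> up to
  \<open>e\<close>; superadditivity then applies to \<open>D\<close> and \<open>F\<close>.\<close>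

lemma charge_supermodular:
  assumes "closed E" "E \<subseteq> X" "closed F"
  shows "charge E + charge F \<le> charge (E \<union> F) + charge (E \<inter> F)"
proof (rule field_le_epsilon)
  fix e :: real assume "e > 0"
  then obtain D where D: "closed D" "D \<subseteq> E" "D \<inter> (E \<inter> F) = {}" "charge E \<le> charge (E \<inter> F) + charge D + e"
    using charge_tight[OF assms(1,2), of e "E \<inter> F"] by blast
  have "charge D + charge F \<le> charge (D \<union> F)" using D assms by (intro charge_superadd) auto
  also have "\<dots> \<le> charge (E \<union> F)" using D by (intro charge_mono) auto
  finally show "charge E + charge F \<le> charge (E \<union> F) + charge (E \<inter> F) + e" using D(4) by simp
qed

lemma charge_le_X: "charge C \<le> charge X"
  using one_majorant charge_le charge_X by metis

text \<open>By supermodularity the defect \<open>charge X - charge E\<close> behaves like the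
  measure of a complement: it is subadditive when closed sets are intersected.\<close>

lemma charge_Inter_ge:
  fixes E :: "nat \<Rightarrow> 'a set"
  assumes "\<And>i. i < N \<Longrightarrow> closed (E i)"
  shows "charge X - charge (X \<inter> (\<Inter>i<N. E i)) \<le> (\<Sum>i<N. charge X - charge (E i))"
  using assms
proof (induction N)
  case (Suc N)
  let ?F = "X \<inter> (\<Inter>i<N. E i)"
  have "closed ?F" using Suc.prems closed_X by (intro closed_Int closed_INT) auto
  then have "charge ?F + charge (E N) \<le> charge (?F \<union> E N) + charge (?F \<inter> E N)"
    by (intro charge_supermodular Suc.prems) auto
  also have "?F \<inter> E N = X \<inter> (\<Inter>i<Suc N. E i)" by (auto simp: lessThan_Suc)
  finally show ?case using Suc charge_le_X[of "?F \<union> E N"] by simp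
qed simp

text \<open>Here compactness becomes the source of countable additivity: the part of
  \<open>X\<close> where a strict majorant of the intersection is at most \<open>1\<close> is
  compact, and finitely many of the \<open>E i\<close> already have no common point in it.\<close>

lemma charge_continuous:
  assumes E: "\<And>i::nat. closed (E i)" and "e > 0"
  shows "\<exists>N. charge (X \<inter> (\<Inter>i<N. E i)) < charge (\<Inter>i. E i) + e"
proof -
  obtain f where f: "L f < charge (\<Inter>i. E i) + e" "\<forall>x\<in>X. 0 \<le> ev x f" "\<forall>x\<in>(\<Inter>i. E i) \<inter> X. 1 < ev x f"
    using ex_majorant_gt_1[OF \<open>e > 0\<close>] by blast
  let ?K = "X \<inter> {x. ev x f \<le> 1}"
  have "compact ?K" using compact_X closed_ev_le by blast
  moreover have "?K \<inter> (\<Inter>i. E i) = {}" using f(3) by force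
  ultimately obtain I where I: "finite I" "?K \<inter> (\<Inter>i\<in>I. E i) = {}"
    using compact_imp_fip_image[of ?K UNIV E] E by blast
  obtain N where N: "I \<subseteq> {..<N}" using finite_nat_iff_bounded I(1) by blast
  have "1 \<le> ev x f" if "x \<in> X \<inter> (\<Inter>i<N. E i)" for x
  proof (rule ccontr)
    assume "\<not> 1 \<le> ev x f"
    then have "x \<in> ?K \<inter> (\<Inter>i\<in>I. E i)" using that N by auto
    then show False using I(2) by blast
  qed
  then have "f \<in> majorants (X \<inter> (\<Inter>i<N. E i))" using f(2) by (simp add: majorants_def)
  from charge_le[OF this] f(1) show ?thesis by (intro exI[of _ N]) simp
qed

section \<open>Extension by inner regularity, and measurable sets\<close>

definition inner_charge :: "'a set \<Rightarrow> real"
  where "inner_charge A = Sup {charge C | C. closed C \<and> C \<subseteq> A \<inter> X}"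

lemma charge_le_inner:
  assumes "closed C" "C \<subseteq> A" "C \<subseteq> X"
  shows "charge C \<le> inner_charge A"
  unfolding inner_charge_def
  using assms charge_le_X by (intro cSup_upper bdd_aboveI[of _ "charge X"]) auto

lemma ex_inner:
  assumes "e > 0"
  shows "\<exists>C. closed C \<and> C \<subseteq> A \<inter> X \<and> inner_charge A < charge C + e"
proof -
  have "\<exists>x\<in>{charge C | C. closed C \<and> C \<subseteq> A \<inter> X}. inner_charge A - e < x"
    unfolding inner_charge_def using assms by (intro less_cSupD) (auto intro: exI[of _ "{}"])
  then show ?thesis by force
qed

lemma inner_charge_closed:
  assumes "closed C" "C \<subseteq> X"
  shows "inner_charge C = charge C"
proof (rule antisym)
  show "charge C \<le> inner_charge C" using assms by (intro charge_le_inner) auto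
  show "inner_charge C \<le> charge C" unfolding inner_charge_def
    using assms by (intro cSup_least) (auto intro: charge_mono)
qed

lemma inner_charge_nonneg: "0 \<le> inner_charge A"
  using charge_le_inner[of "{}" A] charge_empty by simp

lemma inner_charge_Int_X: "inner_charge (A \<inter> X) = inner_charge A"
  by (simp add: inner_charge_def Int_assoc)

lemma inner_charge_superadd:
  assumes "A \<inter> B = {}"
  shows "inner_charge A + inner_charge B \<le> inner_charge (A \<union> B)"
proof (rule field_le_epsilon)
  fix e :: real assume "e > 0"
  then have "e / 2 > 0" by simp
  then obtain C D where CD: "closed C" "C \<subseteq> A \<inter> X" "inner_charge A < charge C + e / 2"
      "closed D" "D \<subseteq> B \<inter> X" "inner_charge B < charge D + e / 2"
    using ex_inner by meson
  have "charge C + charge D \<le> charge (C \<union> D)" using CD assms by (intro charge_superadd) auto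
  also have "\<dots> \<le> inner_charge (A \<union> B)" using CD by (intro charge_le_inner) auto
  finally show "inner_charge A + inner_charge B \<le> inner_charge (A \<union> B) + e" using CD by simp
qed

text \<open>Caratheodory's condition, tested on \<open>X\<close> alone; the opposite inequality is a
  case of superadditivity.\<close>

definition charge_measurable :: "'a set \<Rightarrow> bool"
  where "charge_measurable A \<longleftrightarrow> charge X \<le> inner_charge A + inner_charge (- A)"

lemma charge_measurable_Compl: "charge_measurable (- A) \<longleftrightarrow> charge_measurable A"
  by (simp add: charge_measurable_def add.commute)

lemma charge_measurable_closed:
  assumes "closed C"
  shows "charge_measurable C"
  unfolding charge_measurable_def
proof (rule field_le_epsilon)
  fix e :: real assume "e > 0"
  have "closed X" by (rule closed_X)
  then obtain D where D: "closed D" "D \<subseteq> X" "D \<inter> (C \<inter> X) = {}" "charge X \<le> charge (C \<inter> X) + charge D + e"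
    using charge_tight[OF _ order.refl \<open>e > 0\<close>] by blast
  have "charge (C \<inter> X) \<le> inner_charge C" "charge D \<le> inner_charge (- C)"
    using assms closed_X D by (auto intro!: charge_le_inner)
  then show "charge X \<le> inner_charge C + inner_charge (- C) + e" using D(4) by simp
qed

lemma charge_measurable_approx:
  assumes "charge_measurable A" "e > 0"
  shows "\<exists>C D. closed C \<and> closed D \<and> C \<subseteq> A \<inter> X \<and> D \<subseteq> - A \<inter> X \<and> charge X \<le> charge C + charge D + e"
proof -
  have "e / 2 > 0" using assms by simp
  then obtain C D where "closed C" "C \<subseteq> A \<inter> X" "inner_charge A < charge C + e / 2"
      "closed D" "D \<subseteq> - A \<inter> X" "inner_charge (- A) < charge D + e / 2"
    using ex_inner by meson
  moreover from this have "charge X \<le> charge C + charge D + e"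
    using assms(1) by (simp add: charge_measurable_def)
  ultimately show ?thesis by blast
qed

text \<open>Let closed \<open>C i\<close> and \<open>D i\<close> exhaust \<open>A i\<close> and its
  complement up to a geometric error. Intersecting the sets \<open>C i \<union> D i\<close> for
  \<open>i < N\<close> loses at most \<open>e / 2\<close>, and what remains is covered by finitely
  many \<open>C i\<close>, which lie in the union, and by the finite intersection of the
  \<open>D i\<close>. Only the latter needs a limit, provided by
  \<open>charge_continuous\<close>.\<close>

lemma charge_measurable_UN:
  fixes A :: "nat \<Rightarrow> 'a set"
  assumes A: "\<And>i. charge_measurable (A i)"
  shows "charge_measurable (\<Union>i. A i)"
  unfolding charge_measurable_def
proof (rule field_le_epsilon)
  fix e :: real assume "e > 0"
  then have e: "e / 2 > 0" by simp
  then have "\<forall>i. \<exists>C D. closed C \<and> closed D \<and> C \<subseteq> A i \<inter> X \<and> D \<subseteq> - A i \<inter> X \<and>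
      charge X \<le> charge C + charge D + (e / 2) / 2 ^ Suc i"
    using A by (intro allI charge_measurable_approx) auto
  then obtain C D where CD: "\<And>i. closed (C i)" "\<And>i. closed (D i)" "\<And>i. C i \<subseteq> A i \<inter> X" "\<And>i. D i \<subseteq> - A i \<inter> X"
      "\<And>i. charge X \<le> charge (C i) + charge (D i) + (e / 2) / 2 ^ Suc i"
    by metis
  obtain N where N: "charge (X \<inter> (\<Inter>i<N. D i)) < charge (\<Inter>i. D i) + e / 2"
    using charge_continuous[of D, OF CD(2) e] by blast
  have "charge X - charge (C i \<union> D i) \<le> (e / 2) / 2 ^ Suc i" for i
    using charge_superadd[OF CD(1,2)[of i]] CD(3,4,5)[of i] by force
  then have "(\<Sum>i<N. charge X - charge (C i \<union> D i)) \<le> (\<Sum>i<N. (e / 2) / 2 ^ Suc i)"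
    by (rule sum_mono)
  also have "\<dots> \<le> e / 2" by (rule sum_geometric_le[OF e])
  finally have "charge X - charge (X \<inter> (\<Inter>i<N. C i \<union> D i)) \<le> e / 2"
    using charge_Inter_ge[of N "\<lambda>i. C i \<union> D i"] CD(1,2) by (meson closed_Un order.trans)
  moreover have "charge (X \<inter> (\<Inter>i<N. C i \<union> D i)) \<le> charge ((\<Union>i<N. C i) \<union> (X \<inter> (\<Inter>i<N. D i)))"
    by (intro charge_mono) auto
  moreover have "\<dots> \<le> charge (\<Union>i<N. C i) + charge (X \<inter> (\<Inter>i<N. D i))" by (rule charge_subadd)
  moreover have "charge (\<Union>i<N. C i) \<le> inner_charge (\<Union>i. A i)"
    using CD(1,3) by (intro charge_le_inner closed_UN) (blast | simp)+
  moreover have "charge (X \<inter> (\<Inter>i<N. D i)) \<le> inner_charge (- (\<Union>i. A i)) + e / 2"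
  proof -
    have "charge (\<Inter>i. D i) \<le> inner_charge (- (\<Union>i. A i))"
    proof (rule charge_le_inner)
      show "closed (\<Inter>i. D i)" using CD(2) by (simp add: closed_INT)
      show "(\<Inter>i. D i) \<subseteq> X" using CD(4)[of 0] by (auto simp: subset_iff)
      show "(\<Inter>i. D i) \<subseteq> - (\<Union>i. A i)"
      proof
        fix x assume "x \<in> (\<Inter>i. D i)"
        then have "x \<in> D i" for i by simp
        then have "x \<notin> A i" for i using CD(4)[of i] by blast
        then show "x \<in> - (\<Union>i. A i)" by simp
      qed
    qed
    then show ?thesis using N by simp
  qed
  ultimately show "charge X \<le> inner_charge (\<Union>i. A i) + inner_charge (- (\<Union>i. A i)) + e" by linarith
qed

lemma charge_measurable_borel:
  assumes "A \<in> sets borel"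
  shows "charge_measurable A"
proof -
  have "A \<in> sigma_sets UNIV {U. open U}" using assms by (simp add: borel_def)
  then show ?thesis
  proof (induction rule: sigma_sets.induct)
    case (Basic U)
    then show ?case
      using charge_measurable_closed[of "- U"] charge_measurable_Compl by auto
  next
    case Empty
    then show ?case using charge_measurable_closed[of "{}"] by simp
  next
    case (Compl A)
    then show ?case using charge_measurable_Compl[of A] by (simp add: Compl_eq_Diff_UNIV)
  next
    case (Union A)
    then show ?case by (intro charge_measurable_UN)
  qed
qed

text \<open>Finite superadditivity gives one inequality. For the other, a closed \<open>C\<close>
  inside the union and closed \<open>D i\<close> outside the \<open>A i\<close> have no common
  point, so finitely many of them intersect in small charge and their defects add up to almost
  \<open>charge X\<close>. The defect of \<open>D i\<close> is at most the inner charge of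
  \<open>A i\<close> up to a geometric error.\<close>

lemma inner_charge_sums:
  fixes A :: "nat \<Rightarrow> 'a set"
  assumes A: "\<And>i. charge_measurable (A i)" and disj: "disjoint_family A"
  shows "(\<lambda>i. inner_charge (A i)) sums inner_charge (\<Union>i. A i)"
proof -
  let ?s = "\<lambda>N. \<Sum>i<N. inner_charge (A i)"
  have mono: "inner_charge B \<le> inner_charge D" if "B \<subseteq> D" for B D
    using inner_charge_superadd[of B "D - B"] inner_charge_nonneg[of "D - B"] that by (simp add: Un_absorb1)
  have "?s N \<le> inner_charge (\<Union>i<N. A i)" for N
  proof (induction N)
    case 0
    then show ?case by (simp add: inner_charge_nonneg)
  next
    case (Suc N)
    have "A i \<inter> A N = {}" if "i < N" for i
      using disjoint_family_onD[OF disj, of i N] that by simp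
    then have "(\<Union>i<N. A i) \<inter> A N = {}" by blast
    from inner_charge_superadd[OF this] Suc show ?case by (simp add: lessThan_Suc Un_commute)
  qed
  then have upper: "?s N \<le> inner_charge (\<Union>i. A i)" for N
    using mono[of "\<Union>i<N. A i" "\<Union>i. A i"] order.trans by blast
  have lower: "\<exists>N. inner_charge (\<Union>i. A i) < ?s N + e" if "e > 0" for e
  proof -
    have e: "e / 3 > 0" using that by simp
    obtain C where C: "closed C" "C \<subseteq> (\<Union>i. A i) \<inter> X" "inner_charge (\<Union>i. A i) < charge C + e / 3"
      using ex_inner[OF e] by blast
    have "\<forall>i. \<exists>D. closed D \<and> D \<subseteq> - A i \<inter> X \<and> charge X \<le> inner_charge (A i) + charge D + (e / 3) / 2 ^ Suc i"
    proof
      fix i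
      have "(e / 3) / 2 ^ Suc i > 0" using that by simp
      from charge_measurable_approx[OF A[of i] this] obtain C D where
        CD: "closed C" "closed D" "C \<subseteq> A i \<inter> X" "D \<subseteq> - A i \<inter> X"
          "charge X \<le> charge C + charge D + (e / 3) / 2 ^ Suc i"
        by (elim exE conjE)
      from CD(1,3) have "charge C \<le> inner_charge (A i)" by (intro charge_le_inner) auto
      then have "charge X \<le> inner_charge (A i) + charge D + (e / 3) / 2 ^ Suc i"
        using CD(5) by linarith
      then show "\<exists>D. closed D \<and> D \<subseteq> - A i \<inter> X \<and> charge X \<le> inner_charge (A i) + charge D + (e / 3) / 2 ^ Suc i"
        using CD(2,4) by blast
    qed
    from choice[OF this] obtain D where D: "\<And>i. closed (D i)" "\<And>i. D i \<subseteq> - A i \<inter> X"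
        "\<And>i. charge X \<le> inner_charge (A i) + charge (D i) + (e / 3) / 2 ^ Suc i"
      by blast
    \<comment> \<open>One sequence with \<open>C\<close> in front, so that the estimates for
      intersections treat \<open>C\<close> and the \<open>D j\<close> together.\<close>
    define E where "E i = (case i of 0 \<Rightarrow> C | Suc j \<Rightarrow> D j)" for i
    have E: "closed (E i)" for i using C(1) D(1) by (cases i) (simp_all add: E_def)
    have "(\<Inter>i. E i) = {}"
    proof (intro equals0I)
      fix x assume "x \<in> (\<Inter>i. E i)"
      then have x: "x \<in> E i" for i by blast
      from x[of 0] have "x \<in> C" by (simp add: E_def)
      then obtain j where "x \<in> A j" using C(2) by blast
      moreover have "x \<in> D j" using x[of "Suc j"] by (simp add: E_def)
      ultimately show False using D(2) by blast
    qed
    then obtain N where "charge (X \<inter> (\<Inter>i<N. E i)) < e / 3"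
      using charge_continuous[of E, OF E e] by (auto simp: charge_empty simp del: less_divide_eq_numeral1)
    moreover have "charge (X \<inter> (\<Inter>i<Suc N. E i)) \<le> charge (X \<inter> (\<Inter>i<N. E i))"
      by (intro charge_mono) auto
    ultimately have "charge X < (\<Sum>i<Suc N. charge X - charge (E i)) + e / 3"
      using charge_Inter_ge[of "Suc N" E] E by force
    also have "(\<Sum>i<Suc N. charge X - charge (E i)) = charge X - charge C + (\<Sum>i<N. charge X - charge (D i))"
      by (subst sum.lessThan_Suc_shift) (simp add: E_def)
    also have "(\<Sum>i<N. charge X - charge (D i)) \<le> (\<Sum>i<N. inner_charge (A i) + (e / 3) / 2 ^ Suc i)"
      using D(3) by (intro sum_mono) (simp add: algebra_simps)
    also have "\<dots> \<le> ?s N + e / 3"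
      using sum_geometric_le[OF e, of N] by (simp add: sum.distrib)
    finally show ?thesis using C(3) by (intro exI[of _ N]) simp
  qed
  show ?thesis
    unfolding sums_def
  proof (rule LIMSEQ_I)
    fix e :: real assume "e > 0"
    then obtain N where N: "inner_charge (\<Union>i. A i) < ?s N + e" using lower by blast
    have "norm (?s n - inner_charge (\<Union>i. A i)) < e" if "N \<le> n" for n
    proof -
      have "?s N \<le> ?s n" using that inner_charge_nonneg by (intro sum_mono2) auto
      then show ?thesis using N upper[of n] by (simp add: abs_less_iff)
    qed
    then show "\<exists>N. \<forall>n\<ge>N. norm (?s n - inner_charge (\<Union>i. A i)) < e" by blast
  qed
qed

section \<open>The measure, its Radon property and its integrals\<close>

definition riesz_measure :: "'a measure"
  where "riesz_measure = measure_of UNIV (sets borel) (\<lambda>A. ennreal (inner_charge A))"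

lemma sets_riesz_measure [simp]: "sets riesz_measure = sets borel"
  using sets.sigma_sets_eq[of borel] by (simp add: riesz_measure_def)

lemma space_riesz_measure [simp]: "space riesz_measure = UNIV"
  by (simp add: riesz_measure_def)

lemma emeasure_riesz_measure:
  assumes "A \<in> sets borel"
  shows "emeasure riesz_measure A = ennreal (inner_charge A)"
proof -
  have "sigma_algebra UNIV (sets borel)" using sets.sigma_algebra_axioms[of borel] by simp
  moreover have "positive (sets borel) (\<lambda>A. ennreal (inner_charge A))"
    by (simp add: positive_def inner_charge_closed charge_empty)
  moreover have "countably_additive (sets borel) (\<lambda>A. ennreal (inner_charge A))"
    unfolding countably_additive_def
  proof (intro allI impI)
    fix A :: "nat \<Rightarrow> 'a set" assume "range A \<subseteq> sets borel" "disjoint_family A"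
    then have "(\<lambda>i. inner_charge (A i)) sums inner_charge (\<Union>i. A i)"
      by (intro inner_charge_sums charge_measurable_borel) auto
    then show "suminf (\<lambda>i. ennreal (inner_charge (A i))) = ennreal (inner_charge (\<Union>i. A i))"
      by (intro suminf_ennreal_eq inner_charge_nonneg)
  qed
  ultimately show ?thesis
    unfolding riesz_measure_def using assms by (rule emeasure_measure_of_sigma)
qed

lemma measure_riesz_measure:
  assumes "A \<in> sets borel"
  shows "measure riesz_measure A = inner_charge A"
  using emeasure_riesz_measure[OF assms] inner_charge_nonneg by (simp add: measure_def)

lemma finite_riesz_measure: "finite_measure riesz_measure"
  by (rule finite_measureI) (simp add: emeasure_riesz_measure)

lemma measure_riesz_measure_closed:
  assumes "closed C"
  shows "measure riesz_measure C = charge (C \<inter> X)"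
proof -
  have "measure riesz_measure C = inner_charge (C \<inter> X)"
    unfolding inner_charge_Int_X by (rule measure_riesz_measure[OF borel_closed[OF assms]])
  then show ?thesis using assms closed_X by (simp add: inner_charge_closed closed_Int)
qed

lemma measure_riesz_measure_UNIV: "measure riesz_measure UNIV = L 1"
  using measure_riesz_measure_closed[of UNIV] by (simp add: charge_X)

lemma emeasure_riesz_measure_Compl_X: "emeasure riesz_measure (- X) = 0"
proof -
  have "emeasure riesz_measure (- X) = ennreal (inner_charge (- X))"
    using closed_X by (intro emeasure_riesz_measure) auto
  also have "inner_charge (- X) = inner_charge (- X \<inter> X)" by (rule inner_charge_Int_X[symmetric])
  also have "- X \<inter> X = {}" by blast
  also have "inner_charge {} = 0" by (simp add: inner_charge_closed charge_empty)
  finally show ?thesis by simp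
qed

lemma radon_riesz_measure: "radon_measure riesz_measure"
  unfolding radon_measure_def
proof (intro conjI allI ballI)
  show "\<exists>U. open U \<and> x \<in> U \<and> emeasure riesz_measure U < \<infinity>" for x
    by (intro exI[of _ UNIV]) (simp add: emeasure_riesz_measure)
  fix B :: "'a set" assume B: "B \<in> sets borel"
  let ?K = "{K. compact K \<and> K \<subseteq> B}"
  show "emeasure riesz_measure B = (SUP K\<in>?K. emeasure riesz_measure K)"
  proof (rule antisym)
    show "(SUP K\<in>?K. emeasure riesz_measure K) \<le> emeasure riesz_measure B"
      using B by (intro SUP_least emeasure_mono) auto
    show "emeasure riesz_measure B \<le> (SUP K\<in>?K. emeasure riesz_measure K)"
    proof (rule ennreal_le_epsilon)
      fix e :: real assume "e > 0"
      then obtain C where C: "closed C" "C \<subseteq> B \<inter> X" "inner_charge B < charge C + e"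
        using ex_inner by blast
      have "compact C" using compact_Int_closed[OF compact_X C(1)] C(2) by (simp add: Int_absorb1 inf.absorb2)
      have "emeasure riesz_measure B \<le> ennreal (charge C + e)"
        using C(3) by (simp add: emeasure_riesz_measure B ennreal_leI)
      also have "\<dots> = emeasure riesz_measure C + ennreal e"
        using C(1,2) \<open>e > 0\<close> by (simp add: emeasure_riesz_measure inner_charge_closed charge_nonneg)
      also have "emeasure riesz_measure C \<le> (SUP K\<in>?K. emeasure riesz_measure K)"
        using C(2) \<open>compact C\<close> by (intro SUP_upper) auto
      finally show "emeasure riesz_measure B \<le> (SUP K\<in>?K. emeasure riesz_measure K) + ennreal e"
        by (simp add: add_right_mono)
    qed
  qed
qed simp


text \<open>Let \<open>C k\<close> be the set where \<open>n * f \<ge> k + 1\<close>. The layers of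
  \<open>n * f\<close> show that the charges of the \<open>C k\<close> add up to at most
  \<open>n * L f\<close>, while on \<open>X\<close> the function \<open>n * f\<close> exceeds the
  number of \<open>C k\<close> containing the point by at most \<open>1\<close>. Hence
  \<open>n\<close> times the integral is at most \<open>L 1 + n * L f\<close>, and a large
  \<open>n\<close> removes \<open>L 1\<close>.\<close>

lemma integral_riesz_measure_le:
  assumes f: "\<And>x. x \<in> X \<Longrightarrow> 0 \<le> ev x f" "\<And>x. x \<in> X \<Longrightarrow> ev x f \<le> 1"
  shows "(\<integral>x. ev x f \<partial>riesz_measure) \<le> L f"
proof -
  let ?\<mu> = riesz_measure
  let ?I = "\<integral>x. ev x f \<partial>?\<mu>"
  interpret finite_measure ?\<mu> by (rule finite_riesz_measure)
  have step: "real n * ?I \<le> L 1 + real n * L f" for n :: nat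
  proof -
    define C where "C k = {x. real k + 1 \<le> ev x (real n *\<^sub>R f)}" for k
    have C: "closed (C k)" for k unfolding C_def by (rule closed_ev_ge)
    have charge_sum: "(\<Sum>k<n. charge (C k)) \<le> real n * L f"
    proof (rule field_le_epsilon)
      fix e :: real assume "e > 0"
      \<comment> \<open>The layers are continuous but need not come from the algebra, and are
        replaced by elements \<open>q k\<close> up to \<open>d\<close>. The errors add up to
        \<open>2 * n * d * L 1\<close>, which this choice keeps at most \<open>e\<close>.\<close>
      define d where "d = e / (2 * real n * L 1 + 1)"
      have d: "d > 0" using \<open>e > 0\<close> L_one_nonneg by (simp add: d_def add_nonneg_pos)
      have "\<exists>q. \<forall>x\<in>X. \<bar>min 1 (max 0 (real n * ev x f - real k)) - ev x q\<bar> < d" for k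
        by (intro ex_approximation d continuous_intros continuous_on_subset[OF ev_continuous]) simp
      then obtain q where q: "\<And>k x. x \<in> X \<Longrightarrow> \<bar>min 1 (max 0 (real n * ev x f - real k)) - ev x (q k)\<bar> < d"
        by metis
      have "charge (C k) \<le> L (q k) + d * L 1" for k
      proof -
        have "q k + of_real d \<in> majorants (C k)"
          unfolding majorants_def
        proof (intro CollectI conjI ballI)
          fix x assume "x \<in> X"
          from q[OF this, of k] have "min 1 (max 0 (real n * ev x f - real k)) \<le> ev x (q k) + d" by linarith
          moreover have "0 \<le> min 1 (max 0 (real n * ev x f - real k))" by simp
          ultimately show "0 \<le> ev x (q k + of_real d)" unfolding ev_add ev_of_real by linarith
        next
          fix x assume "x \<in> C k \<inter> X"
          then have "min 1 (max 0 (real n * ev x f - real k)) = 1" "x \<in> X" by (auto simp: C_def ev_scale)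
          with q[of x k] show "1 \<le> ev x (q k + of_real d)" by (simp add: ev_add abs_less_iff)
        qed
        from charge_le[OF this] show ?thesis by (simp add: linear_add[OF linear_L] L_of_real)
      qed
      then have "(\<Sum>k<n. charge (C k)) \<le> (\<Sum>k<n. L (q k) + d * L 1)" by (rule sum_mono)
      also have "\<dots> = L (\<Sum>k<n. q k) + real n * d * L 1"
        by (simp add: sum.distrib linear_sum[OF linear_L])
      also have "L (\<Sum>k<n. q k) \<le> L (real n *\<^sub>R f + of_real (real n * d))"
      proof (rule L_mono)
        fix x assume x: "x \<in> X"
        have "ev x (\<Sum>k<n. q k) \<le> (\<Sum>k<n. min 1 (max 0 (real n * ev x f - real k)) + d)"
          unfolding ev_sum
        proof (rule sum_mono)
          show "ev x (q k) \<le> min 1 (max 0 (real n * ev x f - real k)) + d" for k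
            using q[OF x, of k] by linarith
        qed
        also have "\<dots> = real n * ev x f + real n * d"
          using f[OF x] by (simp add: sum.distrib sum_clamp mult_left_le)
        finally show "ev x (\<Sum>k<n. q k) \<le> ev x (real n *\<^sub>R f + of_real (real n * d))"
          by (simp only: ev_add ev_scale ev_of_real real_scaleR_def)
      qed
      also have "L (real n *\<^sub>R f + of_real (real n * d)) = real n * L f + real n * d * L 1"
        by (simp only: linear_add[OF linear_L] linear_scale[OF linear_L] L_of_real real_scaleR_def)
      also have "real n * L f + real n * d * L 1 + real n * d * L 1 = real n * L f + d * (2 * real n * L 1)" by simp
      also have "d * (2 * real n * L 1) \<le> d * (2 * real n * L 1 + 1)" using d by simp
      also have "\<dots> = e" using L_one_nonneg by (simp add: d_def add_nonneg_eq_0_iff)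
      finally show "(\<Sum>k<n. charge (C k)) \<le> real n * L f + e" by simp
    qed
    have meas: "measure ?\<mu> (C k) = charge (C k \<inter> X)" for k
      by (rule measure_riesz_measure_closed[OF C])
    have "real n * ?I = (\<integral>x. real n * ev x f \<partial>?\<mu>)" by simp
    also have "\<dots> \<le> (\<integral>x. 1 + (\<Sum>k<n. indicator (C k) x) \<partial>?\<mu>)"
    proof (rule integral_mono_AE)
      show "integrable ?\<mu> (\<lambda>x. real n * ev x f)"
        by (intro integrable_mult_right integrable_ev finite_riesz_measure emeasure_riesz_measure_Compl_X) simp
      show "integrable ?\<mu> (\<lambda>x. 1 + (\<Sum>k<n. indicator (C k) x) :: real)"
        using C by (intro Bochner_Integration.integrable_add integrable_const Bochner_Integration.integrable_sum
            integrable_real_indicator) (auto simp: less_top[symmetric])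
      have "real n * ev x f \<le> 1 + (\<Sum>k<n. indicator (C k) x)" if x: "x \<in> X" for x
      proof -
        have "real n * ev x f \<le> real n" using f[OF x] by (simp add: mult_left_le)
        \<comment> \<open>Lowering by \<open>1\<close> brings layer \<open>k\<close> under the
          indicator of \<open>C k\<close>.\<close>
        then have "real n * ev x f \<le> 1 + (\<Sum>k<n. min 1 (max 0 (real n * ev x f - 1 - real k)))"
          unfolding sum_clamp by (simp add: min_def max_def)
        also have "(\<Sum>k<n. min 1 (max 0 (real n * ev x f - 1 - real k))) \<le> (\<Sum>k<n. indicator (C k) x)"
          by (intro sum_mono) (auto simp: C_def ev_scale indicator_def)
        finally show ?thesis by simp
      qed
      then show "AE x in ?\<mu>. real n * ev x f \<le> 1 + (\<Sum>k<n. indicator (C k) x)"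
        by (intro eventually_mono[OF AE_mem_X] emeasure_riesz_measure_Compl_X) auto
    qed
    also have "\<dots> = measure ?\<mu> UNIV + (\<Sum>k<n. measure ?\<mu> (C k))"
      using C by (subst Bochner_Integration.integral_add)
        (auto simp: less_top[symmetric] intro!: Bochner_Integration.integrable_sum integrable_real_indicator)
    also have "measure ?\<mu> UNIV = L 1" by (rule measure_riesz_measure_UNIV)
    also have "(\<Sum>k<n. measure ?\<mu> (C k)) \<le> (\<Sum>k<n. charge (C k))"
      unfolding meas by (intro sum_mono charge_mono) auto
    finally show ?thesis using charge_sum by simp
  qed
  show ?thesis
  proof (rule ccontr)
    assume "\<not> ?I \<le> L f"
    then have "?I - L f > 0" by simp
    then obtain n where "L 1 < real n * (?I - L f)" using reals_Archimedean3 by blast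
    then show False using step[of n] by (simp add: right_diff_distrib)
  qed
qed

theorem integral_riesz_measure: "(\<integral>x. ev x f \<partial>riesz_measure) = L f"
proof -
  let ?\<mu> = riesz_measure
  interpret finite_measure ?\<mu> by (rule finite_riesz_measure)
  have int: "integrable ?\<mu> (\<lambda>x. ev x f)" for f
    by (intro integrable_ev finite_riesz_measure emeasure_riesz_measure_Compl_X) simp
  note mass = measure_riesz_measure_UNIV
  have le: "(\<integral>x. ev x f \<partial>?\<mu>) \<le> L f" for f
  proof -
    obtain B where B: "B > 0" "\<And>x. x \<in> X \<Longrightarrow> \<bar>ev x f\<bar> \<le> B" using ev_bounded by blast
    \<comment> \<open>Moves the values on \<open>X\<close> from the interval between
      \<open>- B\<close> and \<open>B\<close> into the unit interval.\<close>
    let ?g = "(1 / (2 * B)) *\<^sub>R (f + of_real B)"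
    have "(\<integral>x. ev x ?g \<partial>?\<mu>) \<le> L ?g"
    proof (rule integral_riesz_measure_le)
      fix x assume "x \<in> X"
      from B(2)[OF this] B(1) show "0 \<le> ev x ?g" "ev x ?g \<le> 1"
        by (auto simp: ev_scale ev_add field_simps abs_le_iff)
    qed
    moreover have "(\<integral>x. ev x ?g \<partial>?\<mu>) = 1 / (2 * B) * ((\<integral>x. ev x f \<partial>?\<mu>) + B * L 1)"
      using int[of f] by (simp add: ev_scale ev_add mass)
    moreover have "L ?g = 1 / (2 * B) * (L f + B * L 1)"
      by (simp add: linear_scale[OF linear_L] linear_add[OF linear_L] L_of_real)
    ultimately have "1 / (2 * B) * ((\<integral>x. ev x f \<partial>?\<mu>) + B * L 1) \<le> 1 / (2 * B) * (L f + B * L 1)" by simp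
    then show ?thesis using B(1) by (simp add: divide_le_cancel)
  qed
  from le[of f] le[of "- f"] show ?thesis
    by (simp add: ev_minus linear_neg[OF linear_L])
qed

end

section \<open>Radon measures\<close>

lemma radon_measureD:
  assumes "radon_measure \<mu>"
  shows "sets \<mu> = sets borel"
    and "\<exists>U. open U \<and> x \<in> U \<and> emeasure \<mu> U < \<infinity>"
    and "B \<in> sets borel \<Longrightarrow> emeasure \<mu> B = (SUP K\<in>{K. compact K \<and> K \<subseteq> B}. emeasure \<mu> K)"
  using assms by (auto simp: radon_measure_def)

lemma radon_emeasure_eqI:
  assumes "radon_measure \<mu>" "radon_measure \<nu>"
    and "\<And>K. compact K \<Longrightarrow> emeasure \<mu> K = emeasure \<nu> K"
  shows "\<mu> = \<nu>"
proof (rule measure_eqI)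
  show "sets \<mu> = sets \<nu>" using assms(1,2) by (simp add: radon_measureD)
  fix B assume "B \<in> sets \<mu>"
  then have B: "B \<in> sets borel" using assms(1) by (simp add: radon_measureD)
  show "emeasure \<mu> B = emeasure \<nu> B"
    unfolding radon_measureD(3)[OF assms(1) B] radon_measureD(3)[OF assms(2) B]
    using assms(3) by (intro SUP_cong) auto
qed

text \<open>A compact subset of the union is covered by finitely many of the null sets, and inner
  regularity passes to the whole union. The index set is arbitrary, since balls and positivity sets
  are intersections over all vectors or all elements of a module.\<close>

lemma radon_null_UN:
  assumes \<mu>: "radon_measure \<mu>"
    and U: "\<And>i. i \<in> I \<Longrightarrow> open (U i)" "\<And>i. i \<in> I \<Longrightarrow> emeasure \<mu> (U i) = 0"
  shows "emeasure \<mu> (\<Union>i\<in>I. U i) = 0"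
proof -
  note sets = radon_measureD(1)[OF \<mu>]
  have "emeasure \<mu> K = 0" if K: "compact K" "K \<subseteq> (\<Union>i\<in>I. U i)" for K
  proof -
    obtain J where J: "J \<subseteq> I" "finite J" "K \<subseteq> (\<Union>i\<in>J. U i)"
      using compactE_image[OF K(1) _ K(2)] U(1) by metis
    have "(\<Union>i\<in>J. U i) \<in> sets \<mu>" using J(1) U(1) unfolding sets by (intro borel_open open_UN) auto
    then have "emeasure \<mu> K \<le> emeasure \<mu> (\<Union>i\<in>J. U i)" using J(3) by (intro emeasure_mono)
    also have "\<dots> \<le> (\<Sum>i\<in>J. emeasure \<mu> (U i))"
      using J U(1) sets by (intro emeasure_subadditive_finite) auto
    also have "\<dots> = 0" using J U(2) by (intro sum.neutral) auto
    finally show ?thesis by simp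
  qed
  moreover have "(\<Union>i\<in>I. U i) \<in> sets borel" using U(1) by (intro borel_open open_UN) auto
  ultimately show ?thesis unfolding radon_measureD(3)[OF \<mu> \<open>_ \<in> sets borel\<close>]
    by (auto intro!: antisym SUP_least)
qed

lemma supported_by_INT:
  assumes \<mu>: "radon_measure \<mu>"
    and F: "\<And>i. i \<in> I \<Longrightarrow> closed (F i)" "\<And>i. i \<in> I \<Longrightarrow> supported_by \<mu> (F i)"
  shows "supported_by \<mu> (\<Inter>i\<in>I. F i)"
  unfolding supported_by_def
proof
  show "(\<Inter>i\<in>I. F i) \<in> sets borel" using F(1) by (intro borel_closed closed_INT) auto
  have "emeasure \<mu> (\<Union>i\<in>I. - F i) = 0"
    using F by (intro radon_null_UN[OF \<mu>]) (auto simp: supported_by_def)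
  then show "emeasure \<mu> (- (\<Inter>i\<in>I. F i)) = 0" by simp
qed

lemma supported_by_Int:
  assumes "radon_measure \<mu>" "closed A" "closed B" "supported_by \<mu> A" "supported_by \<mu> B"
  shows "supported_by \<mu> (A \<inter> B)"
  using supported_by_INT[OF assms(1), of UNIV "\<lambda>b. if b then A else B"] assms by (simp add: UNIV_bool Int_commute)

lemma AE_supported_by:
  assumes "sets \<mu> = sets borel" "supported_by \<mu> A"
  shows "AE x in \<mu>. x \<in> A"
proof (rule AE_I)
  show "{x \<in> space \<mu>. x \<notin> A} \<subseteq> - A" by blast
  show "emeasure \<mu> (- A) = 0" using assms(2) by (simp add: supported_by_def)
  show "- A \<in> sets \<mu>" using assms by (simp add: supported_by_def borel_comp)
qed

lemma finite_measure_radon: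
  assumes \<mu>: "radon_measure \<mu>" and K: "compact K" "supported_by \<mu> K"
  shows "finite_measure \<mu>"
proof (rule finite_measureI)
  note sets = radon_measureD(1)[OF \<mu>]
  have space: "space \<mu> = UNIV" using sets_eq_imp_space_eq[OF sets] by simp
  obtain U where U: "\<And>x. open (U x)" "\<And>x. x \<in> U x" "\<And>x. emeasure \<mu> (U x) < \<infinity>"
    using radon_measureD(2)[OF \<mu>] by metis
  have "K \<subseteq> (\<Union>x\<in>K. U x)" using U(2) by blast
  from compactE_image[OF K(1) U(1) this] obtain J where J: "finite J" "K \<subseteq> (\<Union>i\<in>J. U i)" .
  have UJ: "(\<Union>i\<in>J. U i) \<in> sets \<mu>" unfolding sets using U(1) by (intro borel_open open_UN) auto
  have CK: "- K \<in> sets \<mu>" using K(2) sets by (simp add: supported_by_def borel_comp)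
  have "emeasure \<mu> UNIV \<le> emeasure \<mu> ((\<Union>i\<in>J. U i) \<union> - K)"
    using J(2) by (intro emeasure_mono sets.Un UJ CK) auto
  also have "\<dots> \<le> emeasure \<mu> (\<Union>i\<in>J. U i) + emeasure \<mu> (- K)"
    by (rule emeasure_subadditive[OF UJ CK])
  also have "emeasure \<mu> (- K) = 0" using K(2) by (simp add: supported_by_def)
  also have "emeasure \<mu> (\<Union>i\<in>J. U i) \<le> (\<Sum>i\<in>J. emeasure \<mu> (U i))"
    using J U(1) sets by (intro emeasure_subadditive_finite) auto
  also have "(\<Sum>i\<in>J. emeasure \<mu> (U i)) + 0 < \<infinity>"
    using J(1) U(3) by (simp add: less_top ennreal_sum_less_top)
  finally show "emeasure \<mu> (space \<mu>) \<noteq> \<infinity>" using space by simp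
qed

lemma radon_ex_compact:
  assumes \<mu>: "radon_measure \<mu>" "finite_measure \<mu>" and B: "B \<in> sets borel" and "e > 0"
  shows "\<exists>K. compact K \<and> K \<subseteq> B \<and> measure \<mu> B < measure \<mu> K + e"
proof (cases "measure \<mu> B < e")
  \<comment> \<open>Here the empty set serves; otherwise \<open>measure \<mu> B - e\<close> is
    nonnegative and passes to \<open>ennreal\<close> unchanged.\<close>
  case True
  then show ?thesis by (intro exI[of _ "{}"]) simp
next
  case False
  interpret finite_measure \<mu> by (rule \<mu>(2))
  have "ennreal (measure \<mu> B - e) < ennreal (measure \<mu> B)"
    using False \<open>e > 0\<close> by (intro ennreal_lessI) auto
  also have "\<dots> = (SUP K\<in>{K. compact K \<and> K \<subseteq> B}. emeasure \<mu> K)"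
    using radon_measureD(3)[OF \<mu>(1) B] by (simp add: emeasure_eq_measure)
  finally obtain K where K: "compact K" "K \<subseteq> B" "ennreal (measure \<mu> B - e) < emeasure \<mu> K"
    by (auto simp: less_SUP_iff)
  then have "measure \<mu> B - e < measure \<mu> K"
    using False by (simp add: emeasure_eq_measure ennreal_less_iff)
  then show ?thesis using K by (intro exI[of _ K]) simp
qed

section \<open>What the integrals of algebra elements determine about a Radon measure\<close>

context compact_function_algebra
begin

text \<open>Choose a compact \<open>D\<close> in \<open>X - C\<close> that leaves out less than
  \<open>e\<close> of it for \<open>\<nu>\<close>, and an algebra element near \<open>1\<close> on
  \<open>C\<close> and near \<open>0\<close> on \<open>D\<close>. Up to terms vanishing with
  \<open>e\<close>, its integral lies above the \<open>\<mu>\<close>-measure and below the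
  \<open>\<nu>\<close>-measure of \<open>C\<close>.\<close>

lemma radon_measure_le_compact:
  assumes \<mu>: "radon_measure \<mu>" "supported_by \<mu> X" and \<nu>: "radon_measure \<nu>" "supported_by \<nu> X"
    and eq: "\<And>f. (\<integral>x. ev x f \<partial>\<mu>) = (\<integral>x. ev x f \<partial>\<nu>)"
    and C: "compact C" "C \<subseteq> X"
  shows "measure \<mu> C \<le> measure \<nu> C"
proof -
  interpret \<mu>: finite_measure \<mu> by (rule finite_measure_radon[OF \<mu>(1) compact_X \<mu>(2)])
  interpret \<nu>: finite_measure \<nu> by (rule finite_measure_radon[OF \<nu>(1) compact_X \<nu>(2)])
  note sets = radon_measureD(1)[OF \<mu>(1)] radon_measureD(1)[OF \<nu>(1)]
  have space: "space \<nu> = UNIV" using sets_eq_imp_space_eq[OF sets(2)] by simp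
  have int: "integrable \<mu> (\<lambda>x. ev x f)" "integrable \<nu> (\<lambda>x. ev x f)" for f
    using \<mu>(2) \<nu>(2) sets by (auto intro!: integrable_ev \<mu>.finite_measure_axioms \<nu>.finite_measure_axioms simp: supported_by_def)
  have AE: "AE x in \<mu>. x \<in> X" "AE x in \<nu>. x \<in> X" using AE_supported_by sets \<mu>(2) \<nu>(2) by blast+
  have closed_C: "closed C" using C(1) by (rule compact_imp_closed)
  have "(1 - e) * measure \<mu> C \<le> measure \<nu> C + e * (1 + measure \<nu> UNIV)" if e: "0 < e" "e < 1" for e
  proof -
    have XC: "X - C \<in> sets borel" using closed_X closed_C by auto
    obtain D where D: "compact D" "D \<subseteq> X - C" "measure \<nu> (X - C) < measure \<nu> D + e"
      using radon_ex_compact[OF \<nu>(1) \<nu>.finite_measure_axioms XC e(1)] by blast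
    have closed_D: "closed D" using D(1) by (rule compact_imp_closed)
    obtain f where f: "\<And>x. x \<in> X \<Longrightarrow> 0 \<le> ev x f" "\<And>x. x \<in> X \<Longrightarrow> ev x f \<le> 1"
        "\<And>x. x \<in> D \<Longrightarrow> ev x f < e" "\<And>x. x \<in> C \<Longrightarrow> 1 - e < ev x f"
      using ex_separating[of D C e] closed_D closed_C C(2) D(2) e by blast
    have "(1 - e) * measure \<mu> C = (\<integral>x. (1 - e) * indicator C x \<partial>\<mu>)"
      using closed_C sets by simp
    also have "\<dots> \<le> (\<integral>x. ev x f \<partial>\<mu>)"
    proof (rule integral_mono_AE)
      show "integrable \<mu> (\<lambda>x. (1 - e) * indicator C x)"
        using closed_C sets by (intro integrable_mult_right integrable_real_indicator) (auto simp: \<mu>.emeasure_eq_measure)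
      show "AE x in \<mu>. (1 - e) * indicator C x \<le> ev x f"
        by (rule eventually_mono[OF AE(1)]) (use f in \<open>auto simp: indicator_def less_imp_le\<close>)
    qed (rule int)
    also have "\<dots> = (\<integral>x. ev x f \<partial>\<nu>)" by (rule eq)
    also have "\<dots> \<le> (\<integral>x. e + indicator (X - D) x \<partial>\<nu>)"
    proof (rule integral_mono_AE)
      show "integrable \<nu> (\<lambda>x. e + indicator (X - D) x)"
        using closed_D closed_X sets by (intro Bochner_Integration.integrable_add integrable_real_indicator \<nu>.integrable_const) (auto simp: \<nu>.emeasure_eq_measure)
      show "AE x in \<nu>. ev x f \<le> e + indicator (X - D) x"
        by (rule eventually_mono[OF AE(2)])
          (use f e in \<open>auto simp: indicator_def less_imp_le intro: add_increasing\<close>)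
    qed (rule int)
    also have "\<dots> = e * measure \<nu> UNIV + measure \<nu> (X - D)"
      using closed_D closed_X sets by (subst Bochner_Integration.integral_add) (auto simp: \<nu>.emeasure_eq_measure space intro!: integrable_real_indicator)
    also have "measure \<nu> (X - D) \<le> measure \<nu> (C \<union> ((X - C) - D))"
      using closed_D closed_X closed_C sets by (intro \<nu>.finite_measure_mono) auto
    also have "\<dots> \<le> measure \<nu> C + measure \<nu> ((X - C) - D)"
      using closed_D closed_X closed_C sets by (intro measure_Un_le) auto
    also have "measure \<nu> ((X - C) - D) = measure \<nu> (X - C) - measure \<nu> D"
      using closed_D closed_X closed_C sets D(2) by (intro \<nu>.finite_measure_Diff) auto
    finally show ?thesis using D(3) by (simp add: algebra_simps)
  qed
  then have "\<forall>\<^sub>F e in at_right 0. (1 - e) * measure \<mu> C \<le> measure \<nu> C + e * (1 + measure \<nu> UNIV)"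
    using eventually_at_right_real[of 0 "1::real"] by (auto elim!: eventually_mono)
  moreover have "((\<lambda>e. (1 - e) * measure \<mu> C) \<longlongrightarrow> (1 - 0) * measure \<mu> C) (at_right 0)"
    by (intro tendsto_intros)
  moreover have "((\<lambda>e. measure \<nu> C + e * (1 + measure \<nu> UNIV)) \<longlongrightarrow> measure \<nu> C + 0 * (1 + measure \<nu> UNIV)) (at_right 0)"
    by (intro tendsto_intros)
  ultimately show ?thesis
    using tendsto_le[of "at_right (0::real)"] by force
qed

lemma radon_measure_unique:
  assumes \<mu>: "radon_measure \<mu>" "supported_by \<mu> X" and \<nu>: "radon_measure \<nu>" "supported_by \<nu> X"
    and eq: "\<And>f. (\<integral>x. ev x f \<partial>\<mu>) = (\<integral>x. ev x f \<partial>\<nu>)"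
  shows "\<mu> = \<nu>"
proof (rule radon_emeasure_eqI[OF \<mu>(1) \<nu>(1)])
  fix K :: "'a set" assume K: "compact K"
  interpret \<mu>: finite_measure \<mu> by (rule finite_measure_radon[OF \<mu>(1) compact_X \<mu>(2)])
  interpret \<nu>: finite_measure \<nu> by (rule finite_measure_radon[OF \<nu>(1) compact_X \<nu>(2)])
  note sets = radon_measureD(1)[OF \<mu>(1)] radon_measureD(1)[OF \<nu>(1)]
  have KX: "compact (K \<inter> X)" using K closed_X by (rule compact_Int_closed)
  have closed: "closed K" using K by (rule compact_imp_closed)
  have "measure \<mu> (K \<inter> X) = measure \<nu> (K \<inter> X)"
    using radon_measure_le_compact[OF \<mu> \<nu> eq KX] radon_measure_le_compact[OF \<nu> \<mu> eq[symmetric] KX] by simp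
  moreover have "emeasure \<mu> K = emeasure \<mu> (K \<inter> X)"
    using closed closed_X sets AE_supported_by[OF sets(1) \<mu>(2)]
    by (intro emeasure_eq_AE) (auto elim: eventually_mono)
  moreover have "emeasure \<nu> K = emeasure \<nu> (K \<inter> X)"
    using closed closed_X sets AE_supported_by[OF sets(2) \<nu>(2)]
    by (intro emeasure_eq_AE) (auto elim: eventually_mono)
  ultimately show "emeasure \<mu> K = emeasure \<nu> K"
    by (simp add: \<mu>.emeasure_eq_measure \<nu>.emeasure_eq_measure)
qed

text \<open>Localisation: if \<open>g\<close> were at most \<open>- \<delta>\<close> on a compact set of positive measure, one could take
  for \<open>a\<close> an element close to \<open>1\<close> on that set and to \<open>0\<close> where \<open>g \<ge> 0\<close>.\<close>

lemma nonneg_of_localized_integrals: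
  assumes \<mu>: "radon_measure \<mu>" "supported_by \<mu> X" and m: "m \<ge> 1"
    and pos: "\<And>a. 0 \<le> (\<integral>x. ev x (a ^ (2 * m) * g) \<partial>\<mu>)"
  shows "emeasure \<mu> {x. ev x g < 0} = 0"
proof (rule ccontr)
  assume nz: "emeasure \<mu> {x. ev x g < 0} \<noteq> 0"
  interpret finite_measure \<mu> by (rule finite_measure_radon[OF \<mu>(1) compact_X \<mu>(2)])
  note sets = radon_measureD(1)[OF \<mu>(1)]
  have space: "space \<mu> = UNIV" using sets_eq_imp_space_eq[OF sets] by simp
  have AE: "AE x in \<mu>. x \<in> X" using AE_supported_by[OF sets \<mu>(2)] .
  have int: "integrable \<mu> (\<lambda>x. ev x f)" for f
    using \<mu>(2) sets by (auto intro!: integrable_ev finite_measure_axioms simp: supported_by_def)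
  have N: "{x. ev x g < 0} \<in> sets borel"
    using closed_ev_ge[of 0 g] by (intro borel_open) (simp add: closed_def Collect_neg_eq[symmetric] not_le)
  have "measure \<mu> {x. ev x g < 0} > 0" using nz by (simp add: emeasure_eq_measure zero_less_measure_iff)
  then obtain K where K: "compact K" "K \<subseteq> {x. ev x g < 0}" "measure \<mu> K > 0"
    using radon_ex_compact[OF \<mu>(1) finite_measure_axioms N] by force
  \<comment> \<open>Separation is available only inside \<open>X\<close>; the measure does not
    change.\<close>
  define C where "C = K \<inter> X"
  have C: "compact C" "C \<subseteq> X" "C \<subseteq> {x. ev x g < 0}"
    using K closed_X by (auto simp: C_def intro: compact_Int_closed)
  have closed_C: "closed C" using C(1) by (rule compact_imp_closed)
  have "measure \<mu> C = measure \<mu> K"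
    using AE closed_C compact_imp_closed[OF K(1)] sets unfolding C_def
    by (intro finite_measure_eq_AE) (auto elim: eventually_mono)
  then have mC: "measure \<mu> C > 0" using K(3) by simp
  then have "C \<noteq> {}" by auto
  then obtain x0 where x0: "x0 \<in> C" "\<And>x. x \<in> C \<Longrightarrow> ev x g \<le> ev x0 g"
    using continuous_attains_sup[OF C(1), of "\<lambda>x. ev x g"] continuous_on_subset[OF ev_continuous] by blast
  define \<delta> where "\<delta> = - ev x0 g"
  have \<delta>: "\<delta> > 0" "\<And>x. x \<in> C \<Longrightarrow> ev x g \<le> - \<delta>" using x0 C(3) by (auto simp: \<delta>_def)
  obtain B where B: "B > 0" "\<And>x. x \<in> X \<Longrightarrow> \<bar>ev x g\<bar> \<le> B" using ev_bounded by blast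
  \<comment> \<open>On \<open>C\<close> one will have \<open>a \<ge> 1 / 2\<close> and
    \<open>g \<le> - \<delta>\<close>, so \<open>C\<close> lowers the integral by at least
    \<open>c\<close>.\<close>
  define c where "c = \<delta> * (1 / 2) ^ (2 * m) * measure \<mu> C"
  have c: "c > 0" using \<delta>(1) mC by (simp add: c_def)
  \<comment> \<open>The cap \<open>1 / 2\<close> gives \<open>a \<ge> 1 / 2\<close> on
    \<open>C\<close>; the other bound keeps the possible gain where \<open>g \<ge> 0\<close> at most
    \<open>c / 2\<close>.\<close>
  define e where "e = min (1 / 2) (c / (2 * (B * measure \<mu> UNIV + 1)))"
  have BM: "B * measure \<mu> UNIV \<ge> 0" using B(1) by simp
  have e: "0 < e" using c BM by (simp add: e_def add_nonneg_pos)
  have e_half: "e \<le> 1 / 2" unfolding e_def by (rule min.cobounded1)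
  let ?D = "{x. 0 \<le> ev x g} \<inter> X"
  have "closed ?D" using closed_ev_ge closed_X by (rule closed_Int)
  moreover have "?D \<inter> C = {}" using C(3) by force
  ultimately obtain a where a: "\<And>x. x \<in> X \<Longrightarrow> 0 \<le> ev x a" "\<And>x. x \<in> X \<Longrightarrow> ev x a \<le> 1"
      "\<And>x. x \<in> ?D \<Longrightarrow> ev x a < e" "\<And>x. x \<in> C \<Longrightarrow> 1 - e < ev x a"
    using ex_separating[of ?D C e] closed_C C(2) e e_half by force
  have "0 \<le> (\<integral>x. ev x (a ^ (2 * m) * g) \<partial>\<mu>)" by (rule pos)
  also have "\<dots> \<le> (\<integral>x. e * B - \<delta> * (1 / 2) ^ (2 * m) * indicator C x \<partial>\<mu>)"
  proof (rule integral_mono_AE)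
    show "integrable \<mu> (\<lambda>x. e * B - \<delta> * (1 / 2) ^ (2 * m) * indicator C x)"
      using closed_C sets by (intro Bochner_Integration.integrable_diff integrable_const integrable_mult_right integrable_real_indicator)
        (auto simp: emeasure_eq_measure)
    have "ev x (a ^ (2 * m) * g) \<le> e * B - \<delta> * (1 / 2) ^ (2 * m) * indicator C x" if x: "x \<in> X" for x
    proof -
      have eq: "ev x (a ^ (2 * m) * g) = ev x a ^ (2 * m) * ev x g" by (simp add: ev_mult ev_power)
      have p0: "0 \<le> ev x a ^ (2 * m)" by (simp add: power_mult)
      have eB: "0 \<le> e * B" using e B(1) by simp
      \<comment> \<open>Outside \<open>C\<close> and where \<open>g < 0\<close>, the size of
        \<open>a\<close> is uncontrolled, but the even power gives the product the right
        sign.\<close>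
      consider "x \<in> C" | "x \<notin> C" "ev x g < 0" | "x \<notin> C" "0 \<le> ev x g" by linarith
      then show ?thesis
      proof cases
        case 1
        have "(1 / 2) ^ (2 * m) \<le> ev x a ^ (2 * m)" using a(4)[OF 1] e_half by (intro power_mono) auto
        then have "(1 / 2) ^ (2 * m) * \<delta> \<le> ev x a ^ (2 * m) * (- ev x g)"
          using \<delta>(1) \<delta>(2)[OF 1] p0 by (intro mult_mono) auto
        then show ?thesis using 1 eB unfolding eq by (simp add: mult.commute)
      next
        case 2
        then have "ev x a ^ (2 * m) * ev x g \<le> 0" using p0 by (intro mult_nonneg_nonpos) auto
        then show ?thesis using 2 eB unfolding eq by simp
      next
        case 3
        have "ev x a ^ (2 * m) \<le> ev x a ^ 1" using a(1,2)[OF x] m by (intro power_decreasing) auto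
        also have "\<dots> \<le> e" using a(3)[of x] 3 x by simp
        finally have "ev x a ^ (2 * m) * ev x g \<le> e * B"
          using B(2)[OF x] 3 e by (intro mult_mono) auto
        then show ?thesis using 3 unfolding eq by simp
      qed
    qed
    then show "AE x in \<mu>. ev x (a ^ (2 * m) * g) \<le> e * B - \<delta> * (1 / 2) ^ (2 * m) * indicator C x"
      by (intro eventually_mono[OF AE])
  qed (rule int)
  also have "\<dots> = e * (B * measure \<mu> UNIV) - c"
    using closed_C sets by (subst Bochner_Integration.integral_diff)
      (auto simp: c_def space emeasure_eq_measure intro!: integrable_mult_right integrable_real_indicator)
  also have "e * (B * measure \<mu> UNIV) \<le> c / (2 * (B * measure \<mu> UNIV + 1)) * (B * measure \<mu> UNIV + 1)"
    using BM c by (intro mult_mono) (auto simp: e_def)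
  also have "\<dots> = c / 2" using BM by (simp add: add_nonneg_eq_0_iff field_simps)
  finally show False using c by simp
qed

end

section \<open>Functionals that are nonnegative on powers\<close>

definition bounded_power_positive :: "('v::real_vector \<Rightarrow> real) \<Rightarrow> nat \<Rightarrow> ('v symalg \<Rightarrow> real) \<Rightarrow> bool"
  where "bounded_power_positive \<rho> m L \<longleftrightarrow>
    linear L \<and> (\<exists>C. monomial_bounded \<rho> L C) \<and> (\<forall>a. 0 \<le> L (a ^ m))"

definition bipolar_cone :: "('v::real_vector \<Rightarrow> real) \<Rightarrow> nat \<Rightarrow> 'v symalg set"
  where "bipolar_cone \<rho> m = {a. \<forall>L. bounded_power_positive \<rho> m L \<longrightarrow> 0 \<le> L a}"

text \<open>Multiplication by a monomial concatenates lists, so its factor goes into the constant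
  while \<open>\<rho>\<close> stays. This is why the constant is left free in
  \<open>bounded_power_positive\<close>.\<close>

lemma monomial_bounded_mult:
  fixes s :: "'v::real_vector symalg"
  assumes \<rho>: "seminorm \<rho>" and L: "linear L" and b: "monomial_bounded \<rho> L C"
  shows "\<exists>C. monomial_bounded \<rho> (\<lambda>x. L (s * x)) C"
proof (induction s rule: symalg_induct)
  case (monom c us)
  have "\<bar>L (c *\<^sub>R sym_monom us * sym_monom vs)\<bar> \<le> (\<bar>c\<bar> * C * prod_list (map \<rho> us)) * prod_list (map \<rho> vs)" for vs
  proof -
    have "L (c *\<^sub>R sym_monom us * sym_monom vs) = c * L (sym_monom (us @ vs))"
      by (simp add: linear_scale[OF L])
    moreover have "\<bar>L (sym_monom (us @ vs))\<bar> \<le> C * prod_list (map \<rho> (us @ vs))"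
      using b unfolding monomial_bounded_def by blast
    ultimately show ?thesis
      using mult_left_mono[of "\<bar>L (sym_monom (us @ vs))\<bar>" "C * prod_list (map \<rho> (us @ vs))" "\<bar>c\<bar>"]
      by (simp add: abs_mult mult_ac)
  qed
  then show ?case unfolding monomial_bounded_def by blast
next
  case (add s t)
  then obtain A B where "monomial_bounded \<rho> (\<lambda>x. L (s * x)) A" "monomial_bounded \<rho> (\<lambda>x. L (t * x)) B" by blast
  then have *: "\<bar>L (s * sym_monom vs)\<bar> \<le> A * prod_list (map \<rho> vs)" "\<bar>L (t * sym_monom vs)\<bar> \<le> B * prod_list (map \<rho> vs)" for vs
    by (auto simp: monomial_bounded_def)
  have "\<bar>L ((s + t) * sym_monom vs)\<bar> \<le> (A + B) * prod_list (map \<rho> vs)" for vs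
    using *[of vs] abs_triangle_ineq[of "L (s * sym_monom vs)" "L (t * sym_monom vs)"]
    by (simp add: distrib_right linear_add[OF L])
  then show ?case unfolding monomial_bounded_def by blast
qed

lemma linear_comp_mult:
  fixes L :: "'a::real_algebra \<Rightarrow> real"
  shows "linear L \<Longrightarrow> linear (\<lambda>x. L (s * x))"
  by (simp add: linear_iff distrib_left)

text \<open>For admissible \<open>L\<close> the functional \<open>y \<mapsto> L (x ^ m * y)\<close>
  is admissible, because a product of two \<open>m\<close>-th powers is one; testing it on
  \<open>a\<close> gives \<open>L (a * x ^ m) \<ge> 0\<close>. So
  \<open>y \<mapsto> L (a * y)\<close> is admissible too and can be tested on
  \<open>b\<close>.\<close>

lemma bipolar_cone_mult:
  fixes a b :: "'v::real_vector symalg"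
  assumes \<rho>: "seminorm \<rho>" and a: "a \<in> bipolar_cone \<rho> m" and b: "b \<in> bipolar_cone \<rho> m"
  shows "a * b \<in> bipolar_cone \<rho> m"
  unfolding bipolar_cone_def
proof (intro CollectI allI impI)
  fix L :: "'v symalg \<Rightarrow> real" assume L: "bounded_power_positive \<rho> m L"
  then have lin: "linear L" and pos: "\<And>x. 0 \<le> L (x ^ m)" by (auto simp: bounded_power_positive_def)
  obtain C where C: "monomial_bounded \<rho> L C" using L by (auto simp: bounded_power_positive_def)
  have shift: "bounded_power_positive \<rho> m (\<lambda>x. L (s * x))" if "\<And>x. 0 \<le> L (s * x ^ m)" for s
    unfolding bounded_power_positive_def using monomial_bounded_mult[OF \<rho> lin C] linear_comp_mult[OF lin] that by blast
  have "0 \<le> L (a * x ^ m)" for x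
  proof -
    have "bounded_power_positive \<rho> m (\<lambda>y. L (x ^ m * y))"
      by (rule shift) (simp add: pos flip: power_mult_distrib)
    then have "0 \<le> L (x ^ m * a)" using a by (auto simp: bipolar_cone_def)
    then show ?thesis by (simp add: mult.commute)
  qed
  from shift[OF this] show "0 \<le> L (a * b)" using b by (auto simp: bipolar_cone_def)
qed

text \<open>At the powers of \<open>v / r\<close> the functional is bounded by
  \<open>C * (\<rho> v / r) ^ j\<close>, and \<open>\<rho> v < r\<close> is what the convergence of
  the binomial series requires.\<close>

lemma sym_of_add_mem_bipolar_cone:
  fixes v :: "'v::real_vector"
  assumes \<rho>: "seminorm \<rho>" and m: "m \<ge> 1" and r: "\<rho> v < r"
  shows "of_real r + sym_of v \<in> bipolar_cone \<rho> m"
  unfolding bipolar_cone_def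
proof (intro CollectI allI impI)
  fix L :: "'v symalg \<Rightarrow> real" assume L: "bounded_power_positive \<rho> m L"
  then have lin: "linear L" and pos: "\<And>x. 0 \<le> L (x ^ m)" by (auto simp: bounded_power_positive_def)
  obtain C where C: "monomial_bounded \<rho> L C" using L by (auto simp: bounded_power_positive_def)
  have r0: "0 \<le> \<rho> v" "0 < r" using seminormD(1)[OF \<rho>, of v] r by auto
  let ?x = "(1 / r) *\<^sub>R sym_of v"
  have "\<bar>L (?x ^ j)\<bar> \<le> C * (\<rho> v / r) ^ j" for j
  proof -
    have "?x ^ j = (1 / r) ^ j *\<^sub>R sym_monom (replicate j v)"
      by (induction j) simp_all
    then have "\<bar>L (?x ^ j)\<bar> = (1 / r) ^ j * \<bar>L (sym_monom (replicate j v))\<bar>"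
      using r0(2) by (simp add: linear_scale[OF lin] abs_mult del: map_replicate)
    also have "\<dots> \<le> (1 / r) ^ j * (C * prod_list (map \<rho> (replicate j v)))"
      using C r0(2) by (intro mult_left_mono) (auto simp: monomial_bounded_def simp del: map_replicate)
    also have "\<dots> = C * (\<rho> v / r) ^ j"
      by (simp add: prod_list_replicate power_divide)
    finally show ?thesis .
  qed
  from power_positive_one_plus[OF lin m pos this] have "0 \<le> L (1 + ?x)" using r r0 by simp
  then have "0 \<le> r * L (1 + ?x)" using r0(2) by simp
  also have "r * L (1 + ?x) = L (r *\<^sub>R (1 + ?x))" by (simp add: linear_scale[OF lin])
  also have "r *\<^sub>R (1 + ?x) = of_real r + sym_of v" using r0(2) by (simp add: scaleR_right_distrib of_real_def)
  finally show "0 \<le> L (of_real r + sym_of v)" .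
qed

text \<open>Bounds for both signs are carried along at once, because a product \<open>v * x\<close>
  is bounded by combining \<open>s + v\<close>, \<open>s - v\<close> with \<open>r + x\<close>,
  \<open>r - x\<close>. Induction on monomials starts from the generators; multiples and sums
  follow.\<close>

lemma archimedean_bipolar_cone:
  fixes \<rho> :: "'v::real_vector \<Rightarrow> real"
  assumes \<rho>: "seminorm \<rho>" and m: "m \<ge> 1"
  shows "archimedean_preprime (bipolar_cone \<rho> m)"
proof
  let ?T = "bipolar_cone \<rho> m"
  show add: "a + b \<in> ?T" if "a \<in> ?T" "b \<in> ?T" for a b
    using that by (auto simp: bipolar_cone_def bounded_power_positive_def linear_add)
  show mult: "a * b \<in> ?T" if "a \<in> ?T" "b \<in> ?T" for a b
    by (rule bipolar_cone_mult[OF \<rho> that])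
  show scalar: "of_real c \<in> ?T" if "0 \<le> c" for c
    unfolding bipolar_cone_def
  proof (intro CollectI allI impI)
    fix L :: "'v symalg \<Rightarrow> real" assume L: "bounded_power_positive \<rho> m L"
    then have "0 \<le> L (1 ^ m)" unfolding bounded_power_positive_def by blast
    then show "0 \<le> L (of_real c)"
      using L that by (simp add: of_real_def linear_scale bounded_power_positive_def)
  qed
  have "\<exists>r. of_real r - a \<in> ?T \<and> of_real r + a \<in> ?T" for a
  proof (induction a rule: symalg_induct)
    case (monom c vs)
    have gen: "\<exists>r\<ge>0. of_real r - sym_monom vs \<in> ?T \<and> of_real r + sym_monom vs \<in> ?T" for vs
    proof (induction vs)
      case Nil
      then show ?case using scalar[of 0] scalar[of 2] by (intro exI[of _ 1]) simp
    next
      case (Cons v vs)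
      then obtain r where r: "r \<ge> 0" "of_real r - sym_monom vs \<in> ?T" "of_real r + sym_monom vs \<in> ?T" by blast
      \<comment> \<open>The \<open>+ 1\<close> gives the strict inequality needed for membership in
        the cone.\<close>
      define s where "s = \<rho> v + 1"
      have s: "s \<ge> 0" using seminormD(1)[OF \<rho>, of v] by (simp add: s_def)
      have sv: "of_real s + sym_of v \<in> ?T" "of_real s - sym_of v \<in> ?T"
        using sym_of_add_mem_bipolar_cone[OF \<rho> m, of v s] sym_of_add_mem_bipolar_cone[OF \<rho> m, of "- v" s]
        by (auto simp: s_def seminorm_minus[OF \<rho>] linear_neg[OF linear_sym_of])
      have half: "x \<in> ?T" if "2 *\<^sub>R x \<in> ?T" for x
        using mult[OF scalar[of "1/2"] that] by (simp flip: scaleR_conv_of_real)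
      have "2 *\<^sub>R (of_real (s * r) + sym_of v * x) \<in> ?T"
        if "of_real r - x \<in> ?T" "of_real r + x \<in> ?T" for x
      proof -
        have "(of_real s + sym_of v) * (of_real r + x) + (of_real s - sym_of v) * (of_real r - x) \<in> ?T"
          by (intro add mult sv that)
        also have "(of_real s + sym_of v) * (of_real r + x) + (of_real s - sym_of v) * (of_real r - x) =
            2 *\<^sub>R (of_real (s * r) + sym_of v * x)"
          by (simp add: algebra_simps scaleR_2)
        finally show ?thesis .
      qed
      note * = half[OF this]
      from *[of "sym_monom vs"] *[of "- sym_monom vs"] r show ?case
        using s by (intro exI[of _ "s * r"]) simp
    qed
    obtain r where r: "r \<ge> 0" "of_real r - sym_monom vs \<in> ?T" "of_real r + sym_monom vs \<in> ?T" using gen by blast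
    have "of_real \<bar>c\<bar> * (of_real r - sym_monom vs) \<in> ?T" "of_real \<bar>c\<bar> * (of_real r + sym_monom vs) \<in> ?T"
      using r by (auto intro!: mult scalar)
    then show ?case
      by (intro exI[of _ "\<bar>c\<bar> * r"])
         (cases "c \<ge> 0"; simp add: algebra_simps scaleR_conv_of_real)
  next
    case (add f g)
    then obtain r s where "of_real r - f \<in> ?T" "of_real r + f \<in> ?T" "of_real s - g \<in> ?T" "of_real s + g \<in> ?T" by blast
    then have "(of_real r - f) + (of_real s - g) \<in> ?T" "(of_real r + f) + (of_real s + g) \<in> ?T"
      using \<open>\<And>a b. a \<in> ?T \<Longrightarrow> b \<in> ?T \<Longrightarrow> a + b \<in> ?T\<close> by blast+
    then show ?case by (intro exI[of _ "r + s"]) (simp add: algebra_simps)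
  qed
  then show "\<exists>r. of_real r - a \<in> ?T" for a by blast
qed

section \<open>The dual ball\<close>

lemma sym_eval_props:
  shows alg_hom_sym_eval: "alg_hom (sym_eval \<phi>)"
    and sym_eval_sym_of: "sym_eval \<phi> (sym_of v) = dual_app \<phi> v"
proof -
  have "linear (dual_app \<phi>)" using dual_app[of \<phi>] by simp
  from theI'[OF symalg_universal[OF this]]
  show "alg_hom (sym_eval \<phi>)" "sym_eval \<phi> (sym_of v) = dual_app \<phi> v"
    by (auto simp: sym_eval_def)
qed

lemma sym_eval_eqI:
  assumes "alg_hom h" "\<And>v. h (sym_of v) = dual_app \<phi> v"
  shows "sym_eval \<phi> = h"
proof -
  have "linear (dual_app \<phi>)" using dual_app[of \<phi>] by simp
  from ex1_implies_ex[OF symalg_universal[OF this]] show ?thesis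
    unfolding sym_eval_def using assms symalg_universal[OF \<open>linear _\<close>] by (intro the1_equality) auto
qed

lemma sym_eval_monom: "sym_eval \<phi> (sym_monom vs) = prod_list (map (dual_app \<phi>) vs)"
  using alg_hom_sym_eval[of \<phi>] by (induction vs) (auto simp: alg_hom_def sym_eval_sym_of)

text \<open>The infimum in \<open>dual_norm\<close> is attained: for fixed \<open>v\<close> the
  inequality is closed in the constant, so constants slightly above \<open>i\<close>
  suffice.\<close>

lemma dual_ball_eq:
  assumes \<rho>: "seminorm \<rho>"
  shows "dual_ball \<rho> i = {\<phi>. \<forall>v. \<bar>dual_app \<phi> v\<bar> \<le> real i * \<rho> v}"
proof (intro equalityI subsetI)
  fix \<phi> assume "\<phi> \<in> {\<phi>. \<forall>v. \<bar>dual_app \<phi> v\<bar> \<le> real i * \<rho> v}"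
  then show "\<phi> \<in> dual_ball \<rho> i"
    unfolding dual_ball_def dual_norm_def by (auto intro!: Inf_lower)
next
  fix \<phi> assume "\<phi> \<in> dual_ball \<rho> i"
  then have le: "dual_norm \<rho> \<phi> \<le> ereal (real i)" by (simp add: dual_ball_def)
  have "\<bar>dual_app \<phi> v\<bar> \<le> real i * \<rho> v" for v
  proof (rule field_le_epsilon)
    fix e :: real assume "e > 0"
    define d where "d = e / (\<rho> v + 1)"
    have v: "0 \<le> \<rho> v" by (rule seminormD(1)[OF \<rho>])
    have d: "d > 0" using \<open>e > 0\<close> v by (simp add: d_def)
    have "dual_norm \<rho> \<phi> < ereal (real i + d)" using le d by (simp add: le_less_trans)
    then obtain C where C: "C < real i + d" "\<And>w. \<bar>dual_app \<phi> w\<bar> \<le> C * \<rho> w"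
      unfolding dual_norm_def Inf_less_iff by auto
    have "\<bar>dual_app \<phi> v\<bar> \<le> C * \<rho> v" by (rule C(2))
    also have "\<dots> \<le> (real i + d) * \<rho> v" using C(1) v by (intro mult_right_mono) auto
    also have "\<dots> = real i * \<rho> v + d * \<rho> v" by (rule distrib_right)
    also have "d * \<rho> v \<le> d * (\<rho> v + 1)" using d by simp
    also have "\<dots> = e" using v by (simp add: d_def)
    finally show "\<bar>dual_app \<phi> v\<bar> \<le> real i * \<rho> v + e" by simp
  qed
  then show "\<phi> \<in> {\<phi>. \<forall>v. \<bar>dual_app \<phi> v\<bar> \<le> real i * \<rho> v}" by blast
qed

lemma continuous_on_dual_app: "continuous_on UNIV (\<lambda>\<phi>. dual_app \<phi> v)"
proof -
  have "open {\<phi>. dual_app \<phi> v \<in> U}" if "open U" for U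
    unfolding open_algdual_def using that by (intro generate_topology.Basis) blast
  then show ?thesis
    by (auto simp: continuous_on_open_vimage[OF open_UNIV] vimage_def)
qed

lemma continuous_on_sym_eval: "continuous_on UNIV (\<lambda>\<phi>. sym_eval \<phi> f)"
proof (induction f rule: symalg_induct)
  case (monom c vs)
  have "continuous_on UNIV (\<lambda>\<phi>. prod_list (map (dual_app \<phi>) vs))"
    by (induction vs) (auto intro!: continuous_intros continuous_on_dual_app)
  moreover have "sym_eval \<phi> (c *\<^sub>R sym_monom vs) = c * prod_list (map (dual_app \<phi>) vs)" for \<phi>
    using alg_hom_sym_eval[of \<phi>] by (simp add: alg_hom_def linear_scale sym_eval_monom)
  ultimately show ?case by (auto intro!: continuous_intros)
next
  case (add f g)
  moreover have "sym_eval \<phi> (f + g) = sym_eval \<phi> f + sym_eval \<phi> g" for \<phi>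
    using alg_hom_sym_eval[of \<phi>] by (simp add: alg_hom_def linear_add)
  ultimately show ?case by (auto intro!: continuous_intros)
qed

text \<open>The topology of the dual is the trace of the product topology, which makes Tychonoff's
  theorem applicable.\<close>

lemma open_algdual_imp_open_fun:
  assumes "open (W :: 'v::real_vector algdual set)"
  shows "\<exists>U :: ('v \<Rightarrow> real) set. open U \<and> W = {\<phi>. dual_app \<phi> \<in> U}"
  using assms unfolding open_algdual_def
proof (induction rule: generate_topology.induct)
  case UNIV
  then show ?case by (intro exI[of _ UNIV]) simp
next
  case (Int a b)
  then obtain U V where "open U" "a = {\<phi>. dual_app \<phi> \<in> U}" "open V" "b = {\<phi>. dual_app \<phi> \<in> V}" by blast
  then show ?case by (intro exI[of _ "U \<inter> V"]) auto
next
  case (UN K)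
  then obtain U where "\<And>k. k \<in> K \<Longrightarrow> open (U k) \<and> k = {\<phi>. dual_app \<phi> \<in> U k}" by metis
  then show ?case by (intro exI[of _ "\<Union>k\<in>K. U k"]) blast
next
  case (Basis s)
  then obtain f and U :: "real set" where fU: "s = {\<phi>. dual_app \<phi> f \<in> U}" "open U" by blast
  have "open ((\<lambda>x :: 'v \<Rightarrow> real. x f) -` U)"
    using fU(2) by (intro open_vimage continuous_on_product_coordinates)
  then show ?case using fU(1) by (intro exI[of _ "(\<lambda>x. x f) -` U"]) auto
qed

text \<open>Banach-Alaoglu: linear functions form a closed subset of a product of compact
  intervals.\<close>

lemma compact_dual_set: "compact {\<phi> :: 'v::real_vector algdual. \<forall>v. \<bar>dual_app \<phi> v\<bar> \<le> r v}"
proof -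
  let ?P = "PiE UNIV (\<lambda>v :: 'v. {- r v..r v})"
  define K where "K = ?P \<inter> {x. linear x}"
  have "compactin (product_topology (\<lambda>_. euclidean) UNIV) ?P"
    by (simp add: compactin_PiE)
  then have "compact ?P" by (simp add: euclidean_product_topology)
  moreover have "closed {x :: 'v \<Rightarrow> real. linear x}"
  proof -
    have "{x :: 'v \<Rightarrow> real. linear x} =
        (\<Inter>u. \<Inter>v. {x. x (u + v) = x u + x v}) \<inter> (\<Inter>c. \<Inter>v. {x. x (c *\<^sub>R v) = c * x v})"
      by (auto simp: linear_iff)
    then show ?thesis
      by (auto intro!: closed_Int closed_INT closed_Collect_eq continuous_intros continuous_on_product_coordinates)
  qed
  ultimately have K: "compact K" unfolding K_def by (rule compact_Int_closed)
  have "continuous_on K Abs_algdual"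
    unfolding continuous_on_open_invariant
  proof (intro allI impI)
    fix W :: "'v algdual set" assume "open W"
    then obtain U :: "('v \<Rightarrow> real) set" where "open U" "W = {\<phi>. dual_app \<phi> \<in> U}"
      using open_algdual_imp_open_fun by blast
    then show "\<exists>A. open A \<and> A \<inter> K = Abs_algdual -` W \<inter> K"
      by (intro exI[of _ U]) (auto simp: K_def Abs_algdual_inverse)
  qed
  then have "compact (Abs_algdual ` K)" using K by (rule compact_continuous_image)
  also have "Abs_algdual ` K = {\<phi>. \<forall>v. \<bar>dual_app \<phi> v\<bar> \<le> r v}"
  proof (intro equalityI subsetI)
    fix \<phi> assume "\<phi> \<in> Abs_algdual ` K"
    then show "\<phi> \<in> {\<phi>. \<forall>v. \<bar>dual_app \<phi> v\<bar> \<le> r v}"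
      by (auto simp: K_def Abs_algdual_inverse abs_le_iff PiE_iff minus_le_iff)
  next
    fix \<phi> :: "'v algdual" assume "\<phi> \<in> {\<phi>. \<forall>v. \<bar>dual_app \<phi> v\<bar> \<le> r v}"
    then have "dual_app \<phi> \<in> K"
      using dual_app[of \<phi>] by (auto simp: K_def abs_le_iff PiE_iff minus_le_iff)
    then show "\<phi> \<in> Abs_algdual ` K" by (metis dual_app_inverse image_eqI)
  qed
  finally show ?thesis .
qed

lemma function_algebra_dual_ball:
  assumes \<rho>: "seminorm \<rho>"
  shows "compact_function_algebra sym_eval (dual_ball \<rho> i)"
proof
  show "compact (dual_ball \<rho> i)" unfolding dual_ball_eq[OF \<rho>] by (rule compact_dual_set)
  show "alg_hom (sym_eval \<phi>)" for \<phi> :: "'a algdual" by (rule alg_hom_sym_eval)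
  show "continuous_on UNIV (\<lambda>\<phi>. sym_eval \<phi> f)" for f :: "'a symalg" by (rule continuous_on_sym_eval)
  fix \<phi> \<psi> :: "'a algdual" assume "\<phi> \<noteq> \<psi>"
  then obtain v where "dual_app \<phi> v \<noteq> dual_app \<psi> v" by (auto simp flip: dual_app_inject simp: fun_eq_iff)
  then show "\<exists>f. sym_eval \<phi> f \<noteq> sym_eval \<psi> f" by (metis sym_eval_sym_of)
qed

text \<open>A character that is nonnegative on the cone restricts to \<open>V\<close> as a
  functional bounded by \<open>\<rho>\<close>, because \<open>\<rho> v + e + v\<close> lies in the
  cone for every \<open>e > 0\<close>. So it is the evaluation at a point where \<open>f\<close> is
  nonnegative, and adding a constant \<open>e > 0\<close> to \<open>f\<close> gives the strict
  positivity that the Positivstellensatz asks for.\<close>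

lemma power_positive_nonneg:
  fixes L :: "'v::real_vector symalg \<Rightarrow> real"
  assumes \<rho>: "seminorm \<rho>" and m: "m \<ge> 1" and L: "bounded_power_positive \<rho> m L"
    and f: "\<And>\<phi>. (\<And>v. \<bar>dual_app \<phi> v\<bar> \<le> \<rho> v) \<Longrightarrow> 0 \<le> sym_eval \<phi> f"
  shows "0 \<le> L f"
proof -
  interpret archimedean_preprime "bipolar_cone \<rho> m" by (rule archimedean_bipolar_cone[OF \<rho> m])
  have mem: "f + of_real e \<in> bipolar_cone \<rho> m" if "e > 0" for e
  proof (rule positivstellensatz)
    fix h :: "'v symalg \<Rightarrow> real"
    assume h: "alg_hom h" and pos: "\<And>t. t \<in> bipolar_cone \<rho> m \<Longrightarrow> 0 \<le> h t"
    have lin: "linear h" and h1: "h 1 = 1" using h by (auto simp: alg_hom_def)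
    have hr: "h (of_real r) = r" for r using linear_scale[OF lin, of r 1] h1 by (simp add: of_real_def)
    define \<phi> where "\<phi> = Abs_algdual (\<lambda>v. h (sym_of v))"
    have "linear (\<lambda>v. h (sym_of v))" using linear_compose[OF linear_sym_of lin] by (simp add: comp_def)
    then have \<phi>: "dual_app \<phi> v = h (sym_of v)" for v by (simp add: \<phi>_def Abs_algdual_inverse)
    have below: "- h (sym_of v) \<le> \<rho> v" for v
    proof (rule field_le_epsilon)
      fix e :: real assume "e > 0"
      then have "0 \<le> h (of_real (\<rho> v + e) + sym_of v)"
        by (intro pos sym_of_add_mem_bipolar_cone \<rho> m) simp
      then show "- h (sym_of v) \<le> \<rho> v + e" unfolding linear_add[OF lin] hr by simp
    qed
    have "\<bar>dual_app \<phi> v\<bar> \<le> \<rho> v" for v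
      using below[of v] below[of "- v"] \<phi>[of v]
      by (simp add: abs_le_iff seminorm_minus[OF \<rho>] linear_neg[OF linear_sym_of] linear_neg[OF lin])
    then have "0 \<le> sym_eval \<phi> f" by (rule f)
    also have "sym_eval \<phi> = h" using h \<phi> by (intro sym_eval_eqI) simp_all
    finally show "0 < h (f + of_real e)" using that by (simp add: linear_add[OF lin] hr)
  qed
  have lin: "linear L" using L by (simp add: bounded_power_positive_def)
  have "- L f \<le> 0 + e" if "e > 0" for e
  proof -
    define d where "d = e / (\<bar>L 1\<bar> + 1)"
    have d: "d > 0" using that by (simp add: d_def)
    have "0 \<le> L (f + of_real d)" using mem[OF d] L by (auto simp: bipolar_cone_def)
    also have "\<dots> = L f + d * L 1" by (simp add: linear_add[OF lin] of_real_def linear_scale[OF lin])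
    also have "d * L 1 \<le> d * (\<bar>L 1\<bar> + 1)" using d by (intro mult_left_mono) auto
    also have "\<dots> = e" by (simp add: d_def)
    finally show ?thesis by simp
  qed
  then have "- L f \<le> 0" by (rule field_le_epsilon)
  then show ?thesis by simp
qed

section \<open>The moment problem\<close>

lemma ex_representing_measure:
  assumes \<rho>: "seminorm \<rho>" and m: "m \<ge> 1" and L: "bounded_power_positive (\<lambda>v. real i * \<rho> v) m L"
  shows "\<exists>\<mu>. radon_measure \<mu> \<and> supported_by \<mu> (dual_ball \<rho> i) \<and> represents \<mu> L"
proof -
  interpret compact_function_algebra sym_eval "dual_ball \<rho> i"
    by (rule function_algebra_dual_ball[OF \<rho>])
  interpret positive_functional sym_eval "dual_ball \<rho> i" L
  proof (intro positive_functional.intro positive_functional_axioms.intro)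
    show "compact_function_algebra sym_eval (dual_ball \<rho> i)"
      by (rule function_algebra_dual_ball[OF \<rho>])
    show "linear L" using L by (simp add: bounded_power_positive_def)
    show "0 \<le> L f" if "\<And>\<phi>. \<phi> \<in> dual_ball \<rho> i \<Longrightarrow> 0 \<le> sym_eval \<phi> f" for f
      using that by (intro power_positive_nonneg[OF seminorm_scale_nat[OF \<rho>] m L]) (simp add: dual_ball_eq[OF \<rho>])
  qed
  have "supported_by riesz_measure (dual_ball \<rho> i)"
    using closed_X emeasure_riesz_measure_Compl_X by (simp add: supported_by_def)
  moreover have "represents riesz_measure L"
    unfolding represents_def
    by (auto simp: integral_riesz_measure intro!: integrable_ev finite_riesz_measure emeasure_riesz_measure_Compl_X)
  ultimately show ?thesis using radon_riesz_measure by blast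
qed

lemma represents_integral:
  assumes \<rho>: "seminorm \<rho>" and \<mu>: "radon_measure \<mu>" "supported_by \<mu> (dual_ball \<rho> i)"
  shows "represents \<mu> (\<lambda>f. \<integral>\<phi>. sym_eval \<phi> f \<partial>\<mu>)"
proof -
  interpret compact_function_algebra sym_eval "dual_ball \<rho> i"
    by (rule function_algebra_dual_ball[OF \<rho>])
  have "finite_measure \<mu>" by (rule finite_measure_radon[OF \<mu>(1) compact_X \<mu>(2)])
  then show ?thesis using \<mu> unfolding represents_def
    by (auto intro!: integrable_ev simp: supported_by_def radon_measureD(1))
qed

lemma represents_linear:
  assumes "represents \<mu> L"
  shows "linear L"
proof -
  have L: "L f = (\<integral>\<phi>. sym_eval \<phi> f \<partial>\<mu>)" "integrable \<mu> (\<lambda>\<phi>. sym_eval \<phi> f)" for f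
    using assms by (auto simp: represents_def)
  have "linear (sym_eval \<phi>)" for \<phi> :: "'a algdual" using alg_hom_sym_eval[of \<phi>] by (simp add: alg_hom_def)
  then show ?thesis
    by (intro linearI) (simp_all add: L linear_add linear_scale)
qed

lemma represents_nonneg:
  assumes "represents \<mu> L" "AE \<phi> in \<mu>. 0 \<le> sym_eval \<phi> f"
  shows "0 \<le> L f"
  using assms integral_nonneg_AE[of "\<lambda>\<phi>. sym_eval \<phi> f" \<mu>] by (simp add: represents_def)

text \<open>On the ball the values of a monomial are bounded by the product of the
  \<open>i * \<rho>\<close> values, so the total mass serves as constant.\<close>

lemma represents_monomial_bounded:
  assumes \<rho>: "seminorm \<rho>" and \<mu>: "radon_measure \<mu>" "supported_by \<mu> (dual_ball \<rho> i)"
    and L: "represents \<mu> L"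
  shows "monomial_bounded (\<lambda>v. real i * \<rho> v) L (measure \<mu> UNIV)"
  unfolding monomial_bounded_def
proof
  fix vs
  let ?B = "prod_list (map (\<lambda>v. real i * \<rho> v) vs)"
  have "compact (dual_ball \<rho> i)" unfolding dual_ball_eq[OF \<rho>] by (rule compact_dual_set)
  then interpret finite_measure \<mu> using \<mu> by (intro finite_measure_radon)
  have space: "space \<mu> = UNIV" using sets_eq_imp_space_eq[OF radon_measureD(1)[OF \<mu>(1)]] by simp
  have int: "integrable \<mu> (\<lambda>\<phi>. sym_eval \<phi> (sym_monom vs))" using L by (simp add: represents_def)
  have "\<bar>L (sym_monom vs)\<bar> \<le> (\<integral>\<phi>. \<bar>sym_eval \<phi> (sym_monom vs)\<bar> \<partial>\<mu>)"
    using L integral_abs_bound[of \<mu> "\<lambda>\<phi>. sym_eval \<phi> (sym_monom vs)"] by (simp add: represents_def)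
  also have "\<dots> \<le> (\<integral>\<phi>. ?B \<partial>\<mu>)"
  proof (rule integral_mono_AE)
    have "\<bar>sym_eval \<phi> (sym_monom vs)\<bar> \<le> ?B" if "\<phi> \<in> dual_ball \<rho> i" for \<phi>
    proof -
      have "\<bar>sym_eval \<phi> (sym_monom vs)\<bar> = prod_list (map (\<lambda>v. \<bar>dual_app \<phi> v\<bar>) vs)"
        unfolding sym_eval_monom by (induction vs) (simp_all add: abs_mult)
      also have "\<dots> \<le> ?B" using that by (intro prod_list_map_mono) (auto simp: dual_ball_eq[OF \<rho>])
      finally show ?thesis .
    qed
    then show "AE \<phi> in \<mu>. \<bar>sym_eval \<phi> (sym_monom vs)\<bar> \<le> ?B"
      by (intro eventually_mono[OF AE_supported_by[OF radon_measureD(1)[OF \<mu>(1)] \<mu>(2)]])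
  qed (use int in auto)
  finally show "\<bar>L (sym_monom vs)\<bar> \<le> measure \<mu> UNIV * ?B" by (simp add: space)
qed

text \<open>Growth of the even moments of \<open>v\<close> against the bound \<open>C * r\<^sup>2\<^sup>n\<close> excludes mass
  where \<open>\<bar>v\<bar> > r\<close>.\<close>

lemma represents_supported_by:
  assumes \<rho>: "seminorm \<rho>" and \<mu>: "radon_measure \<mu>" "finite_measure \<mu>"
    and L: "represents \<mu> L" and b: "monomial_bounded (\<lambda>v. real i * \<rho> v) L C"
  shows "supported_by \<mu> (dual_ball \<rho> i)"
proof -
  interpret finite_measure \<mu> by (rule \<mu>(2))
  note sets = radon_measureD(1)[OF \<mu>(1)]
  have "supported_by \<mu> {\<phi>. \<bar>dual_app \<phi> v\<bar> \<le> real i * \<rho> v}" for v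
  proof -
    let ?r = "real i * \<rho> v"
    have r: "0 \<le> ?r" using seminormD(1)[OF \<rho>, of v] by simp
    define A where "A s = {\<phi>. s \<le> \<bar>dual_app \<phi> v\<bar>}" for s
    have A: "closed (A s)" for s unfolding A_def
      by (intro closed_Collect_le continuous_intros continuous_on_dual_app)
    have null: "emeasure \<mu> (A s) = 0" if s: "?r < s" for s
    proof -
      have s0: "0 < s" using r s by simp
      \<comment> \<open>Chebyshev's inequality for the exponent \<open>2 * n\<close>; as
        \<open>?r < s\<close>, the bound tends to \<open>0\<close>.\<close>
      have le: "measure \<mu> (A s) \<le> C * ((?r / s) ^ 2) ^ n" for n
      proof -
        have eval: "sym_eval \<phi> (sym_monom (replicate (2 * n) v)) = dual_app \<phi> v ^ (2 * n)" for \<phi>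
          unfolding sym_eval_monom by (simp add: prod_list_replicate)
        have int: "integrable \<mu> (\<lambda>\<phi>. dual_app \<phi> v ^ (2 * n))"
            and Leq: "L (sym_monom (replicate (2 * n) v)) = (\<integral>\<phi>. dual_app \<phi> v ^ (2 * n) \<partial>\<mu>)"
          using L unfolding represents_def eval[symmetric] by blast+
        have "s ^ (2 * n) * measure \<mu> (A s) = (\<integral>\<phi>. s ^ (2 * n) * indicator (A s) \<phi> \<partial>\<mu>)"
          using A sets by simp
        also have "\<dots> \<le> (\<integral>\<phi>. dual_app \<phi> v ^ (2 * n) \<partial>\<mu>)"
        proof (rule integral_mono)
          show "integrable \<mu> (\<lambda>\<phi>. s ^ (2 * n) * indicator (A s) \<phi>)"
            using A sets by (intro integrable_mult_right integrable_real_indicator) (auto simp: emeasure_eq_measure)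
          fix \<phi>
          show "s ^ (2 * n) * indicator (A s) \<phi> \<le> dual_app \<phi> v ^ (2 * n)"
          proof (cases "\<phi> \<in> A s")
            case True
            then have "s ^ (2 * n) \<le> \<bar>dual_app \<phi> v\<bar> ^ (2 * n)" using s0 by (intro power_mono) (auto simp: A_def)
            then show ?thesis using True by (simp add: power_even_abs)
          qed (simp add: power_mult)
        qed (rule int)
        also have "\<dots> \<le> \<bar>L (sym_monom (replicate (2 * n) v))\<bar>" unfolding Leq by (rule abs_ge_self)
        also have "\<dots> \<le> C * ?r ^ (2 * n)"
          using b[unfolded monomial_bounded_def, rule_format, of "replicate (2 * n) v"] by (simp add: prod_list_replicate)
        finally have "measure \<mu> (A s) \<le> C * ?r ^ (2 * n) / s ^ (2 * n)" using s0 by (simp add: field_simps)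
        then show ?thesis by (simp add: power_divide power_mult)
      qed
      have "0 \<le> (?r / s) ^ 2" "(?r / s) ^ 2 < 1" using r s s0 by (auto simp: power_less_one_iff abs_square_less_1)
      then have "(\<lambda>n. C * ((?r / s) ^ 2) ^ n) \<longlonglongrightarrow> C * 0"
        by (intro tendsto_mult tendsto_const LIMSEQ_realpow_zero)
      then have "measure \<mu> (A s) \<le> C * 0" by (rule LIMSEQ_le_const) (use le in blast)
      then show ?thesis by (simp add: emeasure_eq_measure measure_le_0_iff)
    qed
    have "- {\<phi>. \<bar>dual_app \<phi> v\<bar> \<le> ?r} = (\<Union>n. A (?r + 1 / real (Suc n)))"
    proof (intro equalityI subsetI)
      fix \<phi> assume "\<phi> \<in> - {\<phi>. \<bar>dual_app \<phi> v\<bar> \<le> ?r}"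
      then have "0 < \<bar>dual_app \<phi> v\<bar> - ?r" by simp
      then obtain n where "1 / real (Suc n) < \<bar>dual_app \<phi> v\<bar> - ?r" using nat_approx_posE by blast
      then have "\<phi> \<in> A (?r + 1 / real (Suc n))" by (simp add: A_def)
      then show "\<phi> \<in> (\<Union>n. A (?r + 1 / real (Suc n)))" by blast
    next
      fix \<phi> assume "\<phi> \<in> (\<Union>n. A (?r + 1 / real (Suc n)))"
      then obtain n where "?r + 1 / real (Suc n) \<le> \<bar>dual_app \<phi> v\<bar>" by (auto simp: A_def)
      moreover have "0 < 1 / real (Suc n)" by simp
      ultimately have "?r < \<bar>dual_app \<phi> v\<bar>" by linarith
      then show "\<phi> \<in> - {\<phi>. \<bar>dual_app \<phi> v\<bar> \<le> ?r}" by simp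
    qed
    moreover have "emeasure \<mu> (\<Union>n. A (?r + 1 / real (Suc n))) = 0"
      using A sets by (intro emeasure_UN_eq_0 null) (auto simp: add_pos_pos)
    moreover have "closed {\<phi>. \<bar>dual_app \<phi> v\<bar> \<le> ?r}"
      by (intro closed_Collect_le continuous_intros continuous_on_dual_app)
    ultimately show ?thesis by (simp add: supported_by_def)
  qed
  \<comment> \<open>There may be uncountably many \<open>v\<close>; the Radon property handles the
    intersection.\<close>
  then have "supported_by \<mu> (\<Inter>v. {\<phi>. \<bar>dual_app \<phi> v\<bar> \<le> real i * \<rho> v})"
    by (intro supported_by_INT[OF \<mu>(1)] closed_Collect_le continuous_intros continuous_on_dual_app)
  also have "(\<Inter>v. {\<phi>. \<bar>dual_app \<phi> v\<bar> \<le> real i * \<rho> v}) = dual_ball \<rho> i"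
    by (auto simp: dual_ball_eq[OF \<rho>])
  finally show ?thesis .
qed

text \<open>Since \<open>M\<close> absorbs \<open>2d\<close>-th powers, each
  \<open>g \<in> M\<close> has nonnegative localised integrals and is therefore nonnegative almost
  everywhere. The exceptional open null sets, possibly uncountably many, are joined by inner
  regularity.\<close>

lemma represents_nonneg_on_module_iff:
  assumes \<rho>: "seminorm \<rho>" and \<mu>: "radon_measure \<mu>" "supported_by \<mu> (dual_ball \<rho> i)"
    and L: "represents \<mu> L" and d: "d \<ge> 1" and M: "power_module (2 * d) M"
  shows "L ` M \<subseteq> {0..} \<longleftrightarrow> supported_by \<mu> (nonneg_set M \<inter> dual_ball \<rho> i)"
proof
  interpret compact_function_algebra sym_eval "dual_ball \<rho> i"
    by (rule function_algebra_dual_ball[OF \<rho>])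
  have eq: "nonneg_set M = (\<Inter>g\<in>M. {\<phi>. 0 \<le> sym_eval \<phi> g})" by (auto simp: nonneg_set_def)
  assume pos: "L ` M \<subseteq> {0..}"
  have "supported_by \<mu> {\<phi>. 0 \<le> sym_eval \<phi> g}" if "g \<in> M" for g
  proof -
    have "0 \<le> (\<integral>\<phi>. sym_eval \<phi> (a ^ (2 * d) * g) \<partial>\<mu>)" for a
    proof -
      have "a ^ (2 * d) * g \<in> M" using M that by (simp add: power_module_def)
      then have "0 \<le> L (a ^ (2 * d) * g)" using pos by auto
      then show ?thesis using L by (simp add: represents_def)
    qed
    from nonneg_of_localized_integrals[OF \<mu> d this] have "emeasure \<mu> {\<phi>. sym_eval \<phi> g < 0} = 0" .
    moreover have "- {\<phi>. 0 \<le> sym_eval \<phi> g} = {\<phi>. sym_eval \<phi> g < 0}" by auto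
    ultimately show ?thesis using closed_ev_ge by (simp add: supported_by_def)
  qed
  then have "supported_by \<mu> (nonneg_set M)"
    unfolding eq by (intro supported_by_INT[OF \<mu>(1)] closed_ev_ge)
  moreover have "closed (nonneg_set M)" unfolding eq by (intro closed_INT ballI closed_ev_ge)
  ultimately show "supported_by \<mu> (nonneg_set M \<inter> dual_ball \<rho> i)"
    using \<mu> closed_X by (intro supported_by_Int)
next
  assume "supported_by \<mu> (nonneg_set M \<inter> dual_ball \<rho> i)"
  then have AE: "AE \<phi> in \<mu>. \<phi> \<in> nonneg_set M \<inter> dual_ball \<rho> i"
    by (rule AE_supported_by[OF radon_measureD(1)[OF \<mu>(1)]])
  have "0 \<le> L g" if "g \<in> M" for g
    by (rule represents_nonneg[OF L eventually_mono[OF AE]]) (use that in \<open>auto simp: nonneg_set_def\<close>)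
  then show "L ` M \<subseteq> {0..}" by auto
qed

lemma power_mem_sums_of_powers: "a ^ m \<in> sums_of_powers m"
  unfolding sums_of_powers_def by (intro CollectI exI[of _ 1] exI[of _ "\<lambda>_. a"]) simp

theorem corollary5p2:
  fixes S :: "('v::real_vector \<Rightarrow> real) set" and d :: nat
  assumes "\<forall>\<rho>\<in>S. seminorm \<rho>"
    and "directed_family S"
    and "d \<ge> 1"
  shows
    "((\<forall>L\<in>pos_functionals S d. \<exists>!\<mu>. \<mu> \<in> ball_measures S \<and> represents \<mu> L) \<and>
      (\<forall>\<mu>\<in>ball_measures S. \<exists>!L. L \<in> pos_functionals S d \<and> represents \<mu> L)) \<and>
     (\<forall>L\<in>pos_functionals S d. \<forall>\<mu>\<in>ball_measures S. represents \<mu> L \<longrightarrow>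
       (\<forall>\<rho>\<in>S. \<forall>i\<ge>1. supported_by \<mu> (dual_ball \<rho> i) \<longleftrightarrow>
          continuous_map (seminorm_topology {proj_ext (\<lambda>v. real i * \<rho> v)}) euclideanreal L)) \<and>
     (\<forall>L\<in>pos_functionals S d. \<forall>\<mu>\<in>ball_measures S. represents \<mu> L \<longrightarrow>
       (\<forall>\<rho>\<in>S. \<forall>i\<ge>1. supported_by \<mu> (dual_ball \<rho> i) \<longrightarrow>
          (\<forall>M. power_module (2 * d) M \<longrightarrow>
             (L ` M \<subseteq> {0..} \<longleftrightarrow> supported_by \<mu> (nonneg_set M \<inter> dual_ball \<rho> i)))))"
proof -
  have semi: "seminorm \<rho>" if "\<rho> \<in> S" for \<rho> using assms(1) that by blast
  have finite: "finite_measure \<mu>" if \<mu>: "\<mu> \<in> ball_measures S" for \<mu> :: "'v algdual measure"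
  proof -
    obtain \<rho> i where \<rho>: "\<rho> \<in> S" and rad: "radon_measure \<mu>" "supported_by \<mu> (dual_ball \<rho> i)"
      using \<mu> by (auto simp: ball_measures_def)
    have "compact (dual_ball \<rho> i)" unfolding dual_ball_eq[OF semi[OF \<rho>]] by (rule compact_dual_set)
    then show ?thesis by (rule finite_measure_radon[OF rad(1) _ rad(2)])
  qed
  have "\<exists>!\<mu>. \<mu> \<in> ball_measures S \<and> represents \<mu> L" if L: "L \<in> pos_functionals S d" for L
  proof -
    have lin: "linear L" and cont: "continuous_map (sym_topology S) euclideanreal L"
      and pos: "L ` sums_of_powers (2 * d) \<subseteq> {0..}" using L by (auto simp: pos_functionals_def)
    obtain \<rho> i C where \<rho>: "\<rho> \<in> S" and i: "i \<ge> (1::nat)" and b: "monomial_bounded (\<lambda>v. real i * \<rho> v) L C"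
      using continuous_map_sym_topologyD[OF assms(1,2) lin cont] by blast
    have "0 \<le> L (a ^ (2 * d))" for a using pos power_mem_sums_of_powers by fastforce
    then have "bounded_power_positive (\<lambda>v. real i * \<rho> v) (2 * d) L"
      using lin b unfolding bounded_power_positive_def by blast
    from ex_representing_measure[OF semi[OF \<rho>] _ this] assms(3) obtain \<mu> where
      \<mu>: "radon_measure \<mu>" "supported_by \<mu> (dual_ball \<rho> i)" "represents \<mu> L" by auto
    show ?thesis
    proof (rule ex1I[of _ \<mu>])
      show "\<mu> \<in> ball_measures S \<and> represents \<mu> L" using \<mu> \<rho> i by (auto simp: ball_measures_def)
      fix \<nu> assume \<nu>: "\<nu> \<in> ball_measures S \<and> represents \<nu> L"
      then have rad: "radon_measure \<nu>" by (simp add: ball_measures_def)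
      \<comment> \<open>A competing measure may be given on another ball. The bound on
        \<open>L\<close> places it on the ball of \<open>\<mu>\<close>, where uniqueness on a
        compact set applies.\<close>
      have "supported_by \<nu> (dual_ball \<rho> i)"
        using represents_supported_by[OF semi[OF \<rho>] rad finite _ b] \<nu> by blast
      then show "\<nu> = \<mu>"
        using compact_function_algebra.radon_measure_unique[OF function_algebra_dual_ball[OF semi[OF \<rho>]] rad _ \<mu>(1,2)]
          \<nu> \<mu>(3) by (simp add: represents_def)
    qed
  qed
  moreover have "\<exists>!L. L \<in> pos_functionals S d \<and> represents \<mu> L" if "\<mu> \<in> ball_measures S" for \<mu>
  proof -
    obtain \<rho> i where \<rho>: "\<rho> \<in> S" and i: "i \<ge> 1" and \<mu>: "radon_measure \<mu>" "supported_by \<mu> (dual_ball \<rho> i)"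
      using \<open>\<mu> \<in> ball_measures S\<close> by (auto simp: ball_measures_def)
    let ?p = "\<lambda>v. real i * \<rho> v"
    define L where "L f = (\<integral>\<phi>. sym_eval \<phi> f \<partial>\<mu>)" for f
    have rep: "represents \<mu> L" using represents_integral[OF semi[OF \<rho>] \<mu>] by (simp add: L_def[abs_def])
    have lin: "linear L" by (rule represents_linear[OF rep])
    have "monomial_bounded ?p L (measure \<mu> UNIV)"
      by (rule represents_monomial_bounded[OF semi[OF \<rho>] \<mu> rep])
    then have "\<bar>L f\<bar> \<le> measure \<mu> UNIV * proj_ext ?p f" for f
      by (intro proj_ext_bound lin seminorm_scale_nat semi \<rho>)
    then have "continuous_map (sym_topology S) euclideanreal L"
      unfolding sym_topology_def using \<rho> i
      by (intro continuous_map_seminorm_topologyI[where p = "proj_ext ?p"] seminorm_proj_ext seminorm_scale_nat semi lin) auto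
    moreover have "0 \<le> L (\<Sum>k<n. a k ^ (2 * d))" for n and a :: "nat \<Rightarrow> 'v symalg"
    proof (rule represents_nonneg[OF rep], rule AE_I2)
      fix \<phi> :: "'v algdual"
      have hom: "alg_hom (sym_eval \<phi>)" by (rule alg_hom_sym_eval)
      have "sym_eval \<phi> (x ^ k) = sym_eval \<phi> x ^ k" for x k
        using hom by (induction k) (auto simp: alg_hom_def)
      then show "0 \<le> sym_eval \<phi> (\<Sum>k<n. a k ^ (2 * d))"
        using hom by (simp add: alg_hom_def linear_sum sum_nonneg power_mult)
    qed
    ultimately have "L \<in> pos_functionals S d"
      using lin by (auto simp: pos_functionals_def sums_of_powers_def)
    moreover have "K = L" if "represents \<mu> K" for K
      using that rep by (auto simp: represents_def fun_eq_iff)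
    ultimately show ?thesis using rep by blast
  qed
  moreover have "supported_by \<mu> (dual_ball \<rho> i) \<longleftrightarrow>
      continuous_map (seminorm_topology {proj_ext (\<lambda>v. real i * \<rho> v)}) euclideanreal L"
    if "\<mu> \<in> ball_measures S" "represents \<mu> L" "\<rho> \<in> S" for L \<mu> \<rho> i
  proof -
    have "radon_measure \<mu>" using that(1) by (simp add: ball_measures_def)
    \<comment> \<open>Continuity is exchanged for boundedness on monomials; integration gives it
      from the support, and the growth of moments gives the support back.\<close>
    then show ?thesis
      unfolding continuous_map_proj_ext_iff[OF seminorm_scale_nat[OF semi[OF that(3)]] represents_linear[OF that(2)]]
      using represents_monomial_bounded[OF semi[OF that(3)] _ _ that(2)]
        represents_supported_by[OF semi[OF that(3)] _ finite[OF that(1)] that(2)] by blast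
  qed
  moreover have "L ` M \<subseteq> {0..} \<longleftrightarrow> supported_by \<mu> (nonneg_set M \<inter> dual_ball \<rho> i)"
    if "\<mu> \<in> ball_measures S" "represents \<mu> L" "\<rho> \<in> S" "supported_by \<mu> (dual_ball \<rho> i)" "power_module (2 * d) M" for L \<mu> \<rho> i M
    using that(1) by (intro represents_nonneg_on_module_iff[OF semi[OF that(3)] _ that(4,2) assms(3) that(5)])
      (simp add: ball_measures_def)
  ultimately show ?thesis by simp
qed

end
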